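(* Let $k$ be a field and let $Q$ be the quiver with vertex set $\{1,\dots,8\}$ and arrows $a:1\to 4$, $b:2\to 4$, $c:3\to 4$, $d:4\to 5$, $e:5\to 6$, $f:5\to 7$, $g:5\to 8$. Let $\alpha=(1,1,1,8,12,2,7,7)$, which is a positive real root for $Q$, and let $X_\alpha$ be the unique (up to isomorphism) indecomposable representation of $Q$ over $k$ of dimension vector $\alpha$. Then there exists no real Schur root $\beta$ for $Q$ with both of the following properties: (i) $X_\alpha \in \mathfrak{M}^{X_\beta}_{X_\beta}$, and (ii) $\operatorname{Hom}_{kQ}(X_\alpha,X_\beta)\neq 0$ or $\operatorname{Hom}_{kQ}(X_\beta,X_\alpha)\neq 0$.
   Context: All representations are finite dimensional over the field $k$; they are identified with $kQ$-modules. A representation $X$ of $Q$ consists of a vector space $X_i$ for each vertex $i$ and a linear map $X_{i}\to X_{j}$ for each arrow $i\to j$; its dimension vector is $(\dim X_i)_i$, with coordinates listed in the order of the vertices $1,\dots,8$. The Ringel form on $\mathbb{Z}^{Q_0}$ is $\langle\alpha,\beta\rangle=\sum_{i\in Q_0}\alpha[i]\beta[i]-\sum_{x: i\to j \text{ in } Q_1}\alpha[i]\beta[j]$, and $(\alpha,\beta)=\langle\alpha,\beta\rangle+\langle\beta,\alpha\rangle$. For each vertex $i$ (there are no loops), $e_i$ is the coordinate vector at $i$ and $s_i(\alpha)=\alpha-(\alpha,e_i)e_i$ is the simple reflection. The Weyl group $W$ is generated by the $s_i$. A (positive) real root is a vector $\alpha> 0$ (i.e. nonzero with nonnegative coordinates)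 of the form $w(e_i)$ with $w\in W$, $i\in Q_0$. By a theorem of Kac and Schofield, for each positive real root $\beta$ there is, up to isomorphism, a unique indecomposable representation over $k$ of dimension vector $\beta$; it is denoted $X_\beta$. A positive real root $\beta$ is a real Schur root if $\operatorname{End}_{kQ}(X_\beta)=k$; then also $\operatorname{Ext}^1_{kQ}(X_\beta,X_\beta)=0$. For a representation $S$ with $\operatorname{End}_{kQ}(S)=k$ and $\operatorname{Ext}^1_{kQ}(S,S)=0$: $\mathfrak{M}^S$ is the full subcategory of all representations $X$ with $\operatorname{Ext}^1_{kQ}(S,X)=0$ such that no (nonzero) direct summand of $X$ can be embedded into a direct sum of copies of $S$; $\mathfrak{M}_S$ is the full subcategory of all representations $X$ with $\operatorname{Ext}^1_{kQ}(X,S)=0$ such that no (nonzero) direct summand of $X$ is a quotient of a direct sum of copies of $S$; and $\mathfrak{M}^S_S=\mathfrak{M}^S\cap\mathfrak{M}_S$. *)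

theory Defs
  imports
    Complex_Main
    "HOL-Library.Function_Algebras"
    "HOL-Library.Product_Plus"
    "Graph_Theory.Digraph"
begin

text \<open>
  A quiver is a \<^typ>\<open>('a, 'b) pre_digraph\<close>; the arrow \<open>x\<close> runs from \<open>tail G x\<close> to \<open>head G x\<close>.
  The field \<open>k\<close> is the type \<open>'k\<close>.
\<close>

section \<open>Ringel form, Weyl group, real roots\<close>

definition ringel_form :: "('a, 'b) pre_digraph \<Rightarrow> ('a \<Rightarrow> int) \<Rightarrow> ('a \<Rightarrow> int) \<Rightarrow> int" where
  "ringel_form G \<alpha> \<beta> =
     (\<Sum>i\<in>verts G. \<alpha> i * \<beta> i) - (\<Sum>x\<in>arcs G. \<alpha> (tail G x) * \<beta> (head G x))"

definition sym_form :: "('a, 'b) pre_digraph \<Rightarrow> ('a \<Rightarrow> int) \<Rightarrow> ('a \<Rightarrow> int) \<Rightarrow> int" where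
  "sym_form G \<alpha> \<beta> = ringel_form G \<alpha> \<beta> + ringel_form G \<beta> \<alpha>"

definition unit_vec :: "'a \<Rightarrow> 'a \<Rightarrow> int" where
  "unit_vec i = (\<lambda>j. if j = i then 1 else 0)"

definition simple_reflection ::
    "('a, 'b) pre_digraph \<Rightarrow> 'a \<Rightarrow> ('a \<Rightarrow> int) \<Rightarrow> ('a \<Rightarrow> int)" where
  "simple_reflection G i \<alpha> = (\<lambda>j. \<alpha> j - sym_form G \<alpha> (unit_vec i) * unit_vec i j)"

text \<open>Closure under inverses is automatic, the simple reflections being involutions
  (at vertices without loops).\<close>

inductive_set weyl_group :: "('a, 'b) pre_digraph \<Rightarrow> (('a \<Rightarrow> int) \<Rightarrow> ('a \<Rightarrow> int)) set"
  for G where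
  one: "id \<in> weyl_group G"
| step: "\<lbrakk>i \<in> verts G; w \<in> weyl_group G\<rbrakk> \<Longrightarrow> simple_reflection G i \<circ> w \<in> weyl_group G"

text \<open>The vectors \<open>w e\<^sub>i\<close> vanish outside \<^term>\<open>verts G\<close>, so that they are elements of
  \<open>\<int>\<close> to the power \<^term>\<open>verts G\<close>, extended by zero.\<close>

definition positive_real_root :: "('a, 'b) pre_digraph \<Rightarrow> ('a \<Rightarrow> int) \<Rightarrow> bool" where
  "positive_real_root G \<alpha> \<longleftrightarrow>
     (\<exists>w\<in>weyl_group G. \<exists>i\<in>verts G. \<alpha> = w (unit_vec i)) \<and>
     (\<forall>i. 0 \<le> \<alpha> i) \<and> (\<exists>i. \<alpha> i \<noteq> 0)"

section \<open>Finite dimensional representations\<close>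

text \<open>
  The spaces at the vertices are finite dimensional subspaces of one ambient vector space
  \<open>'v\<close> of arbitrary dimension with scalar multiplication \<open>smul X\<close>. Only the values of \<open>amap X x\<close>
  on the space at the tail of \<open>x\<close> matter. This is no restriction: any family of vector spaces
  embeds into its direct sum.
\<close>

record ('k, 'v, 'a, 'b) qrep =
  smul :: "'k \<Rightarrow> 'v \<Rightarrow> 'v"
  space :: "'a \<Rightarrow> 'v set"
  amap :: "'b \<Rightarrow> 'v \<Rightarrow> 'v"

definition linear_map_on ::
    "('k \<Rightarrow> 'v \<Rightarrow> 'v) \<Rightarrow> 'v set \<Rightarrow> ('k \<Rightarrow> 'w \<Rightarrow> 'w) \<Rightarrow> 'w set \<Rightarrow>
     ('v::ab_group_add \<Rightarrow> 'w::ab_group_add) \<Rightarrow> bool" where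
  "linear_map_on s1 U s2 W f \<longleftrightarrow>
     (\<forall>u\<in>U. f u \<in> W) \<and>
     (\<forall>u\<in>U. \<forall>v\<in>U. f (u + v) = f u + f v) \<and>
     (\<forall>c. \<forall>u\<in>U. f (s1 c u) = s2 c (f u))"

definition is_rep ::
    "('a, 'b) pre_digraph \<Rightarrow> ('k::field, 'v::ab_group_add, 'a, 'b) qrep \<Rightarrow> bool" where
  "is_rep G X \<longleftrightarrow>
     vector_space (smul X) \<and>
     (\<forall>i\<in>verts G. module.subspace (smul X) (space X i) \<and>
        (\<exists>B. finite B \<and> module.span (smul X) B = space X i)) \<and>
     (\<forall>x\<in>arcs G. linear_map_on (smul X) (space X (tail G x))
        (smul X) (space X (head G x)) (amap X x))"

definition dim_vec ::
    "('a, 'b) pre_digraph \<Rightarrow> ('k::field, 'v::ab_group_add, 'a, 'b) qrep \<Rightarrow> 'a \<Rightarrow> int" where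
  "dim_vec G X = (\<lambda>i. if i \<in> verts G then int (vector_space.dim (smul X) (space X i)) else 0)"

definition is_zero_rep ::
    "('a, 'b) pre_digraph \<Rightarrow> ('k::field, 'v::ab_group_add, 'a, 'b) qrep \<Rightarrow> bool" where
  "is_zero_rep G X \<longleftrightarrow> (\<forall>i\<in>verts G. space X i = {0})"

subsection \<open>Homomorphisms\<close>

definition is_hom ::
    "('a, 'b) pre_digraph \<Rightarrow> ('k::field, 'v::ab_group_add, 'a, 'b) qrep \<Rightarrow>
     ('k, 'w::ab_group_add, 'a, 'b) qrep \<Rightarrow> ('a \<Rightarrow> 'v \<Rightarrow> 'w) \<Rightarrow> bool" where
  "is_hom G X Y f \<longleftrightarrow>
     (\<forall>i\<in>verts G. linear_map_on (smul X) (space X i) (smul Y) (space Y i) (f i)) \<and>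
     (\<forall>x\<in>arcs G. \<forall>v\<in>space X (tail G x).
        f (head G x) (amap X x v) = amap Y x (f (tail G x) v))"

definition is_mono ::
    "('a, 'b) pre_digraph \<Rightarrow> ('k::field, 'v::ab_group_add, 'a, 'b) qrep \<Rightarrow>
     ('k, 'w::ab_group_add, 'a, 'b) qrep \<Rightarrow> ('a \<Rightarrow> 'v \<Rightarrow> 'w) \<Rightarrow> bool" where
  "is_mono G X Y f \<longleftrightarrow> is_hom G X Y f \<and> (\<forall>i\<in>verts G. inj_on (f i) (space X i))"

definition is_epi ::
    "('a, 'b) pre_digraph \<Rightarrow> ('k::field, 'v::ab_group_add, 'a, 'b) qrep \<Rightarrow>
     ('k, 'w::ab_group_add, 'a, 'b) qrep \<Rightarrow> ('a \<Rightarrow> 'v \<Rightarrow> 'w) \<Rightarrow> bool" where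
  "is_epi G X Y f \<longleftrightarrow> is_hom G X Y f \<and> (\<forall>i\<in>verts G. f i ` space X i = space Y i)"

definition Hom_nonzero ::
    "('a, 'b) pre_digraph \<Rightarrow> ('k::field, 'v::ab_group_add, 'a, 'b) qrep \<Rightarrow>
     ('k, 'w::ab_group_add, 'a, 'b) qrep \<Rightarrow> bool" where
  "Hom_nonzero G X Y \<longleftrightarrow>
     (\<exists>f. is_hom G X Y f \<and> (\<exists>i\<in>verts G. \<exists>v\<in>space X i. f i v \<noteq> 0))"

text \<open>\<open>End(X) = k\<close>: the canonical map from \<open>k\<close> to \<open>End(X)\<close> is bijective.\<close>

definition End_is_field ::
    "('a, 'b) pre_digraph \<Rightarrow> ('k::field, 'v::ab_group_add, 'a, 'b) qrep \<Rightarrow> bool" where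
  "End_is_field G X \<longleftrightarrow>
     \<not> is_zero_rep G X \<and>
     (\<forall>f. is_hom G X X f \<longrightarrow> (\<exists>c. \<forall>i\<in>verts G. \<forall>v\<in>space X i. f i v = smul X c v))"

subsection \<open>Direct sums\<close>

definition is_subrep ::
    "('a, 'b) pre_digraph \<Rightarrow> ('k::field, 'v::ab_group_add, 'a, 'b) qrep \<Rightarrow>
     ('k, 'v, 'a, 'b) qrep \<Rightarrow> bool" where
  "is_subrep G Y X \<longleftrightarrow>
     is_rep G Y \<and> smul Y = smul X \<and> amap Y = amap X \<and> (\<forall>i\<in>verts G. space Y i \<subseteq> space X i)"

definition is_internal_sum ::
    "('a, 'b) pre_digraph \<Rightarrow> ('k::field, 'v::ab_group_add, 'a, 'b) qrep \<Rightarrow>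
     ('k, 'v, 'a, 'b) qrep \<Rightarrow> ('k, 'v, 'a, 'b) qrep \<Rightarrow> bool" where
  "is_internal_sum G X Y Z \<longleftrightarrow>
     is_subrep G Y X \<and> is_subrep G Z X \<and>
     (\<forall>i\<in>verts G. space Y i \<inter> space Z i = {0} \<and>
        space X i = {y + z | y z. y \<in> space Y i \<and> z \<in> space Z i})"

definition direct_summand ::
    "('a, 'b) pre_digraph \<Rightarrow> ('k::field, 'v::ab_group_add, 'a, 'b) qrep \<Rightarrow>
     ('k, 'v, 'a, 'b) qrep \<Rightarrow> bool" where
  "direct_summand G Y X \<longleftrightarrow> (\<exists>Z. is_internal_sum G X Y Z)"

definition indecomposable ::
    "('a, 'b) pre_digraph \<Rightarrow> ('k::field, 'v::ab_group_add, 'a, 'b) qrep \<Rightarrow> bool" where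
  "indecomposable G X \<longleftrightarrow>
     is_rep G X \<and> \<not> is_zero_rep G X \<and>
     (\<forall>Y Z. is_internal_sum G X Y Z \<longrightarrow> is_zero_rep G Y \<or> is_zero_rep G Z)"

text \<open>The direct sum of \<open>n\<close> copies of \<open>S\<close>, with elements the sequences vanishing from \<open>n\<close> on.\<close>

definition rep_power ::
    "('k::field, 'v::ab_group_add, 'a, 'b) qrep \<Rightarrow> nat \<Rightarrow> ('k, nat \<Rightarrow> 'v, 'a, 'b) qrep" where
  "rep_power S n =
     \<lparr>smul = (\<lambda>c u j. smul S c (u j)),
      space = (\<lambda>i. {u. (\<forall>j<n. u j \<in> space S i) \<and> (\<forall>j\<ge>n. u j = 0)}),
      amap = (\<lambda>x u j. if j < n then amap S x (u j) else 0)\<rparr>"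

subsection \<open>Vanishing of \<open>Ext\<^sup>1\<close>\<close>

text \<open>
  \<open>Ext\<^sup>1(X, Y) = 0\<close> in the sense of Yoneda: every short exact sequence
  \<open>0 \<rightarrow> Y \<rightarrow> E \<rightarrow> X \<rightarrow> 0\<close> splits. The ambient type \<open>'w \<times> 'v\<close> of \<open>E\<close> does not restrict the
  extensions, since \<open>E\<^sub>i\<close> is isomorphic to the product of \<open>Y\<^sub>i\<close> and \<open>X\<^sub>i\<close> as a vector space.
\<close>

definition short_exact ::
    "('a, 'b) pre_digraph \<Rightarrow> ('k::field, 'w::ab_group_add, 'a, 'b) qrep \<Rightarrow>
     ('k, 'u::ab_group_add, 'a, 'b) qrep \<Rightarrow> ('k, 'v::ab_group_add, 'a, 'b) qrep \<Rightarrow>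
     ('a \<Rightarrow> 'w \<Rightarrow> 'u) \<Rightarrow> ('a \<Rightarrow> 'u \<Rightarrow> 'v) \<Rightarrow> bool" where
  "short_exact G Y E X f g \<longleftrightarrow>
     is_rep G Y \<and> is_rep G E \<and> is_rep G X \<and> is_mono G Y E f \<and> is_epi G E X g \<and>
     (\<forall>i\<in>verts G. f i ` space Y i = {e \<in> space E i. g i e = 0})"

definition Ext1_vanishes ::
    "('a, 'b) pre_digraph \<Rightarrow> ('k::field, 'v::ab_group_add, 'a, 'b) qrep \<Rightarrow>
     ('k, 'w::ab_group_add, 'a, 'b) qrep \<Rightarrow> bool" where
  "Ext1_vanishes G X Y \<longleftrightarrow>
     (\<forall>(E :: ('k, 'w \<times> 'v, 'a, 'b) qrep) f g.
        short_exact G Y E X f g \<longrightarrow>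
        (\<exists>h. is_hom G X E h \<and> (\<forall>i\<in>verts G. \<forall>v\<in>space X i. g i (h i v) = v)))"

section \<open>The subcategories \<open>\<MM>\<^sup>S\<close>, \<open>\<MM>\<^sub>S\<close> and their intersection\<close>

definition M_upper ::
    "('a, 'b) pre_digraph \<Rightarrow> ('k::field, 'w::ab_group_add, 'a, 'b) qrep \<Rightarrow>
     ('k, 'v::ab_group_add, 'a, 'b) qrep set" where
  "M_upper G S =
     {X. is_rep G X \<and> Ext1_vanishes G S X \<and>
        (\<forall>Y. direct_summand G Y X \<and> \<not> is_zero_rep G Y \<longrightarrow>
           \<not> (\<exists>n f. is_mono G Y (rep_power S n) f))}"

definition M_lower ::
    "('a, 'b) pre_digraph \<Rightarrow> ('k::field, 'w::ab_group_add, 'a, 'b) qrep \<Rightarrow>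
     ('k, 'v::ab_group_add, 'a, 'b) qrep set" where
  "M_lower G S =
     {X. is_rep G X \<and> Ext1_vanishes G X S \<and>
        (\<forall>Y. direct_summand G Y X \<and> \<not> is_zero_rep G Y \<longrightarrow>
           \<not> (\<exists>n f. is_epi G (rep_power S n) Y f))}"

definition M_both ::
    "('a, 'b) pre_digraph \<Rightarrow> ('k::field, 'w::ab_group_add, 'a, 'b) qrep \<Rightarrow>
     ('k, 'v::ab_group_add, 'a, 'b) qrep set" where
  "M_both G S = M_upper G S \<inter> M_lower G S"

section \<open>The representations \<open>X\<^sub>\<beta>\<close> and real Schur roots\<close>

text \<open>
  For a positive real root \<open>\<beta>\<close> the following determines \<open>X\<close> up to isomorphism
  (Kac, Schofield), so it says that \<open>X\<close> is \<open>X\<^sub>\<beta>\<close>.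
\<close>

definition is_indec_of ::
    "('a, 'b) pre_digraph \<Rightarrow> ('a \<Rightarrow> int) \<Rightarrow>
     ('k::field, 'v::ab_group_add, 'a, 'b) qrep \<Rightarrow> bool" where
  "is_indec_of G \<beta> X \<longleftrightarrow> indecomposable G X \<and> dim_vec G X = \<beta>"

text \<open>\<open>\<beta>\<close> is a real Schur root over the field \<open>'k\<close>, and \<open>B\<close> is \<open>X\<^sub>\<beta>\<close>.\<close>

definition real_schur_root ::
    "('a, 'b) pre_digraph \<Rightarrow> ('a \<Rightarrow> int) \<Rightarrow>
     ('k::field, 'v::ab_group_add, 'a, 'b) qrep \<Rightarrow> bool" where
  "real_schur_root G \<beta> B \<longleftrightarrow>
     positive_real_root G \<beta> \<and> is_indec_of G \<beta> B \<and> End_is_field G B"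

section \<open>The quiver and the root\<close>

definition Q8 :: "(nat, nat \<times> nat) pre_digraph" where
  "Q8 = \<lparr>verts = {1..8},
         arcs = {(1,4), (2,4), (3,4), (4,5), (5,6), (5,7), (5,8)},
         tail = fst, head = snd\<rparr>"

definition alpha8 :: "nat \<Rightarrow> int" where
  "alpha8 i = (if i \<in> {1..8} then [1, 1, 1, 8, 12, 2, 7, 7] ! (i - 1) else 0)"

end

(*
  Let B be the representation of a real Schur root beta with both properties. By an argument of
  Happel and Ringel a nonzero map between X and B is a monomorphism or an epimorphism; membership
  in M^B and M_B leaves only an epimorphism from X to B or a monomorphism from B to X, so that
  beta < alpha. The vanishing of Ext^1(X, B) and Ext^1(B, X) makes both Euler forms of alpha and
  beta nonnegative and one of them positive. With q(beta) = 1 this leaves the single vector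
  beta = (0,0,0,1,2,0,1,1). There the vanishing of the two extension groups and the
  indecomposability of X become linear algebra conditions on X, and these contradict a count of
  dimensions.
*)
theory Submission
  imports Defs
begin

section \<open>Finite dimensional subspaces\<close>

text \<open>Numerical conditions cannot dispose of \<beta> = (0,0,0,1,2,0,1,1): its Euler forms with
  \<alpha> are 3 and 2. Once both extension groups vanish, these numbers are c = dim Hom(X, B) and w
  = dim Hom(B, X), so c + w = 5. The obstacle is that X is not known to be a brick and comes without
  matrices. The universal maps X -> B^c and B^w -> X supply the missing structure. A nonzero
  composite B -> X -> B would be invertible and split B off X, so the image of the second map lies
  in the kernel of the first. The layer in between has dimension at least 8 - c - w at vertex 4 and
  exactly 12 - 2c - 2w at vertex 5, and the arrow 4 -> 5 acts injectively on it. Hence c + w \<le>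
  4, a contradiction. In other words, \<alpha> - 5\<beta> = (1,1,1,3,2,2,2,2) has no room for an
  injection from vertex 4 to vertex 5. Functionals on X and subspaces of X stand for the Hom spaces
  and for the layer, and forbidden summands are presented by idempotent endomorphisms.\<close>

definition fd_subspace :: "('k::field \<Rightarrow> 'v::ab_group_add \<Rightarrow> 'v) \<Rightarrow> 'v set \<Rightarrow> bool" where
  "fd_subspace s U \<longleftrightarrow> module.subspace s U \<and> (\<exists>B. finite B \<and> module.span s B = U)"

context vector_space
begin

lemma fd_subspaceD: "fd_subspace scale U \<Longrightarrow> subspace U"
  by (simp add: fd_subspace_def)

lemma fd_subspace_basis:
  assumes "fd_subspace scale U"
  obtains B where "B \<subseteq> U" "independent B" "finite B" "span B = U" "card B = dim U"
proof -
  obtain C where C: "finite C" "span C = U" using assms by (auto simp: fd_subspace_def)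
  obtain B where B: "B \<subseteq> U" "independent B" "U \<subseteq> span B" "card B = dim U"
    using basis_exists by blast
  have "finite B" using independent_span_bound[OF C(1) B(2)] B(1) C(2) by auto
  moreover have "span B = U"
    using B(1,3) span_minimal[OF B(1) fd_subspaceD[OF assms]] by auto
  ultimately show thesis using B that by blast
qed

lemma fd_subspaceI:
  assumes "finite B" "span B = U" shows "fd_subspace scale U"
  using assms by (auto simp: fd_subspace_def)

text \<open>The ambient space may be infinite dimensional, so finiteness is carried by subspaces.
  All three parts come from the bound on independent sets in a finite span; for equality, a vector
  of \<open>W\<close> outside \<open>U\<close> would enlarge a basis of \<open>U\<close> beyond
  \<open>card C\<close>.\<close>

lemma fd_subspace_dim_mono:
  assumes W: "fd_subspace scale W" and U: "subspace U" "U \<subseteq> W"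
  shows "fd_subspace scale U" "dim U \<le> dim W" "dim U = dim W \<Longrightarrow> U = W"
proof -
  obtain C where C: "C \<subseteq> W" "independent C" "finite C" "span C = W" "card C = dim W"
    using fd_subspace_basis[OF W] by metis
  obtain B where B: "B \<subseteq> U" "independent B" "U \<subseteq> span B" "card B = dim U"
    using basis_exists by blast
  have bd: "finite B \<and> card B \<le> card C"
    using independent_span_bound[OF C(3) B(2)] B(1) U(2) C(4) by auto
  have sB: "span B = U" using B(1,3) span_minimal[OF B(1) U(1)] by auto
  show "fd_subspace scale U" using bd sB fd_subspaceI by blast
  show "dim U \<le> dim W" using bd B C by simp
  assume eq: "dim U = dim W"
  show "U = W"
  proof (rule ccontr)
    assume "U \<noteq> W"
    then obtain w where w: "w \<in> W" "w \<notin> U" using U by auto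
    have "independent (insert w B)" using w(2) sB B(2) independent_insertI by blast
    moreover have "insert w B \<subseteq> span C" using w B U C by auto
    ultimately have "card (insert w B) \<le> card C" using independent_span_bound[OF C(3)] by blast
    moreover have "w \<notin> B" using w B by auto
    ultimately show False using bd B C eq by simp
  qed
qed

lemma fd_subspace_sum:
  assumes "fd_subspace scale U" "fd_subspace scale W"
  shows "fd_subspace scale {u + w |u w. u \<in> U \<and> w \<in> W}"
proof -
  obtain B C where "finite B" "span B = U" "finite C" "span C = W"
    using assms by (auto simp: fd_subspace_def)
  then have "finite (B \<union> C)" "span (B \<union> C) = {u + w |u w. u \<in> U \<and> w \<in> W}"
    by (auto simp: span_Un)
  then show ?thesis by (rule fd_subspaceI)
qed

text \<open>The coordinates of \<open>x\<close> with respect to \<open>B\<close> are supported both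
  in \<open>A\<close> and in \<open>B - A\<close>, hence all zero.\<close>

lemma independent_span_disjoint:
  assumes B: "independent B" "A \<subseteq> B" and x: "x \<in> span A" "x \<in> span (B - A)"
  shows "x = 0"
proof -
  have "representation B x b = 0" for b
    using representation_extend[OF B(1) x(1) B(2)] representation_extend[OF B(1) x(2)]
      representation_ne_zero[of A x b] representation_ne_zero[of "B - A" x b] by auto
  moreover have "x \<in> span B" using x(1) span_mono[OF B(2)] by blast
  ultimately show ?thesis using sum_nonzero_representation_eq[OF B(1), of x] by simp
qed

lemma dim_zero_subspace: "dim {0} = 0"
  using dim_span_eq_card_independent[OF independent_empty] by simp

lemma fd_subspace_zero: "fd_subspace scale {0}"
  using fd_subspaceI[of "{}"] by simp

lemma fd_dim_0: "fd_subspace scale U \<Longrightarrow> dim U = 0 \<Longrightarrow> U = {0}"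
  using fd_subspace_basis[of U] by (metis card_0_eq span_empty)

lemma fd_dim_pos:
  assumes "fd_subspace scale U" "x \<in> U" "x \<noteq> 0" shows "dim U > 0"
  using fd_dim_0[OF assms(1)] assms(2,3) by auto

end

section \<open>Rank and nullity on a subspace\<close>

context vector_space_pair
begin

lemma subspace_kernel_on:
  "Vector_Spaces.linear s1 s2 f \<Longrightarrow> vs1.subspace U \<Longrightarrow> vs1.subspace {x\<in>U. f x = 0}"
  unfolding vs1.subspace_def by (auto simp: linear_0 linear_add linear_scale)

text \<open>A basis \<open>A\<close> of the kernel inside \<open>U\<close> extends to a basis
  \<open>B\<close> of \<open>U\<close>. The span of \<open>B - A\<close> meets the kernel only in 0,
  so \<open>f\<close> is injective on it, and the vectors of \<open>A\<close> add nothing to the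
  image.\<close>

lemma rank_nullity:
  assumes f: "Vector_Spaces.linear s1 s2 f" and U: "fd_subspace s1 U"
  shows "fd_subspace s2 (f ` U)" "vs1.dim U = vs2.dim (f ` U) + vs1.dim {x\<in>U. f x = 0}"
proof -
  let ?K = "{x\<in>U. f x = 0}"
  have sU: "vs1.subspace U" using U vs1.fd_subspaceD by blast
  have "fd_subspace s1 ?K"
    using vs1.fd_subspace_dim_mono(1)[OF U subspace_kernel_on[OF f sU]] by blast
  then obtain A where A: "A \<subseteq> ?K" "vs1.independent A" "finite A" "vs1.span A = ?K"
      "card A = vs1.dim ?K"
    by (rule vs1.fd_subspace_basis)
  obtain B where B: "A \<subseteq> B" "B \<subseteq> U" "vs1.independent B" "U \<subseteq> vs1.span B"
    using vs1.maximal_independent_subset_extend[of A U] A by blast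
  have sB: "vs1.span B = U" using B vs1.span_minimal[OF B(2) sU] by auto
  obtain C where C: "finite C" "vs1.span C = U" using U by (auto simp: fd_subspace_def)
  have fB: "finite B" using vs1.independent_span_bound[OF C(1) B(3)] B(2) C(2) by auto
  let ?D = "B - A"
  have inj: "inj_on f (vs1.span ?D)"
  proof (rule iffD2[OF linear_inj_on_iff_eq_0[OF f vs1.subspace_span]], intro ballI impI)
    fix x assume x: "x \<in> vs1.span ?D" "f x = 0"
    have "x \<in> U" using x(1) vs1.span_mono[of ?D B] sB by auto
    then have "x \<in> vs1.span A" using x(2) A(4) by simp
    then show "x = 0" using x(1) vs1.independent_span_disjoint[OF B(3,1)] by blast
  qed
  have ind: "vs2.independent (f ` ?D)"
    using linear_independent_injective_image[OF f _ inj] vs1.independent_mono[OF B(3)] by blast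
  have cD: "card (f ` ?D) = card ?D"
    using inj card_image inj_on_subset vs1.span_superset by metis
  have "f ` U = vs2.span (f ` B)" using linear_span_image[OF f] sB by metis
  also have "\<dots> = vs2.span (f ` ?D)"
  proof
    have "f ` B \<subseteq> insert 0 (f ` ?D)" using A(1) by auto
    then show "vs2.span (f ` B) \<subseteq> vs2.span (f ` ?D)"
      using vs2.span_mono vs2.span_insert_0 by metis
    show "vs2.span (f ` ?D) \<subseteq> vs2.span (f ` B)" by (intro vs2.span_mono) auto
  qed
  finally have im: "f ` U = vs2.span (f ` ?D)" .
  show "fd_subspace s2 (f ` U)" using vs2.fd_subspaceI[of "f ` ?D"] im fB by simp
  have "vs2.dim (f ` U) = card ?D" using im cD vs2.dim_span_eq_card_independent[OF ind] by simp
  moreover have "vs1.dim U = card B" using sB vs1.dim_span_eq_card_independent[OF B(3)] by simp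
  moreover have "card B = card ?D + card A"
    using fB B(1) A(3) by (metis card_Diff_subset card_mono le_add_diff_inverse2)
  ultimately show "vs1.dim U = vs2.dim (f ` U) + vs1.dim ?K" using A by simp
qed

lemma dim_image_inj:
  assumes f: "Vector_Spaces.linear s1 s2 f" and U: "fd_subspace s1 U" and z: "\<And>x. x \<in> U \<Longrightarrow> f x = 0 \<Longrightarrow> x = 0"
  shows "vs2.dim (f ` U) = vs1.dim U"
proof -
  have "{x\<in>U. f x = 0} = {0}"
    using z linear_0[OF f] vs1.subspace_0[OF vs1.fd_subspaceD[OF U]] by auto
  then show ?thesis using rank_nullity(2)[OF f U] vs1.dim_zero_subspace by simp
qed

text \<open>Homomorphisms and arrow maps are constrained only on the spaces at the vertices. Total
  linear maps that agree with them there make \<open>rank_nullity\<close> applicable.\<close>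

lemma linear_extension:
  assumes "linear_map_on s1 U s2 W f" "vs1.subspace U"
  obtains F where "Vector_Spaces.linear s1 s2 F" "\<And>x. x \<in> U \<Longrightarrow> F x = f x"
proof -
  obtain B where B: "B \<subseteq> U" "vs1.independent B" "U \<subseteq> vs1.span B"
    using vs1.maximal_independent_subset by blast
  have sB: "vs1.span B = U" using B assms(2) vs1.span_minimal by blast
  obtain F where F: "Vector_Spaces.linear s1 s2 F" "\<And>x. x \<in> B \<Longrightarrow> F x = f x"
    using linear_independent_extend[OF B(2), of f] by auto
  have "x \<in> vs1.span B \<Longrightarrow> x \<in> U \<and> F x = f x" for x
  proof (induction rule: vs1.span_induct_alt)
    case base
    have "f (s1 0 0) = s2 0 (f 0)"
      using assms vs1.subspace_0[OF assms(2)] unfolding linear_map_on_def by blast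
    then show ?case using linear_0[OF F(1)] vs1.subspace_0[OF assms(2)] by simp
  next
    case (step c x y)
    have U: "x \<in> U" "y \<in> U" using step(1,2) B(1) by blast+
    then have c: "s1 c x \<in> U" using vs1.subspace_scale[OF assms(2)] by blast
    with U have "f (s1 c x + y) = s2 c (f x) + f y"
      using assms(1) unfolding linear_map_on_def by metis
    then show ?case using step F U c vs1.subspace_add[OF assms(2)]
      by (simp add: linear_add[OF F(1)] linear_scale[OF F(1)])
  qed
  then show thesis using that F(1) sB by blast
qed

end

section \<open>Products, functionals and projections\<close>

abbreviation (input) prod_scale :: "('k \<Rightarrow> 'v \<Rightarrow> 'v) \<Rightarrow> ('k \<Rightarrow> 'w \<Rightarrow> 'w) \<Rightarrow> 'k \<Rightarrow> 'v \<times> 'w \<Rightarrow> 'v \<times> 'w" where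
  "prod_scale s1 s2 c p \<equiv> (s1 c (fst p), s2 c (snd p))"

lemma vector_space_prod_scale:
  assumes "vector_space s1" "vector_space s2"
  shows "vector_space (prod_scale s1 s2)"
proof -
  interpret a: vector_space s1 by fact
  interpret b: vector_space s2 by fact
  show ?thesis
    by standard (auto simp: a.scale_right_distrib a.scale_left_distrib b.scale_right_distrib
        b.scale_left_distrib)
qed

lemma linearI':
  assumes "vector_space s1" "vector_space s2"
    "\<And>x y. f (x + y) = f x + f y" "\<And>c x. f (s1 c x) = s2 c (f x)"
  shows "Vector_Spaces.linear s1 s2 f"
  using assms by (simp add: Vector_Spaces.linear_iff)

lemma fd_subspace_Times:
  assumes "vector_space s1" "vector_space s2" "fd_subspace s1 U" "fd_subspace s2 W"
  shows "fd_subspace (prod_scale s1 s2) (U \<times> W)"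
    "vector_space.dim (prod_scale s1 s2) (U \<times> W) = vector_space.dim s1 U + vector_space.dim s2 W"
proof -
  interpret a: vector_space s1 by fact
  interpret b: vector_space s2 by fact
  interpret p: vector_space "prod_scale s1 s2" using vector_space_prod_scale assms by blast
  interpret ap: vector_space_pair s1 "prod_scale s1 s2" ..
  interpret bp: vector_space_pair s2 "prod_scale s1 s2" ..
  interpret pa: vector_space_pair "prod_scale s1 s2" s1 ..
  interpret pb: vector_space_pair "prod_scale s1 s2" s2 ..
  have l1: "Vector_Spaces.linear s1 (prod_scale s1 s2) (\<lambda>x. (x, 0))"
    by (rule linearI'[OF assms(1) p.vector_space_axioms]) auto
  have l2: "Vector_Spaces.linear s2 (prod_scale s1 s2) (\<lambda>x. (0, x))"
    by (rule linearI'[OF assms(2) p.vector_space_axioms]) auto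
  have l3: "Vector_Spaces.linear (prod_scale s1 s2) s1 fst"
    by (rule linearI'[OF p.vector_space_axioms assms(1)]) auto
  have l4: "Vector_Spaces.linear (prod_scale s1 s2) s2 snd"
    by (rule linearI'[OF p.vector_space_axioms assms(2)]) auto
  have z: "0 \<in> U" "0 \<in> W" using assms a.fd_subspaceD b.fd_subspaceD a.subspace_0 b.subspace_0 by blast+
  have "U \<times> W = {u + w |u w. u \<in> (\<lambda>x. (x, 0)) ` U \<and> w \<in> (\<lambda>x. (0, x)) ` W}"
    by force
  then show fd: "fd_subspace (prod_scale s1 s2) (U \<times> W)"
    using p.fd_subspace_sum[OF ap.rank_nullity(1)[OF l1 assms(3)] bp.rank_nullity(1)[OF l2 assms(4)]]
    by simp
  have im: "fst ` (U \<times> W) = U" "{x\<in>U \<times> W. fst x = 0} = (\<lambda>x. (0, x)) ` W" using z by force+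
  have "p.dim ((\<lambda>x. (0, x)) ` W) = b.dim W" by (rule bp.dim_image_inj[OF l2 assms(4)]) (simp add: zero_prod_def)
  then show "p.dim (U \<times> W) = a.dim U + b.dim W" using pa.rank_nullity(2)[OF l3 fd] im by simp
qed

context vector_space
begin

text \<open>Rank-nullity for the addition map on \<open>U \<times> W\<close>, whose kernel is the
  antidiagonal copy of \<open>U \<inter> W\<close>.\<close>

lemma dim_sum_Int:
  assumes U: "fd_subspace scale U" and W: "fd_subspace scale W"
  shows "dim {u + w |u w. u \<in> U \<and> w \<in> W} + dim (U \<inter> W) = dim U + dim W"
proof -
  interpret p: vector_space "prod_scale scale scale"
    using vector_space_prod_scale vector_space_axioms by blast
  interpret pa: vector_space_pair "prod_scale scale scale" scale ..
  interpret ap: vector_space_pair scale "prod_scale scale scale" ..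
  note fd = fd_subspace_Times[OF vector_space_axioms vector_space_axioms U W]
  have l: "Vector_Spaces.linear (prod_scale scale scale) scale (\<lambda>p. fst p + snd p)"
    by (rule linearI'[OF p.vector_space_axioms vector_space_axioms])
      (auto simp: scale_right_distrib)
  have l2: "Vector_Spaces.linear scale (prod_scale scale scale) (\<lambda>x. (x, - x))"
    by (rule linearI'[OF vector_space_axioms p.vector_space_axioms]) auto
  have im: "(\<lambda>p. fst p + snd p) ` (U \<times> W) = {u + w |u w. u \<in> U \<and> w \<in> W}" by force
  have sub: "subspace (U \<inter> W)" using U W fd_subspaceD subspace_inter by blast
  have fdI: "fd_subspace scale (U \<inter> W)" using fd_subspace_dim_mono(1)[OF U sub] by blast
  have k: "{x\<in>U \<times> W. fst x + snd x = 0} = (\<lambda>x. (x, - x)) ` (U \<inter> W)"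
  proof -
    have "- x \<in> W" if "x \<in> W" for x using that W fd_subspaceD subspace_neg by blast
    moreover have "y = - x" if "x + y = 0" for x y :: 'b using that by (simp add: eq_neg_iff_add_eq_0 add.commute)
    ultimately show ?thesis by (force simp: image_iff)
  qed
  have "p.dim ((\<lambda>x. (x, - x)) ` (U \<inter> W)) = dim (U \<inter> W)"
    by (rule ap.dim_image_inj[OF l2 fdI]) (simp add: zero_prod_def)
  then show ?thesis using pa.rank_nullity(2)[OF l fd(1)] fd(2) im k by simp
qed

lemma linear_field_vs: "vector_space ((*) :: 'a \<Rightarrow> 'a \<Rightarrow> 'a)"
  by standard (simp_all add: algebra_simps)

text \<open>Extend a basis of \<open>U\<close> by \<open>w\<close> and prescribe 0 on the basis, 1
  at \<open>w\<close>. Such functionals become the coefficients of the idempotents by which summands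
  are split off.\<close>

lemma functional_separation:
  assumes "subspace U" "w \<notin> U"
  obtains \<phi> :: "'b \<Rightarrow> 'a" where "Vector_Spaces.linear scale (*) \<phi>" "\<And>u. u \<in> U \<Longrightarrow> \<phi> u = 0" "\<phi> w = 1"
proof -
  interpret k: vector_space "(*) :: 'a \<Rightarrow> 'a \<Rightarrow> 'a" by (rule linear_field_vs)
  interpret vk: vector_space_pair scale "(*) :: 'a \<Rightarrow> 'a \<Rightarrow> 'a" ..
  obtain B where B: "B \<subseteq> U" "independent B" "U \<subseteq> span B"
    using maximal_independent_subset by blast
  have sB: "span B = U" using B assms span_minimal by blast
  have "independent (insert w B)" using B(2) sB assms(2) independent_insertI by blast
  then obtain \<phi> where \<phi>: "Vector_Spaces.linear scale (*) \<phi>" "\<And>x. x \<in> insert w B \<Longrightarrow> \<phi> x = (if x = w then 1 else 0)"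
    using vk.linear_independent_extend[of "insert w B" "\<lambda>x. if x = w then 1 else 0"] by blast
  have "\<phi> x = 0" if "x \<in> B" for x using \<phi>(2) that assms(2) B(1) by auto
  then have "\<phi> u = 0" if "u \<in> U" for u
    using vk.linear_eq_0_on_span[OF \<phi>(1)] sB that by blast
  then show thesis using that \<phi> by auto
qed

text \<open>Subtracting \<open>p\<close> from the identity gives a linear map with kernel
  \<open>U\<close>, which serves as a quotient map by \<open>U\<close> inside the same
  space.\<close>

lemma linear_retraction:
  assumes "subspace U"
  obtains p where "Vector_Spaces.linear scale scale p" "\<And>x. p x \<in> U" "\<And>u. u \<in> U \<Longrightarrow> p u = u"
proof -
  interpret vv: vector_space_pair scale scale ..
  obtain B where B: "B \<subseteq> U" "independent B" "U \<subseteq> span B"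
    using maximal_independent_subset by blast
  have sB: "span B = U" using B assms span_minimal by blast
  obtain p where p: "Vector_Spaces.linear scale scale p" "\<forall>x\<in>B. p x = id x" "range p = span (id ` B)"
    using vv.linear_independent_extend_subspace[OF B(2), of id] by blast
  have "p u = u" if "u \<in> U" for u
    using vv.linear_eq_on[OF p(1) linear_ident, of u B] that sB p(2) by auto
  then show thesis using that[OF p(1)] p(3) sB by auto
qed

end

text \<open>Choose preimages in \<open>U\<close> of a basis of the image of \<open>U\<close> and
  extend linearly with range in their span. Thus \<open>p\<close> takes values in \<open>U\<close>
  even off the image, as needed for a map into the space at a vertex.\<close>

lemma linear_generalized_inverse:
  assumes "Vector_Spaces.linear s1 s2 f" "module.subspace s1 U"
  obtains p where "Vector_Spaces.linear s2 s1 p" "\<And>y. p y \<in> U" "\<And>x. x \<in> U \<Longrightarrow> f (p (f x)) = f x"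
proof -
  interpret f: Vector_Spaces.linear s1 s2 f by fact
  interpret vp: vector_space_pair s1 s2 ..
  interpret vq: vector_space_pair s2 s1 ..
  have "f.vs2.subspace (f ` U)" using f.subspace_image assms by blast
  then obtain B where B: "B \<subseteq> f ` U" "f.vs2.independent B" "f ` U \<subseteq> f.vs2.span B"
    using f.vs2.maximal_independent_subset by blast
  have "\<forall>b\<in>B. \<exists>x\<in>U. f x = b" using B(1) by auto
  then obtain g where g: "\<And>b. b \<in> B \<Longrightarrow> g b \<in> U \<and> f (g b) = b" by metis
  obtain p where p: "Vector_Spaces.linear s2 s1 p" "\<forall>x\<in>B. p x = g x" "range p = f.vs1.span (g ` B)"
    using vq.linear_independent_extend_subspace[OF B(2), of g] by blast
  interpret p: Vector_Spaces.linear s2 s1 p by fact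
  have r: "p y \<in> U" for y using p(3) f.vs1.span_minimal[of "g ` B" U] g assms(2) by blast
  interpret yy: vector_space_pair s2 s2 ..
  have lin: "Vector_Spaces.linear s2 s2 (\<lambda>y. f (p y))"
    by (rule linearI'[OF f.vs2.vector_space_axioms f.vs2.vector_space_axioms])
      (simp_all add: p.add f.add p.scale f.scale)
  have "f (p y) = y" if "y \<in> f ` U" for y
    using yy.linear_eq_on[OF lin f.vs2.linear_ident, of y B] that B(3) p(2) g by auto
  then show thesis using that p(1) r by auto
qed

section \<open>Extensions and the lemma of Happel and Ringel\<close>

lemma linear_map_onD:
  assumes "linear_map_on s1 U s2 W f"
  shows "u \<in> U \<Longrightarrow> f u \<in> W" "u \<in> U \<Longrightarrow> v \<in> U \<Longrightarrow> f (u + v) = f u + f v"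
    "u \<in> U \<Longrightarrow> f (s1 c u) = s2 c (f u)"
  using assms by (auto simp: linear_map_on_def)

lemma linear_map_on_zero_diff:
  assumes "linear_map_on s1 U s2 W f" "vector_space s1" "vector_space s2" "module.subspace s1 U"
  shows "f 0 = 0" "u \<in> U \<Longrightarrow> v \<in> U \<Longrightarrow> f (u - v) = f u - f v"
proof -
  interpret vector_space_pair s1 s2
    using assms by (simp add: vector_space_pair_def)
  obtain F where F: "Vector_Spaces.linear s1 s2 F" "\<And>x. x \<in> U \<Longrightarrow> F x = f x"
    using linear_extension[OF assms(1,4)] by blast
  show "f 0 = 0" using F linear_0[OF F(1)] vs1.subspace_0[OF assms(4)] by metis
  show "u \<in> U \<Longrightarrow> v \<in> U \<Longrightarrow> f (u - v) = f u - f v"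
    using F linear_diff[OF F(1)] vs1.subspace_diff[OF assms(4)] by metis
qed

lemma is_repD:
  assumes "is_rep G X"
  shows "vector_space (smul X)" "i \<in> verts G \<Longrightarrow> fd_subspace (smul X) (space X i)"
    "i \<in> verts G \<Longrightarrow> module.subspace (smul X) (space X i)"
    "x \<in> arcs G \<Longrightarrow> linear_map_on (smul X) (space X (tail G x)) (smul X) (space X (head G x)) (amap X x)"
  using assms by (auto simp: is_rep_def fd_subspace_def)

lemma is_repI:
  assumes "vector_space (smul X)" "\<And>i. i \<in> verts G \<Longrightarrow> fd_subspace (smul X) (space X i)"
    "\<And>x. x \<in> arcs G \<Longrightarrow> linear_map_on (smul X) (space X (tail G x)) (smul X) (space X (head G x)) (amap X x)"
  shows "is_rep G X"
  using assms by (auto simp: is_rep_def fd_subspace_def)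

lemma is_homD:
  assumes "is_hom G X Y f"
  shows "i \<in> verts G \<Longrightarrow> linear_map_on (smul X) (space X i) (smul Y) (space Y i) (f i)"
    "x \<in> arcs G \<Longrightarrow> v \<in> space X (tail G x) \<Longrightarrow>
      f (head G x) (amap X x v) = amap Y x (f (tail G x) v)"
  using assms by (auto simp: is_hom_def)

lemma is_rep_pair:
  assumes "is_rep G X" "is_rep G Y" shows "vector_space_pair (smul X) (smul Y)"
  using assms[THEN is_repD(1)] by (simp add: vector_space_pair_def)

text \<open>The complement is the zero representation. This makes the conditions on direct summands
  in \<open>M_upper\<close> and \<open>M_lower\<close> apply to the representation itself.\<close>

lemma (in wf_digraph) direct_summand_refl:
  assumes "is_rep G X" shows "direct_summand G X X"
proof -
  interpret vector_space "smul X" using assms is_repD by blast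
  let ?Z = "\<lparr>smul = smul X, space = (\<lambda>i. {0}), amap = amap X\<rparr>"
  have z: "0 \<in> space X i" if "i \<in> verts G" for i
    using is_repD(3)[OF assms that] by (rule subspace_0)
  have "linear_map_on (smul X) {0} (smul X) {0} (amap X x)" if "x \<in> arcs G" for x
    using linear_map_on_zero_diff(1)[OF is_repD(4)[OF assms that] vector_space_axioms
        vector_space_axioms is_repD(3)[OF assms]] that
    by (auto simp: linear_map_on_def)
  then have "is_rep G ?Z" by (intro is_repI) (auto simp: fd_subspace_zero vector_space_axioms)
  then have "is_internal_sum G X X ?Z"
    using assms z by (auto simp: is_internal_sum_def is_subrep_def)
  then show ?thesis by (auto simp: direct_summand_def)
qed

lemma is_rep_restrict:
  assumes X: "is_rep G X"
    and U: "\<And>i. i \<in> verts G \<Longrightarrow> module.subspace (smul X) (U i)" "\<And>i. i \<in> verts G \<Longrightarrow> U i \<subseteq> space X i"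
    and A: "\<And>x v. x \<in> arcs G \<Longrightarrow> v \<in> U (tail G x) \<Longrightarrow> amap X x v \<in> U (head G x)"
    and wf: "wf_digraph G"
  shows "is_subrep G \<lparr>smul = smul X, space = U, amap = amap X\<rparr> X"
proof -
  interpret vector_space "smul X" using X is_repD by blast
  interpret wf_digraph G by fact
  have "is_rep G \<lparr>smul = smul X, space = U, amap = amap X\<rparr>"
  proof (rule is_repI; simp add: vector_space_axioms)
    show "fd_subspace (smul X) (U i)" if "i \<in> verts G" for i
      using fd_subspace_dim_mono(1)[OF is_repD(2)[OF X that] U(1,2)] that by blast
    show "linear_map_on (smul X) (U (tail G x)) (smul X) (U (head G x)) (amap X x)" if "x \<in> arcs G" for x
      using is_repD(4)[OF X that] U(2)[of "tail G x"] A that unfolding linear_map_on_def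
      by (meson subsetD tail_in_verts)
  qed
  then show ?thesis using U by (auto simp: is_subrep_def)
qed

context wf_digraph
begin

text \<open>The fixed vectors and the kernel of an idempotent are subrepresentations with direct sum
  \<open>X\<close>. Every use of indecomposability passes through here: to forbid a summand, exhibit
  its idempotent.\<close>

lemma idempotent_endomorphism:
  assumes X: "indecomposable G X" and h: "is_hom G X X h"
    and idem: "\<And>i v. i \<in> verts G \<Longrightarrow> v \<in> space X i \<Longrightarrow> h i (h i v) = h i v"
  shows "(\<forall>i\<in>verts G. \<forall>v\<in>space X i. h i v = 0) \<or> (\<forall>i\<in>verts G. \<forall>v\<in>space X i. h i v = v)"
proof -
  have rX: "is_rep G X" using X by (simp add: indecomposable_def)
  interpret vector_space "smul X" using rX is_repD by blast
  note lh = is_homD(1)[OF h]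
  note l0 = linear_map_on_zero_diff[OF lh vector_space_axioms vector_space_axioms is_repD(3)[OF rX]]
  define U where "U = (\<lambda>i. {v\<in>space X i. h i v = v})"
  define W where "W = (\<lambda>i. {v\<in>space X i. h i v = 0})"
  let ?Y = "\<lparr>smul = smul X, space = U, amap = amap X\<rparr>"
  let ?Z = "\<lparr>smul = smul X, space = W, amap = amap X\<rparr>"
  have in_head: "amap X x v \<in> space X (head G x)" if "x \<in> arcs G" "v \<in> space X (tail G x)" for x v
    using linear_map_onD(1)[OF is_repD(4)[OF rX that(1)] that(2)] .
  have subs: "subspace (U i)" "subspace (W i)" if i: "i \<in> verts G" for i
    using is_repD(3)[OF rX i] l0(1)[OF i i] linear_map_onD[OF lh[OF i]]
    by (auto simp: subspace_def U_def W_def)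
  have Y: "is_subrep G ?Y X"
    by (rule is_rep_restrict[OF rX _ _ _ wf_digraph_axioms])
      (use subs is_homD(2)[OF h] in \<open>auto simp: in_head U_def W_def\<close>)
  have "amap X x 0 = 0" if "x \<in> arcs G" for x
    using linear_map_on_zero_diff(1)[OF is_repD(4)[OF rX that] vector_space_axioms vector_space_axioms
        is_repD(3)[OF rX]] that by simp
  then have Z: "is_subrep G ?Z X"
    by (intro is_rep_restrict[OF rX _ _ _ wf_digraph_axioms])
      (use subs is_homD(2)[OF h] in \<open>auto simp: in_head U_def W_def\<close>)
  have "is_internal_sum G X ?Y ?Z"
  proof -
    have "U i \<inter> W i = {0} \<and> space X i = {y + z |y z. y \<in> U i \<and> z \<in> W i}" if i: "i \<in> verts G" for i
    proof
      show "U i \<inter> W i = {0}" using subs[OF i] subspace_0 by (auto simp: U_def W_def)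
      show "space X i = {y + z |y z. y \<in> U i \<and> z \<in> W i}"
      proof
        show "{y + z |y z. y \<in> U i \<and> z \<in> W i} \<subseteq> space X i"
          using is_repD(3)[OF rX i] subspace_add by (auto simp: U_def W_def)
        show "space X i \<subseteq> {y + z |y z. y \<in> U i \<and> z \<in> W i}"
        proof
          fix v assume v: "v \<in> space X i"
          have hv: "h i v \<in> space X i" using linear_map_onD(1)[OF lh[OF i] v] .
          have "h i v \<in> U i" using hv idem[OF i v] by (simp add: U_def)
          moreover have "v - h i v \<in> W i"
            using l0(2)[OF i i v hv] idem[OF i v] subspace_diff[OF is_repD(3)[OF rX i] v hv]
            by (simp add: W_def)
          moreover have "v = h i v + (v - h i v)" by simp
          ultimately show "v \<in> {y + z |y z. y \<in> U i \<and> z \<in> W i}" by blast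
        qed
      qed
    qed
    then show ?thesis using Y Z by (simp add: is_internal_sum_def)
  qed
  then have "is_zero_rep G ?Y \<or> is_zero_rep G ?Z" using X by (auto simp: indecomposable_def)
  then show ?thesis
  proof
    assume z: "is_zero_rep G ?Y"
    have "h i v = 0" if "i \<in> verts G" "v \<in> space X i" for i v
    proof -
      have "h i v \<in> U i" using linear_map_onD(1)[OF lh[OF that(1)] that(2)] idem[OF that]
        by (simp add: U_def)
      then show ?thesis using z that by (simp add: is_zero_rep_def)
    qed
    then show ?thesis by blast
  next
    assume z: "is_zero_rep G ?Z"
    have "h i v = v" if "i \<in> verts G" "v \<in> space X i" for i v
    proof -
      have hv: "h i v \<in> space X i" using linear_map_onD(1)[OF lh[OF that(1)] that(2)] .
      have "v - h i v \<in> W i"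
        using l0(2)[OF that(1) that(1) that(2) hv] idem[OF that] subspace_diff[OF is_repD(3)[OF rX that(1)] that(2) hv]
        by (simp add: W_def)
      then show ?thesis using z that by (simp add: is_zero_rep_def)
    qed
    then show ?thesis by blast
  qed
qed

text \<open>A family \<open>\<zeta>\<close> of linear maps along the arrows twists \<open>Y \<oplus> X\<close> into an extension of \<open>X\<close>
  by \<open>Y\<close>; a splitting of it exhibits \<open>\<zeta>\<close> as a coboundary.\<close>

lemma Ext1_vanishes_coboundary:
  fixes X :: "('k::field, 'v::ab_group_add, 'a, 'b) qrep"
    and Y :: "('k::field, 'w::ab_group_add, 'a, 'b) qrep"
  assumes X: "is_rep G X" and Y: "is_rep G Y" and E: "Ext1_vanishes G X Y"
    and \<zeta>: "\<And>x. x \<in> arcs G \<Longrightarrow>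
      linear_map_on (smul X) (space X (tail G x)) (smul Y) (space Y (head G x)) (\<zeta> x)"
  obtains \<eta> where "\<And>i. i \<in> verts G \<Longrightarrow> linear_map_on (smul X) (space X i) (smul Y) (space Y i) (\<eta> i)"
    "\<And>x v. x \<in> arcs G \<Longrightarrow> v \<in> space X (tail G x) \<Longrightarrow>
       \<zeta> x v = \<eta> (head G x) (amap X x v) - amap Y x (\<eta> (tail G x) v)"
proof -
  interpret vx: vector_space "smul X" using X is_repD by blast
  interpret vy: vector_space "smul Y" using Y is_repD by blast
  define E :: "('k, 'w \<times> 'v, 'a, 'b) qrep" where
    "E = \<lparr>smul = prod_scale (smul Y) (smul X), space = (\<lambda>i. space Y i \<times> space X i),
      amap = (\<lambda>x p. (amap Y x (fst p) + \<zeta> x (snd p), amap X x (snd p)))\<rparr>"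
  note lx = linear_map_onD[OF is_repD(4)[OF X]]
  note ly = linear_map_onD[OF is_repD(4)[OF Y]]
  note lz = linear_map_onD[OF \<zeta>]
  note zx = vx.subspace_0[OF is_repD(3)[OF X]]
  note zy = vy.subspace_0[OF is_repD(3)[OF Y]]
  have z0: "\<zeta> x 0 = 0" if "x \<in> arcs G" for x
    using linear_map_on_zero_diff(1)[OF \<zeta>[OF that] vx.vector_space_axioms vy.vector_space_axioms
        is_repD(3)[OF X tail_in_verts[OF that]]] .
  have x0: "amap X x 0 = 0" if "x \<in> arcs G" for x
    using linear_map_on_zero_diff(1)[OF is_repD(4)[OF X that] vx.vector_space_axioms vx.vector_space_axioms
        is_repD(3)[OF X tail_in_verts[OF that]]] .
  have rE: "is_rep G E"
  proof (rule is_repI)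
    show "vector_space (smul E)"
      using vector_space_prod_scale vx.vector_space_axioms vy.vector_space_axioms by (simp add: E_def)
    show "fd_subspace (smul E) (space E i)" if "i \<in> verts G" for i
      using fd_subspace_Times(1)[OF vy.vector_space_axioms vx.vector_space_axioms
          is_repD(2)[OF Y that] is_repD(2)[OF X that]]
      by (simp add: E_def)
    show "linear_map_on (smul E) (space E (tail G x)) (smul E) (space E (head G x)) (amap E x)"
      if x: "x \<in> arcs G" for x
      using lx[OF x] ly[OF x] lz[OF x] vy.subspace_add[OF is_repD(3)[OF Y head_in_verts[OF x]]]
      by (auto simp: linear_map_on_def E_def vy.scale_right_distrib)
  qed
  have ne: "space Y i \<noteq> {}" if "i \<in> verts G" for i using zy that by blast
  have "short_exact G Y E X (\<lambda>i y. (y, 0)) (\<lambda>i. snd)"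
    using X Y rE zx zy z0 x0 ne unfolding short_exact_def is_mono_def is_epi_def is_hom_def
    by (auto simp: E_def linear_map_on_def inj_on_def image_iff)
  then obtain h where h: "is_hom G X E h" "\<forall>i\<in>verts G. \<forall>v\<in>space X i. snd (h i v) = v"
    using E unfolding Ext1_vanishes_def by meson
  \<comment> \<open>The second component of the section is the identity, so the first one carries
    all the information; comparing first components in the compatibility with an arrow gives the
    coboundary equation.\<close>
  show thesis
  proof (rule that[of "\<lambda>i v. fst (h i v)"])
    show "linear_map_on (smul X) (space X i) (smul Y) (space Y i) (\<lambda>v. fst (h i v))"
      if "i \<in> verts G" for i
      using is_homD(1)[OF h(1) that] by (auto simp: linear_map_on_def E_def mem_Times_iff)
    show "\<zeta> x v = fst (h (head G x) (amap X x v)) - amap Y x (fst (h (tail G x) v))"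
      if "x \<in> arcs G" "v \<in> space X (tail G x)" for x v
      using is_homD(2)[OF h(1) that] h(2) that tail_in_verts by (auto simp: E_def)
  qed
qed

text \<open>The trick of Happel and Ringel: the obstruction to a generalized inverse \<open>p\<close> of \<open>f\<close> being
  a homomorphism is a coboundary, which turns \<open>f\<close> into an idempotent of \<open>End(X)\<close> or \<open>End(Y)\<close>.\<close>

lemma Happel_Ringel:
  fixes X :: "('k::field, 'v::ab_group_add, 'a, 'b) qrep"
    and Y :: "('k::field, 'w::ab_group_add, 'a, 'b) qrep"
  assumes X: "is_rep G X" and Y: "is_rep G Y" and E: "Ext1_vanishes G Y X" and f: "is_hom G X Y f"
  obtains \<eta> p where "is_hom G X X (\<lambda>i v. \<eta> i (f i v))"
    "is_hom G Y Y (\<lambda>i y. f i (\<eta> i y) + y - f i (p i y))"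
    "\<And>i. i \<in> verts G \<Longrightarrow> linear_map_on (smul Y) (space Y i) (smul X) (space X i) (p i)"
    "\<And>i. i \<in> verts G \<Longrightarrow> linear_map_on (smul Y) (space Y i) (smul X) (space X i) (\<eta> i)"
    "\<And>i v. i \<in> verts G \<Longrightarrow> v \<in> space X i \<Longrightarrow> f i (p i (f i v)) = f i v"
proof -
  interpret vx: vector_space "smul X" using X is_repD by blast
  interpret vy: vector_space "smul Y" using Y is_repD by blast
  interpret vector_space_pair "smul X" "smul Y" ..
  have "\<exists>p. Vector_Spaces.linear (smul Y) (smul X) p \<and> (\<forall>y. p y \<in> space X i) \<and>
      (\<forall>v\<in>space X i. f i (p (f i v)) = f i v)" if i: "i \<in> verts G" for i
  proof -
    obtain F where F: "Vector_Spaces.linear (smul X) (smul Y) F" "\<And>x. x \<in> space X i \<Longrightarrow> F x = f i x"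
      using linear_extension[OF is_homD(1)[OF f i] is_repD(3)[OF X i]] by blast
    obtain p where "Vector_Spaces.linear (smul Y) (smul X) p" "\<And>y. p y \<in> space X i"
        "\<And>x. x \<in> space X i \<Longrightarrow> F (p (F x)) = F x"
      using linear_generalized_inverse[OF F(1) is_repD(3)[OF X i]] by blast
    then show ?thesis using F(2) by (intro exI[of _ p]) auto
  qed
  then obtain p where p: "\<And>i. i \<in> verts G \<Longrightarrow> Vector_Spaces.linear (smul Y) (smul X) (p i)"
      "\<And>i y. i \<in> verts G \<Longrightarrow> p i y \<in> space X i"
      "\<And>i v. i \<in> verts G \<Longrightarrow> v \<in> space X i \<Longrightarrow> f i (p i (f i v)) = f i v"
    by metis
  have pa: "p i (y + z) = p i y + p i z" and pd: "p i (y - z) = p i y - p i z"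
    and ps: "p i (smul Y c y) = smul X c (p i y)" and p0: "p i 0 = 0"
    if "i \<in> verts G" for i y z c
  proof -
    interpret l: Vector_Spaces.linear "smul Y" "smul X" "p i" using p(1)[OF that] .
    show "p i (y + z) = p i y + p i z" "p i (y - z) = p i y - p i z"
      "p i (smul Y c y) = smul X c (p i y)" "p i 0 = 0"
      by (simp_all add: l.add l.diff l.scale)
  qed
  note lf = linear_map_onD[OF is_homD(1)[OF f]]
  note fh = is_homD(2)[OF f]
  note lx = linear_map_onD[OF is_repD(4)[OF X]]
  note ly = linear_map_onD[OF is_repD(4)[OF Y]]
  note fd = linear_map_on_zero_diff[OF is_homD(1)[OF f] vx.vector_space_axioms vy.vector_space_axioms is_repD(3)[OF X]]
  have yd: "x \<in> arcs G \<Longrightarrow> u \<in> space Y (tail G x) \<Longrightarrow> v \<in> space Y (tail G x) \<Longrightarrow>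
      amap Y x (u - v) = amap Y x u - amap Y x v" for x u v
    using linear_map_on_zero_diff(2)[OF is_repD(4)[OF Y] vy.vector_space_axioms vy.vector_space_axioms
        is_repD(3)[OF Y]] tail_in_verts by blast
  have y0: "x \<in> arcs G \<Longrightarrow> amap Y x 0 = 0" for x
    using linear_map_on_zero_diff(1)[OF is_repD(4)[OF Y] vy.vector_space_axioms vy.vector_space_axioms
        is_repD(3)[OF Y]] tail_in_verts by blast
  \<comment> \<open>\<open>c\<close> projects to a complement of the image of \<open>f\<close> and
    kills that image.\<close>
  define c where "c = (\<lambda>i y. y - f i (p i y))"
  have cin: "c i y \<in> space Y i" if "i \<in> verts G" "y \<in> space Y i" for i y
    using vy.subspace_diff[OF is_repD(3)[OF Y that(1)] that(2) lf(1)[OF that(1) p(2)[OF that(1)]]]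
    by (simp add: c_def)
  have ca: "c i (y + z) = c i y + c i z" "c i (smul Y a y) = smul Y a (c i y)" if "i \<in> verts G" for i y z a
    using that lf p(2) by (simp_all add: c_def pa ps vy.scale_right_diff_distrib)
  \<comment> \<open>The part of the arrow that leads from this complement back into the image,
    pulled back along \<open>p\<close>. It vanishes on the image of \<open>f\<close>, so that
    \<open>\<eta> \<circ> f\<close> commutes with the arrows.\<close>
  define \<zeta> where "\<zeta> = (\<lambda>x y. p (head G x) (amap Y x (c (tail G x) y)))"
  have "linear_map_on (smul Y) (space Y (tail G x)) (smul X) (space X (head G x)) (\<zeta> x)"
    if x: "x \<in> arcs G" for x
    using p(2)[OF head_in_verts[OF x]] pa[OF head_in_verts[OF x]] ps[OF head_in_verts[OF x]] ly[OF x]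
      cin[OF tail_in_verts[OF x]] ca[OF tail_in_verts[OF x]]
    by (simp add: linear_map_on_def \<zeta>_def)
  then obtain \<eta> where \<eta>: "\<And>i. i \<in> verts G \<Longrightarrow> linear_map_on (smul Y) (space Y i) (smul X) (space X i) (\<eta> i)"
    "\<And>x v. x \<in> arcs G \<Longrightarrow> v \<in> space Y (tail G x) \<Longrightarrow>
       \<zeta> x v = \<eta> (head G x) (amap Y x v) - amap X x (\<eta> (tail G x) v)"
    using Ext1_vanishes_coboundary[OF Y X E, of \<zeta>] by blast
  note le = linear_map_onD[OF \<eta>(1)]
  have h: "is_hom G X X (\<lambda>i v. \<eta> i (f i v))"
    unfolding is_hom_def
  proof (intro conjI ballI)
    show "linear_map_on (smul X) (space X i) (smul X) (space X i) (\<lambda>v. \<eta> i (f i v))" if "i \<in> verts G" for i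
      using lf[OF that] le[OF that] by (simp add: linear_map_on_def)
    fix x v assume x: "x \<in> arcs G" and v: "v \<in> space X (tail G x)"
    note t = tail_in_verts[OF x] and hd = head_in_verts[OF x]
    have "c (tail G x) (f (tail G x) v) = 0" using p(3)[OF t v] by (simp add: c_def)
    then have "\<zeta> x (f (tail G x) v) = 0" using y0[OF x] p0[OF hd] by (simp add: \<zeta>_def)
    then show "\<eta> (head G x) (f (head G x) (amap X x v)) = amap X x (\<eta> (tail G x) (f (tail G x) v))"
      using \<eta>(2)[OF x lf(1)[OF t v]] fh[OF x v] by simp
  qed
  \<comment> \<open>The defect of \<open>c\<close> against an arrow is minus
    \<open>f \<circ> \<zeta>\<close> and that of \<open>f \<circ> \<eta>\<close> is
    \<open>f \<circ> \<zeta>\<close>, so their sum is a homomorphism.\<close>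
  have \<theta>: "is_hom G Y Y (\<lambda>i y. f i (\<eta> i y) + y - f i (p i y))"
    unfolding is_hom_def
  proof (intro conjI ballI)
    show "linear_map_on (smul Y) (space Y i) (smul Y) (space Y i) (\<lambda>y. f i (\<eta> i y) + y - f i (p i y))"
      if i: "i \<in> verts G" for i
    proof -
      have "f i (\<eta> i y) + c i y \<in> space Y i" if "y \<in> space Y i" for y
        using vy.subspace_add[OF is_repD(3)[OF Y i] lf(1)[OF i le(1)[OF i that]] cin[OF i that]] .
      then have "linear_map_on (smul Y) (space Y i) (smul Y) (space Y i) (\<lambda>y. f i (\<eta> i y) + c i y)"
        using lf[OF i] le[OF i] ca[OF i] by (simp add: linear_map_on_def vy.scale_right_distrib)
      then show ?thesis by (simp add: c_def add_diff_eq)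
    qed
    fix x y assume x: "x \<in> arcs G" and y: "y \<in> space Y (tail G x)"
    note t = tail_in_verts[OF x] and hd = head_in_verts[OF x]
    let ?t = "tail G x" and ?h = "head G x"
    have e: "\<eta> ?t y \<in> space X ?t" and q: "p ?t y \<in> space X ?t" using le(1)[OF t y] p(2)[OF t] by auto
    have "f ?h (\<eta> ?h (amap Y x y)) = f ?h (\<zeta> x y) + f ?h (amap X x (\<eta> ?t y))"
    proof -
      have "\<eta> ?h (amap Y x y) = \<zeta> x y + amap X x (\<eta> ?t y)" using \<eta>(2)[OF x y] by simp
      moreover have "\<zeta> x y \<in> space X ?h" using p(2)[OF hd] by (simp add: \<zeta>_def)
      ultimately show ?thesis using lf(2)[OF hd _ lx(1)[OF x e]] by simp
    qed
    moreover have "f ?h (\<zeta> x y) = f ?h (p ?h (amap Y x y)) - amap Y x (f ?t (p ?t y))"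
    proof -
      have "\<zeta> x y = p ?h (amap Y x y) - p ?h (f ?h (amap X x (p ?t y)))"
        using yd[OF x y lf(1)[OF t q]] pd[OF hd] fh[OF x q] by (simp add: \<zeta>_def c_def)
      then show ?thesis using fd(2)[OF hd hd p(2)[OF hd] p(2)[OF hd]] p(3)[OF hd lx(1)[OF x q]] fh[OF x q] by simp
    qed
    moreover have "amap Y x (f ?t (\<eta> ?t y) + y - f ?t (p ?t y)) =
        amap Y x (f ?t (\<eta> ?t y)) + amap Y x y - amap Y x (f ?t (p ?t y))"
      using yd[OF x vy.subspace_add[OF is_repD(3)[OF Y t] lf(1)[OF t e] y] lf(1)[OF t q]]
        ly(2)[OF x lf(1)[OF t e] y] by simp
    ultimately show "f ?h (\<eta> ?h (amap Y x y)) + amap Y x y - f ?h (p ?h (amap Y x y)) =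
        amap Y x (f ?t (\<eta> ?t y) + y - f ?t (p ?t y))"
      using fh[OF x e] by simp
  qed
  have "linear_map_on (smul Y) (space Y i) (smul X) (space X i) (p i)" if "i \<in> verts G" for i
    using p(2) pa ps that by (simp add: linear_map_on_def)
  then show thesis using that h \<theta> \<eta>(1) p(3) by blast
qed

text \<open>The endomorphism of \<open>Y\<close> from \<open>Happel_Ringel\<close> is a scalar and
  induces the identity modulo the image of \<open>f\<close>; if \<open>f\<close> is not onto, the
  scalar is 1. Then \<open>f \<circ> \<eta> = f \<circ> p\<close>, so
  \<open>\<eta> \<circ> f\<close> is an idempotent of the indecomposable \<open>X\<close>. It is not
  zero because \<open>f \<circ> \<eta> \<circ> f = f\<close>, hence it is the identity and
  \<open>f\<close> is injective.\<close>

lemma mono_or_epi_to_brick: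
  fixes X :: "('k::field, 'v::ab_group_add, 'a, 'b) qrep"
    and Y :: "('k::field, 'w::ab_group_add, 'a, 'b) qrep"
  assumes X: "indecomposable G X" and Y: "is_rep G Y" "End_is_field G Y"
    and E: "Ext1_vanishes G Y X" and f: "is_hom G X Y f"
    and nz: "i0 \<in> verts G" "v0 \<in> space X i0" "f i0 v0 \<noteq> 0"
  shows "is_mono G X Y f \<or> is_epi G X Y f"
proof -
  have rX: "is_rep G X" using X by (simp add: indecomposable_def)
  interpret vx: vector_space "smul X" using rX is_repD by blast
  interpret vy: vector_space "smul Y" using Y is_repD by blast
  interpret vector_space_pair "smul X" "smul Y" ..
  obtain \<eta> p where h: "is_hom G X X (\<lambda>i v. \<eta> i (f i v))"
    and \<theta>: "is_hom G Y Y (\<lambda>i y. f i (\<eta> i y) + y - f i (p i y))"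
    and p: "\<And>i. i \<in> verts G \<Longrightarrow> linear_map_on (smul Y) (space Y i) (smul X) (space X i) (p i)"
    and e: "\<And>i. i \<in> verts G \<Longrightarrow> linear_map_on (smul Y) (space Y i) (smul X) (space X i) (\<eta> i)"
    and fpf: "\<And>i v. i \<in> verts G \<Longrightarrow> v \<in> space X i \<Longrightarrow> f i (p i (f i v)) = f i v"
    by (rule Happel_Ringel[OF rX Y(1) E f]) (rule that; assumption)
  note lf = linear_map_onD[OF is_homD(1)[OF f]]
  note le = linear_map_onD[OF e]
  note lp = linear_map_onD[OF p]
  note fd = linear_map_on_zero_diff[OF is_homD(1)[OF f] vx.vector_space_axioms vy.vector_space_axioms is_repD(3)[OF rX]]
  obtain c where c: "\<And>i y. i \<in> verts G \<Longrightarrow> y \<in> space Y i \<Longrightarrow> f i (\<eta> i y) + y - f i (p i y) = smul Y c y"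
    using Y(2) \<theta> unfolding End_is_field_def by meson
  show ?thesis
  proof (cases "is_epi G X Y f")
    case False
    then obtain i y where i: "i \<in> verts G" "y \<in> space Y i" "y \<notin> f i ` space X i"
      using f lf(1) unfolding is_epi_def by blast
    have "c = 1"
    proof (rule ccontr)
      assume "c \<noteq> 1"
      have "smul Y (1 - c) y = f i (p i y - \<eta> i y)"
        unfolding fd(2)[OF i(1) i(1) lp(1)[OF i(1,2)] le(1)[OF i(1,2)]]
        by (simp add: vy.scale_left_diff_distrib c[OF i(1,2), symmetric])
      then have "smul Y (1 / (1 - c)) (smul Y (1 - c) y) = smul Y (1 / (1 - c)) (f i (p i y - \<eta> i y))"
        by simp
      moreover have pe: "p i y - \<eta> i y \<in> space X i"
        using vx.subspace_diff[OF is_repD(3)[OF rX i(1)] lp(1)[OF i(1,2)] le(1)[OF i(1,2)]] .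
      ultimately have "y = f i (smul X (1 / (1 - c)) (p i y - \<eta> i y))"
        using \<open>c \<noteq> 1\<close> lf(3)[OF i(1) pe] by simp
      then show False using i(3) vx.subspace_scale[OF is_repD(3)[OF rX i(1)] pe] by blast
    qed
    then have fe: "f j (\<eta> j z) = f j (p j z)" if "j \<in> verts G" "z \<in> space Y j" for j z
      using c[OF that] by (simp add: algebra_simps)
    then have fef: "f j (\<eta> j (f j v)) = f j v" if "j \<in> verts G" "v \<in> space X j" for j v
      using fpf[OF that] that lf(1) by simp
    then have "(\<forall>i\<in>verts G. \<forall>v\<in>space X i. \<eta> i (f i v) = 0) \<or> (\<forall>i\<in>verts G. \<forall>v\<in>space X i. \<eta> i (f i v) = v)"
      using idempotent_endomorphism[OF X h] by simp
    moreover have "\<not> (\<forall>i\<in>verts G. \<forall>v\<in>space X i. \<eta> i (f i v) = 0)"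
      using nz fef[OF nz(1,2)] fd(1)[OF nz(1) nz(1)] by metis
    ultimately have "inj_on (f i) (space X i)" if "i \<in> verts G" for i
      using that by (metis inj_onI)
    then show ?thesis using f by (simp add: is_mono_def)
  qed simp
qed

text \<open>Now \<open>\<eta> \<circ> f\<close> is a scalar; if nonzero, \<open>f\<close> is
  injective. If it is zero, the endomorphism of \<open>Y\<close> is idempotent. Being 0, it writes
  every \<open>y\<close> as \<open>f (p y - \<eta> y)\<close>; being the identity, it gives
  \<open>f \<circ> p \<circ> f = f \<circ> \<eta> \<circ> f = 0\<close>, against
  \<open>f \<noteq> 0\<close>.\<close>

lemma mono_or_epi_from_brick:
  fixes X :: "('k::field, 'v::ab_group_add, 'a, 'b) qrep"
    and Y :: "('k::field, 'w::ab_group_add, 'a, 'b) qrep"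
  assumes Y: "indecomposable G Y" and X: "is_rep G X" "End_is_field G X"
    and E: "Ext1_vanishes G Y X" and f: "is_hom G X Y f"
    and nz: "i0 \<in> verts G" "v0 \<in> space X i0" "f i0 v0 \<noteq> 0"
  shows "is_mono G X Y f \<or> is_epi G X Y f"
proof -
  have rY: "is_rep G Y" using Y by (simp add: indecomposable_def)
  interpret vx: vector_space "smul X" using X is_repD by blast
  interpret vy: vector_space "smul Y" using rY is_repD by blast
  interpret vector_space_pair "smul X" "smul Y" ..
  obtain \<eta> p where h: "is_hom G X X (\<lambda>i v. \<eta> i (f i v))"
    and \<theta>: "is_hom G Y Y (\<lambda>i y. f i (\<eta> i y) + y - f i (p i y))"
    and p: "\<And>i. i \<in> verts G \<Longrightarrow> linear_map_on (smul Y) (space Y i) (smul X) (space X i) (p i)"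
    and e: "\<And>i. i \<in> verts G \<Longrightarrow> linear_map_on (smul Y) (space Y i) (smul X) (space X i) (\<eta> i)"
    and fpf: "\<And>i v. i \<in> verts G \<Longrightarrow> v \<in> space X i \<Longrightarrow> f i (p i (f i v)) = f i v"
    by (rule Happel_Ringel[OF X(1) rY E f]) (rule that; assumption)
  note lf = linear_map_onD[OF is_homD(1)[OF f]]
  note le = linear_map_onD[OF e]
  note lp = linear_map_onD[OF p]
  note fd = linear_map_on_zero_diff[OF is_homD(1)[OF f] vx.vector_space_axioms vy.vector_space_axioms is_repD(3)[OF X(1)]]
  note ed = linear_map_on_zero_diff[OF e vy.vector_space_axioms vx.vector_space_axioms is_repD(3)[OF rY]]
  note pd = linear_map_on_zero_diff[OF p vy.vector_space_axioms vx.vector_space_axioms is_repD(3)[OF rY]]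
  obtain c where c: "\<And>i v. i \<in> verts G \<Longrightarrow> v \<in> space X i \<Longrightarrow> \<eta> i (f i v) = smul X c v"
    using X(2) h unfolding End_is_field_def by meson
  show ?thesis
  proof (cases "c = 0")
    case False
    have "inj_on (f i) (space X i)" if "i \<in> verts G" for i
    proof (rule inj_onI)
      fix u v assume "u \<in> space X i" "v \<in> space X i" "f i u = f i v"
      then have "smul X c u = smul X c v" using c that by metis
      then show "u = v" using False by simp
    qed
    then show ?thesis using f by (simp add: is_mono_def)
  next
    case True
    then have ef: "\<eta> i (f i v) = 0" if "i \<in> verts G" "v \<in> space X i" for i v using c[OF that] by simp
    have "f i (\<eta> i (f i (\<eta> i y) + y - f i (p i y))) + (f i (\<eta> i y) + y - f i (p i y))
        - f i (p i (f i (\<eta> i y) + y - f i (p i y))) = f i (\<eta> i y) + y - f i (p i y)"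
      if i: "i \<in> verts G" and y: "y \<in> space Y i" for i y
    proof -
      have m: "\<eta> i y \<in> space X i" "p i y \<in> space X i" using le(1)[OF i y] lp(1)[OF i y] .
      have n: "f i (\<eta> i y) \<in> space Y i" "f i (p i y) \<in> space Y i" "f i (\<eta> i y) + y \<in> space Y i"
        using lf(1)[OF i] m vy.subspace_add[OF is_repD(3)[OF rY i]] y by auto
      have "\<eta> i (f i (\<eta> i y) + y - f i (p i y)) = \<eta> i y"
        using ed(2)[OF i i n(3,2)] le(2)[OF i n(1) y] ef[OF i m(1)] ef[OF i m(2)] by simp
      moreover have "f i (p i (f i (\<eta> i y) + y - f i (p i y))) = f i (\<eta> i y)"
      proof -
        have "p i (f i (\<eta> i y) + y - f i (p i y)) = p i (f i (\<eta> i y)) + p i y - p i (f i (p i y))"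
          using pd(2)[OF i i n(3,2)] lp(2)[OF i n(1) y] by simp
        moreover have "f i \<dots> = f i (p i (f i (\<eta> i y))) + f i (p i y) - f i (p i (f i (p i y)))"
          using fd(2)[OF i i vx.subspace_add[OF is_repD(3)[OF X(1) i] lp(1)[OF i n(1)] m(2)] lp(1)[OF i n(2)]]
            lf(2)[OF i lp(1)[OF i n(1)] m(2)] by simp
        ultimately show ?thesis using fpf[OF i m(1)] fpf[OF i m(2)] by simp
      qed
      ultimately show ?thesis by simp
    qed
    then consider "\<forall>i\<in>verts G. \<forall>y\<in>space Y i. f i (\<eta> i y) + y - f i (p i y) = 0"
      | "\<forall>i\<in>verts G. \<forall>y\<in>space Y i. f i (\<eta> i y) + y - f i (p i y) = y"
      using idempotent_endomorphism[OF Y \<theta>] by blast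
    then show ?thesis
    proof cases
      case 1
      have "y \<in> f i ` space X i" if i: "i \<in> verts G" and y: "y \<in> space Y i" for i y
      proof -
        have "y = f i (p i y - \<eta> i y)"
        proof -
          have "y - (f i (p i y) - f i (\<eta> i y)) = f i (\<eta> i y) + y - f i (p i y)" by simp
          also have "\<dots> = 0" using 1 i y by blast
          finally show ?thesis using fd(2)[OF i i lp(1)[OF i y] le(1)[OF i y]] by simp
        qed
        then show ?thesis
          using vx.subspace_diff[OF is_repD(3)[OF X(1) i] lp(1)[OF i y] le(1)[OF i y]] by blast
      qed
      then have "f i ` space X i = space Y i" if "i \<in> verts G" for i using that lf(1) by blast
      then show ?thesis using f by (simp add: is_epi_def)
    next
      case 2
      have "f i0 (\<eta> i0 (f i0 v0)) = f i0 (p i0 (f i0 v0))"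
        using 2 nz(1) lf(1)[OF nz(1,2)] by (auto simp: algebra_simps)
      then have "f i0 v0 = 0" using fpf[OF nz(1,2)] ef[OF nz(1,2)] fd(1)[OF nz(1) nz(1)] by simp
      then show ?thesis using nz by simp
    qed
  qed
qed

section \<open>Consequences of membership in the two subcategories\<close>

lemma M_upper_no_mono:
  fixes X :: "('k::field, 'v::ab_group_add, 'a, 'b) qrep"
    and S :: "('k::field, 'w::ab_group_add, 'a, 'b) qrep"
  assumes "X \<in> M_upper G S" "\<not> is_zero_rep G X" "is_rep G S" shows "\<not> is_mono G X S f"
proof
  interpret vector_space "smul S" using assms(3) is_repD by blast
  assume "is_mono G X S f"
  then have "is_mono G X (rep_power S 1) (\<lambda>i u j. if j = (0::nat) then f i u else 0)"
    by (auto simp: is_mono_def is_hom_def linear_map_on_def rep_power_def inj_on_def fun_eq_iff)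
  then show False using assms direct_summand_refl by (auto simp: M_upper_def)
qed

lemma M_lower_no_epi:
  fixes X :: "('k::field, 'v::ab_group_add, 'a, 'b) qrep"
    and S :: "('k::field, 'w::ab_group_add, 'a, 'b) qrep"
  assumes "X \<in> M_lower G S" "\<not> is_zero_rep G X" shows "\<not> is_epi G S X f"
proof
  assume f: "is_epi G S X f"
  have "f i v \<in> (\<lambda>u. f i (u 0)) ` space (rep_power S 1) i" if "v \<in> space S i" for i v
    using that by (intro image_eqI[of _ _ "\<lambda>j. if j = (0::nat) then v else 0"]) (auto simp: rep_power_def)
  then have "(\<lambda>u. f i (u 0)) ` space (rep_power S 1) i = f i ` space S i" for i
    by (auto simp: rep_power_def)
  then have "is_epi G (rep_power S 1) X (\<lambda>i u. f i (u 0))"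
    using f by (auto simp: is_epi_def is_hom_def linear_map_on_def rep_power_def)
  then show False using assms direct_summand_refl by (auto simp: M_lower_def)
qed

end

section \<open>The Euler form\<close>

abbreviation (input) fun_scale :: "('k \<Rightarrow> 'v \<Rightarrow> 'v) \<Rightarrow> 'k \<Rightarrow> ('i \<Rightarrow> 'v) \<Rightarrow> 'i \<Rightarrow> 'v" where
  "fun_scale s c u j \<equiv> s c (u j)"

lemma vector_space_fun_scale:
  assumes "vector_space s" shows "vector_space (fun_scale s :: _ \<Rightarrow> ('i \<Rightarrow> _) \<Rightarrow> _)"
proof -
  interpret vector_space s by fact
  show ?thesis by standard (auto simp: scale_right_distrib scale_left_distrib fun_eq_iff)
qed

text \<open>The direct sum of the subspaces \<open>S j\<close>, realised by functions supported on
  \<open>J\<close> so that it lies in one ambient space.\<close>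

definition fun_space :: "'i set \<Rightarrow> ('i \<Rightarrow> 'v::zero set) \<Rightarrow> ('i \<Rightarrow> 'v) set" where
  "fun_space J S = {u. (\<forall>j\<in>J. u j \<in> S j) \<and> (\<forall>j. j \<notin> J \<longrightarrow> u j = 0)}"

lemma fd_fun_space:
  fixes s :: "'k::field \<Rightarrow> 'v::ab_group_add \<Rightarrow> 'v"
  assumes "vector_space s" "finite J" "\<And>j. j \<in> J \<Longrightarrow> fd_subspace s (S j)"
  shows "fd_subspace (fun_scale s) (fun_space J S) \<and>
    vector_space.dim (fun_scale s) (fun_space J S) = (\<Sum>j\<in>J. vector_space.dim s (S j))"
proof -
  interpret v: vector_space s by fact
  interpret f: vector_space "fun_scale s :: _ \<Rightarrow> ('a \<Rightarrow> 'v) \<Rightarrow> _" using vector_space_fun_scale assms(1) .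
  interpret vf: vector_space_pair s "fun_scale s :: _ \<Rightarrow> ('a \<Rightarrow> 'v) \<Rightarrow> _" ..
  interpret fv: vector_space_pair "fun_scale s :: _ \<Rightarrow> ('a \<Rightarrow> 'v) \<Rightarrow> _" s ..
  show ?thesis
    using assms(2,3)
  proof (induction J rule: finite_induct)
    case empty
    have "fun_space {} S = {0}" by (auto simp: fun_space_def fun_eq_iff)
    then show ?case using f.fd_subspace_zero f.dim_zero_subspace by simp
  next
    case (insert j J)
    have l: "Vector_Spaces.linear s (fun_scale s) (\<lambda>x i. if i = j then x else 0)"
      by (rule linearI'[OF v.vector_space_axioms f.vector_space_axioms]) (auto simp: fun_eq_iff)
    have l': "Vector_Spaces.linear (fun_scale s) s (\<lambda>u. u j)"
      by (rule linearI'[OF f.vector_space_axioms v.vector_space_axioms]) auto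
    have IH: "fd_subspace (fun_scale s) (fun_space J S)"
      "f.dim (fun_space J S) = (\<Sum>j\<in>J. v.dim (S j))" and Sj: "fd_subspace s (S j)"
      using insert by auto
    have z: "0 \<in> S j" using v.subspace_0 v.fd_subspaceD Sj by blast
    have "fun_space (insert j J) S =
        {u + w |u w. u \<in> (\<lambda>x i. if i = j then x else 0) ` S j \<and> w \<in> fun_space J S}" (is "?L = ?R")
    proof
      show "?L \<subseteq> ?R"
      proof
        fix u assume u: "u \<in> ?L"
        let ?a = "\<lambda>i. if i = j then u j else 0" and ?b = "u(j := 0)"
        have "u = ?a + ?b" by (auto simp: fun_eq_iff)
        moreover have "?a \<in> (\<lambda>x i. if i = j then x else 0) ` S j" using u by (auto simp: fun_space_def)
        moreover have "?b \<in> fun_space J S" using u insert(2) by (auto simp: fun_space_def)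
        ultimately show "u \<in> ?R" by blast
      qed
      show "?R \<subseteq> ?L" using insert(2) z by (auto simp: fun_space_def)
    qed
    then have fd: "fd_subspace (fun_scale s) (fun_space (insert j J) S)"
      using f.fd_subspace_sum[OF vf.rank_nullity(1)[OF l Sj] IH(1)] by simp
    have "(\<lambda>u. u j) ` fun_space (insert j J) S = S j"
    proof
      show "S j \<subseteq> (\<lambda>u. u j) ` fun_space (insert j J) S"
      proof
        fix x assume "x \<in> S j"
        moreover have "0 \<in> S i" if "i \<in> J" for i
          using v.subspace_0 v.fd_subspaceD insert(4)[of i] that by blast
        ultimately show "x \<in> (\<lambda>u. u j) ` fun_space (insert j J) S"
          by (intro image_eqI[of _ _ "\<lambda>i. if i = j then x else 0"]) (auto simp: fun_space_def)
      qed
    qed (auto simp: fun_space_def)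
    moreover have "{u \<in> fun_space (insert j J) S. u j = 0} = fun_space J S"
      using z insert(2) by (auto simp: fun_space_def)
    ultimately show ?case using fd fv.rank_nullity(2)[OF l' fd] IH insert(1,2) by simp
  qed
qed

lemma (in vector_space) subspace_contains_sum:
  assumes "subspace U" "\<And>b. b \<in> B \<Longrightarrow> w b \<in> U" shows "(\<Sum>b\<in>B. scale (c b) (w b)) \<in> U"
  using assms by (intro subspace_sum subspace_scale) auto

lemma coordinates_linear_map:
  assumes "vector_space s1" "vector_space s2"
    and B: "module.independent s1 B" "finite B" "module.span s1 B = U"
    and W: "module.subspace s2 W" "\<And>b. b \<in> B \<Longrightarrow> w b \<in> W"
  shows "linear_map_on s1 U s2 W (\<lambda>v. \<Sum>b\<in>B. s2 (module.representation s1 B v b) (w b))"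
proof -
  interpret vector_space_pair s1 s2 using assms by (simp add: vector_space_pair_def)
  show ?thesis
    unfolding linear_map_on_def
  proof (intro conjI ballI allI)
    show "(\<Sum>b\<in>B. s2 (vs1.representation B v b) (w b)) \<in> W" for v
      using vs2.subspace_contains_sum[OF W] .
    fix u assume u: "u \<in> U"
    show "(\<Sum>b\<in>B. s2 (vs1.representation B (u + v) b) (w b)) =
      (\<Sum>b\<in>B. s2 (vs1.representation B u b) (w b)) + (\<Sum>b\<in>B. s2 (vs1.representation B v b) (w b))"
      if v: "v \<in> U" for v
      using vs1.representation_add[OF B(1), of v u] u v B(3)
      by (simp add: vs2.scale_left_distrib sum.distrib)
    show "(\<Sum>b\<in>B. s2 (vs1.representation B (s1 c u) b) (w b)) =
      s2 c (\<Sum>b\<in>B. s2 (vs1.representation B u b) (w b))" for c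
      using vs1.representation_scale[OF B(1), of u] u B(3) by (simp add: vs2.scale_sum_right)
  qed
qed

lemma coordinates_unique:
  assumes "vector_space s1" "vector_space s2"
    and B: "module.independent s1 B" "finite B" "module.span s1 B = U"
    and f: "linear_map_on s1 U s2 W f" and v: "v \<in> U"
  shows "f v = (\<Sum>b\<in>B. s2 (module.representation s1 B v b) (f b))"
proof -
  interpret vector_space_pair s1 s2 using assms by (simp add: vector_space_pair_def)
  have BU: "B \<subseteq> U" using B(3) vs1.span_superset by blast
  obtain F where F: "Vector_Spaces.linear s1 s2 F" "\<And>x. x \<in> U \<Longrightarrow> F x = f x"
    using linear_extension[OF f] B(3) vs1.subspace_span by metis
  have "v = (\<Sum>b\<in>B. s1 (vs1.representation B v b) b)"
    using vs1.sum_representation_eq[OF B(1) _ B(2) order_refl] v B(3) by simp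
  then have "F v = (\<Sum>b\<in>B. s2 (vs1.representation B v b) (F b))"
    by (metis (mono_tags, lifting) F(1) linear_scale linear_sum sum.cong)
  also have "\<dots> = (\<Sum>b\<in>B. s2 (vs1.representation B v b) (f b))"
    using F(2) BU by (intro sum.cong) auto
  finally show ?thesis using F(2)[OF v] by simp
qed

text \<open>The Euler form computes \<open>dim Hom(X, Y) - dim Ext\<^sup>1(X, Y)\<close>: both spaces are read off the map
  \<open>\<eta> \<mapsto> (\<eta> \<circ> X\<^sub>x - Y\<^sub>x \<circ> \<eta>)\<^sub>x\<close>, which is surjective when \<open>Ext\<^sup>1\<close> vanishes.\<close>

lemma (in fin_digraph) ringel_form_Ext1_vanishes:
  fixes X :: "('k::field, 'v::ab_group_add, 'a, 'b) qrep"
    and Y :: "('k::field, 'w::ab_group_add, 'a, 'b) qrep"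
  assumes X: "is_rep G X" and Y: "is_rep G Y" and E: "Ext1_vanishes G X Y"
  shows "ringel_form G (dim_vec G X) (dim_vec G Y) \<ge> 0"
    and "Hom_nonzero G X Y \<Longrightarrow> ringel_form G (dim_vec G X) (dim_vec G Y) > 0"
proof -
  interpret vx: vector_space "smul X" using X is_repD by blast
  interpret vy: vector_space "smul Y" using Y is_repD by blast
  interpret f0: vector_space "fun_scale (smul Y) :: _ \<Rightarrow> ('a \<times> 'v \<Rightarrow> 'w) \<Rightarrow> _"
    by (rule vector_space_fun_scale) (rule vy.vector_space_axioms)
  interpret f1: vector_space "fun_scale (smul Y) :: _ \<Rightarrow> ('b \<times> 'v \<Rightarrow> 'w) \<Rightarrow> _"
    by (rule vector_space_fun_scale) (rule vy.vector_space_axioms)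
  interpret f01: vector_space_pair "fun_scale (smul Y) :: _ \<Rightarrow> ('a \<times> 'v \<Rightarrow> 'w) \<Rightarrow> _"
    "fun_scale (smul Y) :: _ \<Rightarrow> ('b \<times> 'v \<Rightarrow> 'w) \<Rightarrow> _" ..
  have "\<exists>B. B \<subseteq> space X i \<and> vx.independent B \<and> finite B \<and> vx.span B = space X i \<and> card B = vx.dim (space X i)"
    if "i \<in> verts G" for i
    using vx.fd_subspace_basis[OF is_repD(2)[OF X that]] by metis
  then obtain Bas where Bas: "\<And>i. i \<in> verts G \<Longrightarrow> Bas i \<subseteq> space X i"
      "\<And>i. i \<in> verts G \<Longrightarrow> vx.independent (Bas i)" "\<And>i. i \<in> verts G \<Longrightarrow> finite (Bas i)"
      "\<And>i. i \<in> verts G \<Longrightarrow> vx.span (Bas i) = space X i" "\<And>i. i \<in> verts G \<Longrightarrow> card (Bas i) = vx.dim (space X i)"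
    by metis
  have "\<exists>F. Vector_Spaces.linear (smul Y) (smul Y) F \<and> (\<forall>v\<in>space Y (tail G x). F v = amap Y x v)"
    if x: "x \<in> arcs G" for x
  proof -
    interpret vector_space_pair "smul Y" "smul Y" ..
    show ?thesis
      using linear_extension[OF is_repD(4)[OF Y x] is_repD(3)[OF Y tail_in_verts[OF x]]] by metis
  qed
  then obtain F where F: "\<And>x. x \<in> arcs G \<Longrightarrow> Vector_Spaces.linear (smul Y) (smul Y) (F x)"
      "\<And>x v. x \<in> arcs G \<Longrightarrow> v \<in> space Y (tail G x) \<Longrightarrow> F x v = amap Y x v"
    by metis
  \<comment> \<open>A linear map out of \<open>space X i\<close> is recorded by its values on the
    basis \<open>Bas i\<close>. Families of maps over the vertices and over the arrows thus become
    function spaces whose dimensions are the two sums in the Euler form.\<close>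
  define J0 where "J0 = Sigma (verts G) Bas"
  define J1 where "J1 = Sigma (arcs G) (\<lambda>x. Bas (tail G x))"
  define S0 where "S0 = (\<lambda>(i, b::'v). space Y i)"
  define S1 where "S1 = (\<lambda>(x, b::'v). space Y (head G x))"
  have fin: "finite J0" "finite J1" using Bas(3) by (auto simp: J0_def J1_def)
  have fdim0: "fd_subspace (fun_scale (smul Y)) (fun_space J0 S0)"
      "f0.dim (fun_space J0 S0) = (\<Sum>j\<in>J0. vy.dim (S0 j))"
    using fd_fun_space[OF vy.vector_space_axioms fin(1), of S0] is_repD(2)[OF Y]
    by (auto simp: J0_def S0_def)
  have fdim1: "fd_subspace (fun_scale (smul Y)) (fun_space J1 S1)"
      "f1.dim (fun_space J1 S1) = (\<Sum>j\<in>J1. vy.dim (S1 j))"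
    using fd_fun_space[OF vy.vector_space_axioms fin(2), of S1] is_repD(2)[OF Y] head_in_verts
    by (auto simp: J1_def S1_def)
  have d0: "int (f0.dim (fun_space J0 S0)) = (\<Sum>i\<in>verts G. dim_vec G X i * dim_vec G Y i)"
  proof -
    have "(\<Sum>j\<in>J0. vy.dim (S0 j)) = (\<Sum>i\<in>verts G. \<Sum>b\<in>Bas i. vy.dim (space Y i))"
      unfolding J0_def S0_def using Bas(3) by (subst sum.Sigma) (auto intro!: sum.cong)
    then show ?thesis using fdim0(2) Bas(5) by (simp add: dim_vec_def)
  qed
  have d1: "int (f1.dim (fun_space J1 S1)) = (\<Sum>x\<in>arcs G. dim_vec G X (tail G x) * dim_vec G Y (head G x))"
  proof -
    have "(\<Sum>j\<in>J1. vy.dim (S1 j)) = (\<Sum>x\<in>arcs G. \<Sum>b\<in>Bas (tail G x). vy.dim (space Y (head G x)))"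
      unfolding J1_def S1_def using Bas(3) by (subst sum.Sigma) (auto intro!: sum.cong)
    then show ?thesis using fdim1(2) Bas(5) by (simp add: dim_vec_def)
  qed
  define ext where "ext = (\<lambda>(u :: 'a \<times> 'v \<Rightarrow> 'w) i v. \<Sum>b\<in>Bas i. smul Y (vx.representation (Bas i) v b) (u (i, b)))"
  \<comment> \<open>\<open>F x\<close> replaces \<open>amap Y x\<close> so that \<open>T\<close> is
    linear on all functions and not only on \<open>fun_space J0 S0\<close>.\<close>
  define T where "T = (\<lambda>u (x, b). if (x, b) \<in> J1
      then ext u (head G x) (amap X x b) - F x (ext u (tail G x) b) else 0)"
  have exta: "ext (u + w) i v = ext u i v + ext w i v" for u w i v
    by (simp add: ext_def vy.scale_right_distrib sum.distrib)
  have exts: "ext (fun_scale (smul Y) c u) i v = smul Y c (ext u i v)" for u c i v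
    by (simp add: ext_def vy.scale_sum_right vy.scale_scale mult.commute)
  have Fl: "F x (u + v) = F x u + F x v" "F x (smul Y c u) = smul Y c (F x u)" if "x \<in> arcs G" for x u v c
  proof -
    interpret l: Vector_Spaces.linear "smul Y" "smul Y" "F x" using F(1)[OF that] .
    show "F x (u + v) = F x u + F x v" "F x (smul Y c u) = smul Y c (F x u)" by (simp_all add: l.add l.scale)
  qed
  have T: "Vector_Spaces.linear (fun_scale (smul Y)) (fun_scale (smul Y)) T"
  proof (rule linearI'[OF f0.vector_space_axioms f1.vector_space_axioms])
    show "T (u + w) = T u + T w" for u w
      by (auto simp: T_def exta Fl fun_eq_iff J1_def)
    show "T (fun_scale (smul Y) c u) = fun_scale (smul Y) c (T u)" for c u
      by (auto simp: T_def exts Fl fun_eq_iff J1_def vy.scale_right_diff_distrib)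
  qed
  have ext_hom: "linear_map_on (smul X) (space X i) (smul Y) (space Y i) (ext u i)"
    if "u \<in> fun_space J0 S0" "i \<in> verts G" for u i
    unfolding ext_def
    by (rule coordinates_linear_map[OF vx.vector_space_axioms vy.vector_space_axioms Bas(2-4) is_repD(3)[OF Y]])
      (use that in \<open>auto simp: fun_space_def J0_def S0_def\<close>)
  have ext_eq: "ext (\<lambda>(i, b). if (i, b) \<in> J0 then \<eta> i b else 0) i v = \<eta> i v"
    if "linear_map_on (smul X) (space X i) (smul Y) (space Y i) (\<eta> i)" "i \<in> verts G" "v \<in> space X i" for \<eta> i v
    using coordinates_unique[OF vx.vector_space_axioms vy.vector_space_axioms Bas(2-4)[OF that(2)] that(1,3)] that(2)
    by (simp add: ext_def J0_def)
  have in0: "(\<lambda>(i, b). if (i, b) \<in> J0 then \<eta> i b else 0) \<in> fun_space J0 S0"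
    if "\<And>i. i \<in> verts G \<Longrightarrow> linear_map_on (smul X) (space X i) (smul Y) (space Y i) (\<eta> i)" for \<eta>
    using linear_map_onD(1)[OF that] Bas(1) by (auto simp: fun_space_def J0_def S0_def)
  note lx = linear_map_onD[OF is_repD(4)[OF X]]
  have bX: "b \<in> space X (tail G x)" if "(x, b) \<in> J1" for x b
    using that Bas(1)[OF tail_in_verts] by (auto simp: J1_def)
  have "fun_space J1 S1 \<subseteq> T ` fun_space J0 S0"
  proof
    fix z assume z: "z \<in> fun_space J1 S1"
    define \<zeta> where "\<zeta> = (\<lambda>x v. \<Sum>b\<in>Bas (tail G x). smul Y (vx.representation (Bas (tail G x)) v b) (z (x, b)))"
    have \<zeta>: "linear_map_on (smul X) (space X (tail G x)) (smul Y) (space Y (head G x)) (\<zeta> x)"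
      if x: "x \<in> arcs G" for x
      unfolding \<zeta>_def
      by (rule coordinates_linear_map[OF vx.vector_space_axioms vy.vector_space_axioms
            Bas(2-4)[OF tail_in_verts[OF x]] is_repD(3)[OF Y head_in_verts[OF x]]])
        (use x z in \<open>auto simp: fun_space_def J1_def S1_def\<close>)
    have \<zeta>b: "\<zeta> x b = z (x, b)" if "(x, b) \<in> J1" for x b
    proof -
      have t: "x \<in> arcs G" "b \<in> Bas (tail G x)" "tail G x \<in> verts G" using that by (auto simp: J1_def)
      have "\<zeta> x b = (\<Sum>a\<in>Bas (tail G x). if a = b then z (x, a) else 0)"
        unfolding \<zeta>_def using vx.representation_basis[OF Bas(2)[OF t(3)] t(2)] by (intro sum.cong) auto
      then show ?thesis using Bas(3)[OF t(3)] t(2) by simp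
    qed
    obtain \<eta> where \<eta>: "\<And>i. i \<in> verts G \<Longrightarrow> linear_map_on (smul X) (space X i) (smul Y) (space Y i) (\<eta> i)"
        "\<And>x v. x \<in> arcs G \<Longrightarrow> v \<in> space X (tail G x) \<Longrightarrow>
          \<zeta> x v = \<eta> (head G x) (amap X x v) - amap Y x (\<eta> (tail G x) v)"
      using Ext1_vanishes_coboundary[OF X Y E \<zeta>] by metis
    let ?u = "\<lambda>(i, b). if (i, b) \<in> J0 then \<eta> i b else 0"
    have "T ?u (x, b) = z (x, b)" if J: "(x, b) \<in> J1" for x b
    proof -
      have x: "x \<in> arcs G" using J by (simp add: J1_def)
      note b = bX[OF J] and t = tail_in_verts[OF x] and h = head_in_verts[OF x]
      have "T ?u (x, b) = \<eta> (head G x) (amap X x b) - F x (\<eta> (tail G x) b)"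
        using J ext_eq[where \<eta>=\<eta>, OF \<eta>(1)[OF h] h lx(1)[OF x b]] ext_eq[where \<eta>=\<eta>, OF \<eta>(1)[OF t] t b] by (simp add: T_def)
      also have "\<dots> = \<zeta> x b" using \<eta>(2)[OF x b] F(2)[OF x linear_map_onD(1)[OF \<eta>(1)[OF t] b]] by simp
      finally show ?thesis using \<zeta>b[OF J] by simp
    qed
    moreover have "T ?u p = z p" if "p \<notin> J1" for p
      using that z by (cases p) (auto simp: T_def fun_space_def)
    ultimately have "T ?u p = z p" for p by (cases p; cases "p \<in> J1") simp_all
    then have "z = T ?u" by (simp add: fun_eq_iff)
    then show "z \<in> T ` fun_space J0 S0" using in0[of \<eta>, OF \<eta>(1)] by blast
  qed
  then have le: "f1.dim (fun_space J1 S1) \<le> f1.dim (T ` fun_space J0 S0)"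
    using f1.fd_subspace_dim_mono(2)[OF f01.rank_nullity(1)[OF T fdim0(1)] f1.fd_subspaceD[OF fdim1(1)]] by blast
  note rn = f01.rank_nullity(2)[OF T fdim0(1)]
  show "ringel_form G (dim_vec G X) (dim_vec G Y) \<ge> 0"
    using le rn d0 d1 by (simp add: ringel_form_def)
  assume "Hom_nonzero G X Y"
  then obtain f i v where f: "is_hom G X Y f" "i \<in> verts G" "v \<in> space X i" "f i v \<noteq> 0"
    by (auto simp: Hom_nonzero_def)
  let ?u = "\<lambda>(i, b). if (i, b) \<in> J0 then f i b else 0"
  note lf = is_homD(1)[OF f(1)]
  \<comment> \<open>A homomorphism has zero coboundary, so its values on the bases form a nonzero
    vector of the kernel of \<open>T\<close>, which makes the inequality strict.\<close>
  have "T ?u (x, b) = 0" for x b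
  proof (cases "(x, b) \<in> J1")
    case J: True
    have x: "x \<in> arcs G" using J by (simp add: J1_def)
    note b = bX[OF J] and t = tail_in_verts[OF x] and h = head_in_verts[OF x]
    show ?thesis
      using J ext_eq[where \<eta>=f, OF lf[OF h] h lx(1)[OF x b]] ext_eq[where \<eta>=f, OF lf[OF t] t b] is_homD(2)[OF f(1) x b]
        F(2)[OF x linear_map_onD(1)[OF lf[OF t] b]] by (simp add: T_def)
  qed (simp add: T_def)
  then have "T ?u = 0" by (auto simp: fun_eq_iff)
  moreover have "?u \<noteq> 0"
  proof
    assume "?u = 0"
    then have "ext ?u i v = 0" by (simp add: ext_def)
    then show False using ext_eq[where \<eta>=f, OF lf[OF f(2)] f(2,3)] f(4) by simp
  qed
  moreover have "fd_subspace (fun_scale (smul Y)) {u\<in>fun_space J0 S0. T u = 0}"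
    using f0.fd_subspace_dim_mono(1)[OF fdim0(1) f01.subspace_kernel_on[OF T f0.fd_subspaceD[OF fdim0(1)]]] by blast
  ultimately have "f0.dim {u\<in>fun_space J0 S0. T u = 0} > 0"
    using f0.fd_dim_pos[of _ ?u] in0[of f, OF lf] by blast
  then show "ringel_form G (dim_vec G X) (dim_vec G Y) > 0"
    using le rn d0 d1 by (simp add: ringel_form_def)
qed

section \<open>Roots of the quiver\<close>

text \<open>Here \<open>s = b1 + b2 + b3\<close> and \<open>p = b7 + b8\<close> for a vector \<open>b\<close> below \<^const>\<open>alpha8\<close>; the first three
  disjuncts negate that both Euler forms with \<^const>\<open>alpha8\<close> are nonnegative and their sum positive.\<close>

lemma box_search:
  "list_all (\<lambda>s. list_all (\<lambda>b4. list_all (\<lambda>b5. list_all (\<lambda>b6. list_all (\<lambda>p.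
      s + 5 * b4 + 4 * b5 < 10 * b6 + 5 * p \<or> 2 * b6 + 7 * p < 7 * s + 4 * b4 + 4 * b5 \<or>
      b4 + 2 * p \<le> 6 * s + 8 * b6 \<or>
      list_all (\<lambda>b7. p < b7 \<or> 7 < p - b7 \<or>
        s + b4 * b4 + b5 * b5 + b6 * b6 + b7 * b7 + (p - b7) * (p - b7) \<noteq> 1 + s * b4 + b4 * b5 + b5 * b6 + b5 * p \<or>
        (s = 3 \<and> b4 = 8 \<and> b5 = 12 \<and> b6 = 2 \<and> b7 = 7 \<and> p = 14) \<or>
        (s = 0 \<and> b4 = 1 \<and> b5 = 2 \<and> b6 = 0 \<and> b7 = 1 \<and> p = 2)) [0..7])
      [0..14]) [0..2]) [0..12]) [0..8]) [0..(3::int)]"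
  by code_simp

lemma ringel_form_sub_scale:
  "ringel_form G (\<lambda>j. a j - c * u j) (\<lambda>j. b j - d * v j) =
     ringel_form G a b - d * ringel_form G a v - c * ringel_form G u b + c * d * ringel_form G u v"
  by (simp add: ringel_form_def left_diff_distrib right_diff_distrib sum_subtractf sum_distrib_left
      sum.distrib algebra_simps)

context fin_digraph
begin

lemma ringel_form_unit_vec:
  assumes i: "i \<in> verts G" and l: "\<And>x. x \<in> arcs G \<Longrightarrow> tail G x \<noteq> head G x"
  shows "ringel_form G (unit_vec i) (unit_vec i) = 1"
proof -
  have "(\<Sum>j\<in>verts G. unit_vec i j * unit_vec i j) = (\<Sum>j\<in>verts G. if j = i then 1 else 0)"
    by (intro sum.cong) (auto simp: unit_vec_def)
  moreover have "(\<Sum>x\<in>arcs G. unit_vec i (tail G x) * unit_vec i (head G x)) = 0"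
  proof (intro sum.neutral ballI)
    fix x assume "x \<in> arcs G"
    then show "unit_vec i (tail G x) * unit_vec i (head G x) = 0" using l[of x] by (auto simp: unit_vec_def)
  qed
  ultimately show ?thesis using i by (simp add: ringel_form_def)
qed

text \<open>Simple reflections preserve the quadratic form, and its value at a coordinate vector is
  1 since there are no loops.\<close>

lemma ringel_form_root:
  assumes l: "\<And>x. x \<in> arcs G \<Longrightarrow> tail G x \<noteq> head G x" and r: "positive_real_root G \<beta>"
  shows "ringel_form G \<beta> \<beta> = 1"
proof -
  have refl: "ringel_form G (simple_reflection G i \<alpha>) (simple_reflection G i \<alpha>) = ringel_form G \<alpha> \<alpha>"
    if "i \<in> verts G" for i \<alpha>
    unfolding simple_reflection_def ringel_form_sub_scale
    using ringel_form_unit_vec[OF that l] by (simp add: sym_form_def algebra_simps)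
  have "ringel_form G (w \<alpha>) (w \<alpha>) = ringel_form G \<alpha> \<alpha>" if "w \<in> weyl_group G" for w \<alpha>
    using that by induction (simp_all add: refl)
  then show ?thesis using r ringel_form_unit_vec[OF _ l] by (auto simp: positive_real_root_def)
qed

end

section \<open>The quiver with eight vertices and its roots\<close>

lemma verts_Q8: "verts Q8 = {1, 2, 3, 4, 5, 6, 7, 8}"
  by (auto simp: Q8_def)

lemma arcs_Q8: "arcs Q8 = {(1,4), (2,4), (3,4), (4,5), (5,6), (5,7), (5,8)}"
  by (simp add: Q8_def)

lemma tail_head_Q8: "tail Q8 = fst" "head Q8 = snd"
  by (simp_all add: Q8_def)

lemmas Q8_simps = verts_Q8 arcs_Q8 tail_head_Q8

lemma fin_digraph_Q8: "fin_digraph Q8"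
  by unfold_locales (auto simp: Q8_simps)

lemma ringel_form_Q8:
  "ringel_form Q8 a b = a 1 * b 1 + a 2 * b 2 + a 3 * b 3 + a 4 * b 4 + a 5 * b 5 + a 6 * b 6 + a 7 * b 7 + a 8 * b 8
     - (a 1 * b 4 + a 2 * b 4 + a 3 * b 4 + a 4 * b 5 + a 5 * b 6 + a 5 * b 7 + a 5 * b 8)"
  by (simp add: ringel_form_def Q8_simps)

definition vec8 :: "int list \<Rightarrow> nat \<Rightarrow> int" where
  "vec8 xs i = (if i \<in> {1..8} then xs ! (i - 1) else 0)"

lemma alpha8_vec8: "alpha8 = vec8 [1, 1, 1, 8, 12, 2, 7, 7]"
  by (auto simp: alpha8_def vec8_def fun_eq_iff)

lemma vec8_eqI:
  assumes "\<And>i. i \<notin> {1..8} \<Longrightarrow> u i = 0"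
    "u 1 = a" "u 2 = b" "u 3 = c" "u 4 = d" "u 5 = e" "u 6 = f" "u 7 = g" "u 8 = h"
  shows "u = vec8 [a, b, c, d, e, f, g, h]"
proof
  fix i :: nat
  consider "i \<notin> {1..8}" | "i = 1" | "i = 2" | "i = 3" | "i = 4" | "i = 5" | "i = 6" | "i = 7" | "i = 8"
    by (simp, linarith)
  then show "u i = vec8 [a, b, c, d, e, f, g, h] i"
    by cases (auto simp: vec8_def assms simp del: One_nat_def)
qed

lemma simple_reflection_vec8:
  "simple_reflection Q8 1 (vec8 [a, b, c, d, e, f, g, h]) = vec8 [d - a, b, c, d, e, f, g, h]"
  "simple_reflection Q8 2 (vec8 [a, b, c, d, e, f, g, h]) = vec8 [a, d - b, c, d, e, f, g, h]"
  "simple_reflection Q8 3 (vec8 [a, b, c, d, e, f, g, h]) = vec8 [a, b, d - c, d, e, f, g, h]"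
  "simple_reflection Q8 4 (vec8 [a, b, c, d, e, f, g, h]) = vec8 [a, b, c, a + b + c + e - d, e, f, g, h]"
  "simple_reflection Q8 5 (vec8 [a, b, c, d, e, f, g, h]) = vec8 [a, b, c, d, d + f + g + h - e, f, g, h]"
  "simple_reflection Q8 6 (vec8 [a, b, c, d, e, f, g, h]) = vec8 [a, b, c, d, e, e - f, g, h]"
  "simple_reflection Q8 7 (vec8 [a, b, c, d, e, f, g, h]) = vec8 [a, b, c, d, e, f, e - g, h]"
  "simple_reflection Q8 8 (vec8 [a, b, c, d, e, f, g, h]) = vec8 [a, b, c, d, e, f, g, e - h]"
  by (rule vec8_eqI; force simp: simple_reflection_def sym_form_def ringel_form_Q8 unit_vec_def vec8_def)+

lemma positive_real_root_alpha8: "positive_real_root Q8 alpha8"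
proof -
  let ?r = "simple_reflection Q8"
  \<comment> \<open>Found by descent: read from the left and applied to \<open>alpha8\<close>, each
    reflection lowers one coordinate (first 8 to 1 + 1 + 1 + 12 - 8 = 7 at vertex 4) until the
    coordinate vector at 4 remains.\<close>
  let ?w = "?r 4 \<circ> (?r 5 \<circ> (?r 7 \<circ> (?r 5 \<circ> (?r 4 \<circ> (?r 8 \<circ> (?r 5 \<circ> (?r 4 \<circ> (?r 7 \<circ> (?r 5 \<circ> (?r 6 \<circ> (?r 8 \<circ> (?r 5 \<circ> (?r 4 \<circ> (?r 1 \<circ> (?r 2 \<circ> (?r 3 \<circ> id))))))))))))))))"
  have w: "?w \<in> weyl_group Q8"
    by (intro weyl_group.intros) (simp_all add: verts_Q8)
  have "unit_vec 4 = vec8 [0, 0, 0, 1, 0, 0, 0, 0]"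
    by (rule vec8_eqI) (auto simp: unit_vec_def)
  then have "?w (unit_vec 4) = alpha8"
    by (simp add: alpha8_vec8 simple_reflection_vec8 del: One_nat_def)
  then have "\<exists>w\<in>weyl_group Q8. \<exists>i\<in>verts Q8. alpha8 = w (unit_vec i)"
    by (intro bexI[OF _ w] bexI[of _ 4]) (simp_all only: verts_Q8, simp)
  moreover have "alpha8 i \<ge> 0" for i
    by (auto simp: alpha8_def nth_Cons split: nat.split)
  moreover have "alpha8 1 \<noteq> 0" by (simp add: alpha8_def)
  ultimately show ?thesis by (auto simp: positive_real_root_def)
qed

text \<open>Vertices 1, 2, 3 enter the linear forms only through their sum, and their coordinates,
  being 0 or 1, equal their squares; 7 and 8 enter through their sum except for their squares. This
  collapses the box to the search above. \<open>alpha8\<close> itself survives because its form with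
  itself is 1.\<close>

lemma Euler_form_candidates:
  assumes b: "\<And>i. i \<in> verts Q8 \<Longrightarrow> 0 \<le> b i \<and> b i \<le> alpha8 i" and z: "\<And>i. i \<notin> verts Q8 \<Longrightarrow> b i = 0"
    and q: "ringel_form Q8 b b = 1"
    and ab: "ringel_form Q8 alpha8 b \<ge> 0" and ba: "ringel_form Q8 b alpha8 \<ge> 0"
    and pos: "ringel_form Q8 alpha8 b > 0 \<or> ringel_form Q8 b alpha8 > 0"
  shows "b = alpha8 \<or> b = vec8 [0, 0, 0, 1, 2, 0, 1, 1]"
proof -
  have al: "alpha8 1 = 1" "alpha8 2 = 1" "alpha8 3 = 1" "alpha8 4 = 8" "alpha8 5 = 12" "alpha8 6 = 2"
    "alpha8 7 = 7" "alpha8 8 = 7"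
    by (simp_all add: alpha8_def)
  define s where "s = b 1 + b 2 + b 3"
  define p where "p = b 7 + b 8"
  have rng: "0 \<le> b 1" "b 1 \<le> 1" "0 \<le> b 2" "b 2 \<le> 1" "0 \<le> b 3" "b 3 \<le> 1" "0 \<le> b 4" "b 4 \<le> 8"
    "0 \<le> b 5" "b 5 \<le> 12" "0 \<le> b 6" "b 6 \<le> 2" "0 \<le> b 7" "b 7 \<le> 7" "0 \<le> b 8" "b 8 \<le> 7"
    using b[of 1] b[of 2] b[of 3] b[of 4] b[of 5] b[of 6] b[of 7] b[of 8] by (simp_all add: verts_Q8 al del: One_nat_def)
  have sq: "b 1 * b 1 = b 1" "b 2 * b 2 = b 2" "b 3 * b 3 = b 3"
  proof -
    have "x * x = x" if "0 \<le> x" "x \<le> 1" for x :: int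
    proof -
      have "x = 0 \<or> x = 1" using that by linarith
      then show ?thesis by auto
    qed
    then show "b 1 * b 1 = b 1" "b 2 * b 2 = b 2" "b 3 * b 3 = b 3" using rng by auto
  qed
  have mem: "s \<in> set [0..3]" "b 4 \<in> set [0..8]" "b 5 \<in> set [0..12]" "b 6 \<in> set [0..2]" "p \<in> set [0..14]" "b 7 \<in> set [0..7]"
    using rng by (auto simp: s_def p_def)
  have p8: "p - b 7 = b 8" by (simp add: p_def)
  have l1: "\<not> s + 5 * b 4 + 4 * b 5 < 10 * b 6 + 5 * p" using ab by (simp add: ringel_form_Q8 al s_def p_def del: One_nat_def)
  have l2: "\<not> 2 * b 6 + 7 * p < 7 * s + 4 * b 4 + 4 * b 5" using ba by (simp add: ringel_form_Q8 al s_def p_def del: One_nat_def)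
  have l3: "\<not> b 4 + 2 * p \<le> 6 * s + 8 * b 6" using ab ba pos by (simp add: ringel_form_Q8 al s_def p_def del: One_nat_def) linarith
  have l4: "s + b 4 * b 4 + b 5 * b 5 + b 6 * b 6 + b 7 * b 7 + (p - b 7) * (p - b 7) = 1 + s * b 4 + b 4 * b 5 + b 5 * b 6 + b 5 * p"
    using q sq unfolding p8 by (simp add: ringel_form_Q8 s_def p_def algebra_simps del: One_nat_def)
  have "(s = 3 \<and> b 4 = 8 \<and> b 5 = 12 \<and> b 6 = 2 \<and> b 7 = 7 \<and> p = 14) \<or>
        (s = 0 \<and> b 4 = 1 \<and> b 5 = 2 \<and> b 6 = 0 \<and> b 7 = 1 \<and> p = 2)"
  proof -
    have "\<forall>b7\<in>set [0..7]. p < b7 \<or> 7 < p - b7 \<or>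
        s + b 4 * b 4 + b 5 * b 5 + b 6 * b 6 + b7 * b7 + (p - b7) * (p - b7) \<noteq>
          1 + s * b 4 + b 4 * b 5 + b 5 * b 6 + b 5 * p \<or>
        (s = 3 \<and> b 4 = 8 \<and> b 5 = 12 \<and> b 6 = 2 \<and> b7 = 7 \<and> p = 14) \<or>
        (s = 0 \<and> b 4 = 1 \<and> b 5 = 2 \<and> b 6 = 0 \<and> b7 = 1 \<and> p = 2)"
      using box_search[unfolded list_all_iff] mem(1-5) l1 l2 l3 by blast
    moreover have "\<not> p < b 7" "\<not> 7 < p - b 7" using rng by (auto simp: p_def)
    ultimately show ?thesis using mem(6) l4 by blast
  qed
  then show ?thesis
  proof (elim disjE conjE)
    assume "s = 3" "b 4 = 8" "b 5 = 12" "b 6 = 2" "b 7 = 7" "p = 14"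
    then have "b = vec8 [1, 1, 1, 8, 12, 2, 7, 7]"
      using rng z by (intro vec8_eqI) (auto simp: s_def p_def verts_Q8)
    then show ?thesis by (simp add: alpha8_vec8)
  next
    assume "s = 0" "b 4 = 1" "b 5 = 2" "b 6 = 0" "b 7 = 1" "p = 2"
    then have "b = vec8 [0, 0, 0, 1, 2, 0, 1, 1]"
      using rng z by (intro vec8_eqI) (auto simp: s_def p_def verts_Q8)
    then show ?thesis by simp
  qed
qed

section \<open>A dimension count excluding the remaining root\<close>

text \<open>The spaces \<open>X4\<close>, \<dots>, \<open>X8\<close> and maps \<open>d\<close>, \<dots>, \<open>g\<close> are those of \<open>X\<close>, and \<open>A\<close> is the sum of the
  images of \<open>a\<close>, \<open>b\<close>, \<open>c\<close>. For the brick \<open>B\<close> of dimension \<open>(0,0,0,1,2,0,1,1)\<close>, \<open>Ext\<^sup>1(B, X) = 0\<close> gives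
  \<open>onto_f\<close>, \<open>onto_g\<close> and \<open>decomp\<close>, \<open>Ext\<^sup>1(X, B) = 0\<close> gives \<open>rigid\<close>, and \<open>no_split\<close> is indecomposability
  of \<open>X\<close>, tested on idempotents vanishing at 1, 2, 3 and 6.\<close>

locale split_data = vector_space s for s :: "'k::field \<Rightarrow> 'v::ab_group_add \<Rightarrow> 'v" +
  fixes X4 X5 X7 X8 A :: "'v set" and d e f g :: "'v \<Rightarrow> 'v"
  assumes fd4: "fd_subspace s X4" and fd5: "fd_subspace s X5" and fd7: "fd_subspace s X7"
    and fd8: "fd_subspace s X8" and fdA: "fd_subspace s A" and A4: "A \<subseteq> X4"
    and lin_d: "Vector_Spaces.linear s s d" and lin_e: "Vector_Spaces.linear s s e"
    and lin_f: "Vector_Spaces.linear s s f" and lin_g: "Vector_Spaces.linear s s g"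
    and d_in: "x \<in> X4 \<Longrightarrow> d x \<in> X5" and f_in: "z \<in> X5 \<Longrightarrow> f z \<in> X7" and g_in: "z \<in> X5 \<Longrightarrow> g z \<in> X8"
    and onto_f: "r \<in> X7 \<Longrightarrow> \<exists>z\<in>X5. e z = 0 \<and> f z = r"
    and onto_g: "r \<in> X8 \<Longrightarrow> \<exists>z\<in>X5. e z = 0 \<and> g z = r"
    and decomp: "z \<in> X5 \<Longrightarrow> \<exists>x\<in>X4. \<exists>p\<in>X5. \<exists>q\<in>X5. z = d x + p + q \<and>
      e p = 0 \<and> f p = 0 \<and> e q = 0 \<and> g q = 0"
    and rigid: "x \<in> X4 \<Longrightarrow> y \<in> X4 \<Longrightarrow> x - y \<in> A \<Longrightarrow> f (d x) = 0 \<Longrightarrow> g (d y) = 0 \<Longrightarrow> x = 0 \<and> y = 0"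
    and no_split: "\<lbrakk>Vector_Spaces.linear s s h4; Vector_Spaces.linear s s h5;
        Vector_Spaces.linear s s h7; Vector_Spaces.linear s s h8;
        \<forall>x\<in>X4. h4 x \<in> X4; \<forall>z\<in>X5. h5 z \<in> X5; \<forall>r\<in>X7. h7 r \<in> X7; \<forall>r\<in>X8. h8 r \<in> X8;
        \<forall>x\<in>X4. h4 (h4 x) = h4 x; \<forall>z\<in>X5. h5 (h5 z) = h5 z;
        \<forall>r\<in>X7. h7 (h7 r) = h7 r; \<forall>r\<in>X8. h8 (h8 r) = h8 r;
        \<forall>a\<in>A. h4 a = 0; \<forall>x\<in>X4. h5 (d x) = d (h4 x); \<forall>z\<in>X5. e (h5 z) = 0;
        \<forall>z\<in>X5. h7 (f z) = f (h5 z); \<forall>z\<in>X5. h8 (g z) = g (h5 z); z \<in> X5\<rbrakk> \<Longrightarrow> h5 z = 0"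
    and dims: "dim X4 = 8" "dim X5 = 12" "dim X7 = 7" "dim X8 = 7" "dim A \<le> 3" "dim (e ` X5) \<le> 2"
begin

sublocale d: Vector_Spaces.linear s s d by (rule lin_d)
sublocale e: Vector_Spaces.linear s s e by (rule lin_e)
sublocale f: Vector_Spaces.linear s s f by (rule lin_f)
sublocale g: Vector_Spaces.linear s s g by (rule lin_g)

lemmas lin_simps = d.add e.add f.add g.add d.scale e.scale f.scale g.scale
  d.diff e.diff f.diff g.diff d.neg e.neg f.neg g.neg

text \<open>Exchanging vertices 7 and 8 preserves all the conditions, with the two arguments of
  \<open>rigid\<close> interchanged. Each statement about \<open>f\<close> thereby has its mirror
  image for \<open>g\<close>.\<close>

lemma swap: "split_data s X4 X5 X8 X7 A d e g f"
proof unfold_locales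
  show "\<exists>x\<in>X4. \<exists>p\<in>X5. \<exists>q\<in>X5. z = d x + p + q \<and> e p = 0 \<and> g p = 0 \<and> e q = 0 \<and> f q = 0"
    if "z \<in> X5" for z
  proof -
    obtain x p q where "x \<in> X4" "p \<in> X5" "q \<in> X5" "z = d x + p + q" "e p = 0" "f p = 0" "e q = 0" "g q = 0"
      using decomp[OF \<open>z \<in> X5\<close>] by blast
    moreover from this have "z = d x + q + p" by (simp add: algebra_simps)
    ultimately show ?thesis by blast
  qed
  show "x = 0 \<and> y = 0" if "x \<in> X4" "y \<in> X4" "x - y \<in> A" "g (d x) = 0" "f (d y) = 0" for x y
  proof -
    have "y - x \<in> A" using subspace_neg[OF fd_subspaceD[OF fdA] that(3)] by simp
    then show ?thesis using rigid[of y x] that by blast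
  qed
  show "h5 z = 0" if "Vector_Spaces.linear s s h4" "Vector_Spaces.linear s s h5"
        "Vector_Spaces.linear s s h8" "Vector_Spaces.linear s s h7"
        "\<forall>x\<in>X4. h4 x \<in> X4" "\<forall>z\<in>X5. h5 z \<in> X5" "\<forall>r\<in>X8. h8 r \<in> X8" "\<forall>r\<in>X7. h7 r \<in> X7"
        "\<forall>x\<in>X4. h4 (h4 x) = h4 x" "\<forall>z\<in>X5. h5 (h5 z) = h5 z"
        "\<forall>r\<in>X8. h8 (h8 r) = h8 r" "\<forall>r\<in>X7. h7 (h7 r) = h7 r"
        "\<forall>a\<in>A. h4 a = 0" "\<forall>x\<in>X4. h5 (d x) = d (h4 x)" "\<forall>z\<in>X5. e (h5 z) = 0"
        "\<forall>z\<in>X5. h8 (g z) = g (h5 z)" "\<forall>z\<in>X5. h7 (f z) = f (h5 z)" "z \<in> X5" for h4 h5 h7 h8 z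
    using that by (intro no_split[of h4 h5 h7 h8])
qed (use fd4 fd5 fd7 fd8 fdA A4 d_in f_in g_in onto_f onto_g dims in auto)

lemma linear_rank_one: "Vector_Spaces.linear s (*) \<phi> \<Longrightarrow> Vector_Spaces.linear s s (\<lambda>y. s (\<phi> y) x)"
  by (rule linearI'[OF vector_space_axioms vector_space_axioms])
    (auto simp: Vector_Spaces.linear_iff scale_left_distrib)

lemma linear_zero_map: "Vector_Spaces.linear s s (\<lambda>y. 0)"
  by (rule linearI'[OF vector_space_axioms vector_space_axioms]) auto

lemma linear_comp_functional:
  "Vector_Spaces.linear s (*) \<phi> \<Longrightarrow> Vector_Spaces.linear s s h \<Longrightarrow> Vector_Spaces.linear s (*) (\<lambda>x. \<phi> (h x))"
  by (auto simp: Vector_Spaces.linear_iff)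

lemma linear_rank_one_fd:
  "Vector_Spaces.linear s (*) \<phi> \<Longrightarrow> Vector_Spaces.linear s s (\<lambda>y. s (\<phi> (f (d y))) x)"
  by (auto simp: Vector_Spaces.linear_iff f.add d.add f.scale d.scale scale_left_distrib)

lemma functionalD:
  assumes "Vector_Spaces.linear s (*) \<phi>"
  shows "\<phi> (x + y) = \<phi> x + \<phi> y" "\<phi> (s c x) = c * \<phi> x" "\<phi> 0 = 0" "\<phi> (x - y) = \<phi> x - \<phi> y" "\<phi> (- x) = - \<phi> x"
proof -
  interpret Vector_Spaces.linear s "(*)" \<phi> by fact
  show "\<phi> (x + y) = \<phi> x + \<phi> y" "\<phi> (s c x) = c * \<phi> x" "\<phi> 0 = 0" "\<phi> (x - y) = \<phi> x - \<phi> y" "\<phi> (- x) = - \<phi> x"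
    by (simp_all add: add scale diff neg)
qed

lemmas sub4 = fd_subspaceD[OF fd4] and sub5 = fd_subspaceD[OF fd5] and sub7 = fd_subspaceD[OF fd7]
  and sub8 = fd_subspaceD[OF fd8] and subA = fd_subspaceD[OF fdA]

lemmas sub_scale = subspace_scale[OF sub4] subspace_scale[OF sub5] subspace_scale[OF sub7] subspace_scale[OF sub8]
lemmas sub_zero = subspace_0[OF sub4] subspace_0[OF sub5] subspace_0[OF sub7] subspace_0[OF sub8] subspace_0[OF subA]

lemma d_inj: "x \<in> X4 \<Longrightarrow> d x = 0 \<Longrightarrow> x = 0"
  using rigid[of x x] sub_zero by simp

text \<open>In each of the next five lemmas a counterexample yields an idempotent of \<open>End(X)\<close>, a sum of
  tensors of a functional and a vector.\<close>

lemma no_socle: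
  assumes z: "z \<in> X5" "e z = 0" "f z = 0" "g z = 0" shows "z = 0"
proof (rule ccontr)
  assume "z \<noteq> 0"
  \<comment> \<open>Otherwise \<open>rigid\<close> with equal arguments applies. With the functional
    chosen next vanishing on the image of \<open>d\<close>, the simple representation at vertex 5
    would split off.\<close>
  have "z \<notin> d ` X4"
  proof
    assume "z \<in> d ` X4"
    then obtain x where "x \<in> X4" "z = d x" by blast
    then show False using rigid[of x x] sub_zero z(3,4) \<open>z \<noteq> 0\<close> by auto
  qed
  then obtain \<psi> where \<psi>: "Vector_Spaces.linear s (*) \<psi>" "\<And>u. u \<in> d ` X4 \<Longrightarrow> \<psi> u = 0" "\<psi> z = 1"
    using functional_separation[OF d.subspace_image[OF sub4]] by metis
  have "s (\<psi> z) z = 0"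
    by (rule no_split[of "\<lambda>_. 0" "\<lambda>y. s (\<psi> y) z" "\<lambda>_. 0" "\<lambda>_. 0"])
      (use \<psi> z in \<open>simp_all add: linear_rank_one linear_rank_one_fd linear_zero_map functionalD[OF \<psi>(1)] sub_scale sub_zero lin_simps\<close>)
  then show False using \<psi>(3) \<open>z \<noteq> 0\<close> by simp
qed

lemma no_string_4_5_7:
  assumes x: "x \<in> X4" "e (d x) = 0" "g (d x) = 0" shows "x = 0"
proof (rule ccontr)
  assume "x \<noteq> 0"
  have sub: "subspace ((\<lambda>a. f (d a)) ` A)"
    using f.subspace_image[OF d.subspace_image[OF subA]] by (simp add: image_image)
  \<comment> \<open>If it did, \<open>x - a\<close> and \<open>x\<close> would contradict
    \<open>rigid\<close>. A functional vanishing on that image makes the idempotent zero on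
    \<open>A\<close>, and the summand would be the string 4 -> 5 -> 7.\<close>
  have "f (d x) \<notin> (\<lambda>a. f (d a)) ` A"
  proof
    assume "f (d x) \<in> (\<lambda>a. f (d a)) ` A"
    then obtain a where a: "a \<in> A" "f (d x) = f (d a)" by blast
    have "x - a \<in> X4" using a x A4 subspace_diff[OF sub4] by blast
    moreover have "(x - a) - x \<in> A" using subspace_neg[OF subA a(1)] by simp
    ultimately show False using rigid[of "x - a" x] a x \<open>x \<noteq> 0\<close> by (simp add: lin_simps)
  qed
  then obtain \<phi> where \<phi>: "Vector_Spaces.linear s (*) \<phi>" "\<And>u. u \<in> (\<lambda>a. f (d a)) ` A \<Longrightarrow> \<phi> u = 0" "\<phi> (f (d x)) = 1"
    using functional_separation[OF sub] by metis
  have "s (\<phi> (f (d x))) (d x) = 0"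
    by (rule no_split[of "\<lambda>y. s (\<phi> (f (d y))) x" "\<lambda>y. s (\<phi> (f y)) (d x)" "\<lambda>y. s (\<phi> y) (f (d x))" "\<lambda>_. 0"])
      (use \<phi> x in \<open>simp_all add: linear_rank_one linear_rank_one_fd linear_zero_map functionalD[OF \<phi>(1)] sub_scale sub_zero lin_simps
        linear_comp_functional lin_f lin_d d_in f_in\<close>)
  then show False using \<phi>(3) d_inj x \<open>x \<noteq> 0\<close> by simp
qed

lemma no_string_5_7:
  assumes \<phi>: "Vector_Spaces.linear s (*) \<phi>" "\<And>x. x \<in> X4 \<Longrightarrow> \<phi> (f (d x)) = 0" and r: "r \<in> X7"
  shows "\<phi> r = 0"
proof (rule ccontr)
  assume "\<phi> r \<noteq> 0"
  obtain z where z: "z \<in> X5" "f z = r" using onto_f[OF r] by blast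
  then obtain x p q where q: "x \<in> X4" "p \<in> X5" "q \<in> X5" "z = d x + p + q" "e p = 0" "f p = 0" "e q = 0" "g q = 0"
    using decomp by blast
  \<comment> \<open>Of the three parts of \<open>z\<close> only \<open>q\<close> contributes:
    \<open>f p = 0\<close>, and \<phi> kills the images from \<open>X4\<close>. As \<open>e\<close>
    and \<open>g\<close> vanish at \<open>q\<close>, a multiple of it would generate a summand of
    dimension one at 5 and at 7.\<close>
  have t: "\<phi> (f q) \<noteq> 0"
    using z q \<phi>(2)[OF q(1)] \<open>\<phi> r \<noteq> 0\<close> by (auto simp: lin_simps functionalD[OF \<phi>(1)])
  define q' where "q' = s (1 / \<phi> (f q)) q"
  have q': "q' \<in> X5" "e q' = 0" "g q' = 0" "\<phi> (f q') = 1"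
    using q t by (auto simp: q'_def sub_scale lin_simps functionalD[OF \<phi>(1)])
  have "s (\<phi> (f q')) q' = 0"
    by (rule no_split[of "\<lambda>y. 0" "\<lambda>y. s (\<phi> (f y)) q'" "\<lambda>y. s (\<phi> y) (f q')" "\<lambda>_. 0"])
      (use \<phi> q' in \<open>simp_all add: linear_rank_one linear_rank_one_fd linear_zero_map functionalD[OF \<phi>(1)] sub_scale sub_zero lin_simps
        linear_comp_functional lin_f lin_d d_in f_in\<close>)
  then show False using q'(4) by (auto simp: functionalD[OF \<phi>(1)])
qed

lemma no_string_7_5_8:
  assumes \<phi>: "Vector_Spaces.linear s (*) \<phi>" and \<chi>: "Vector_Spaces.linear s (*) \<chi>"
    and eq: "\<And>z. z \<in> X5 \<Longrightarrow> \<phi> (f z) = \<chi> (g z)" and A: "\<And>a. a \<in> A \<Longrightarrow> \<phi> (f (d a)) = 0" and r: "r \<in> X7"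
  shows "\<phi> r = 0"
proof (rule ccontr)
  assume "\<phi> r \<noteq> 0"
  obtain z where z: "z \<in> X5" "e z = 0" "f z = r" using onto_f[OF r] by blast
  then obtain x p q where q: "x \<in> X4" "p \<in> X5" "q \<in> X5" "z = d x + p + q" "e p = 0" "f p = 0" "e q = 0" "g q = 0"
    using decomp by blast
  have "e (d x) = 0" using z q by (simp add: lin_simps)
  \<comment> \<open>Here \<open>p\<close> drops out by \<open>f p = 0\<close> and \<open>q\<close>
    by \<open>\<phi> (f q) = \<chi> (g q) = 0\<close>, so the value comes from \<open>d x\<close>.
    The summand would have dimension one at 4, 5, 7 and 8.\<close>
  have t: "\<phi> (f (d x)) \<noteq> 0"
    using z q eq[OF q(3)] \<open>\<phi> r \<noteq> 0\<close> by (auto simp: lin_simps functionalD[OF \<phi>] functionalD[OF \<chi>])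
  define y where "y = s (1 / \<phi> (f (d x))) x"
  have y: "y \<in> X4" "e (d y) = 0" "\<phi> (f (d y)) = 1"
    using q t \<open>e (d x) = 0\<close> by (auto simp: y_def sub_scale lin_simps functionalD[OF \<phi>])
  have y': "\<chi> (g (d y)) = 1" using eq y d_in by auto
  have eq': "\<phi> (f (d x)) = \<chi> (g (d x))" if "x \<in> X4" for x using eq d_in that by blast
  have "s (\<phi> (f (d y))) (d y) = 0"
    by (rule no_split[of "\<lambda>x. s (\<phi> (f (d x))) y" "\<lambda>z. s (\<phi> (f z)) (d y)" "\<lambda>r. s (\<phi> r) (f (d y))" "\<lambda>r. s (\<chi> r) (g (d y))"])
      (use \<phi> \<chi> y y' A in \<open>simp_all add: linear_rank_one linear_rank_one_fd linear_zero_map functionalD[OF \<phi>] functionalD[OF \<chi>] sub_scale sub_zero lin_simps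
        linear_comp_functional lin_f lin_d d_in f_in g_in eq\<close>)
  then show False using y d_inj by (auto simp: lin_simps functionalD[OF \<phi>])
qed

lemma no_square:
  assumes \<phi>: "Vector_Spaces.linear s (*) \<phi>" and \<chi>: "Vector_Spaces.linear s (*) \<chi>"
    and eq: "\<And>y. y \<in> X4 \<Longrightarrow> \<phi> (f (d y)) = \<chi> (g (d y))" and A: "\<And>a. a \<in> A \<Longrightarrow> \<phi> (f (d a)) = 0"
    and x: "x \<in> X4" "d x = p + q" and p: "p \<in> X5" "e p = 0" "f p = 0" and q: "q \<in> X5" "e q = 0" "g q = 0"
  shows "\<phi> (f (d x)) = 0"
proof (rule ccontr)
  assume t: "\<phi> (f (d x)) \<noteq> 0"
  define t where "t = 1 / \<phi> (f (d x))"
  have fq: "f (d x) = f q" and gp: "g (d x) = g p" using x p q by (simp_all add: lin_simps)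
  have 1: "\<phi> (f (s t q)) = 1" "\<chi> (g (s t p)) = 1"
    using t eq[OF x(1)] by (simp_all add: t_def lin_simps functionalD[OF \<phi>] functionalD[OF \<chi>] flip: fq gp)
  let ?x = "s t x" and ?p = "s t p" and ?q = "s t q"
  have dx: "d ?x = ?p + ?q" using x by (simp add: lin_simps scale_right_distrib)
  have mem: "?x \<in> X4" "?p \<in> X5" "?q \<in> X5" "e ?p = 0" "f ?p = 0" "e ?q = 0" "g ?q = 0"
    using x p q by (auto simp: sub_scale lin_simps)
  have fx: "f (d ?x) = f ?q" "g (d ?x) = g ?p" by (simp_all only: d.scale f.scale g.scale fq gp)
  have l5: "Vector_Spaces.linear s s (\<lambda>z. s (\<phi> (f z)) ?q + s (\<chi> (g z)) ?p)"
    by (rule linearI'[OF vector_space_axioms vector_space_axioms])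
      (simp_all add: lin_simps functionalD[OF \<phi>] functionalD[OF \<chi>] algebra_simps)
  \<comment> \<open>The summand would be a copy of the brick: \<open>?x\<close> at 4,
    \<open>?q\<close> and \<open>?p\<close> at 5, \<open>f ?q\<close> at 7 and \<open>g ?p\<close>
    at 8. In other terms, a composite B -> X -> B would be nonzero.\<close>
  have h0: "s (\<phi> (f (d ?x))) ?q + s (\<chi> (g (d ?x))) ?p = 0"
  proof (rule no_split[of "\<lambda>x. s (\<phi> (f (d x))) ?x" "\<lambda>z. s (\<phi> (f z)) ?q + s (\<chi> (g z)) ?p"
        "\<lambda>r. s (\<phi> r) (f ?q)" "\<lambda>r. s (\<chi> r) (g ?p)"])
    show "\<forall>x\<in>X4. s (\<phi> (f (d (s (\<phi> (f (d x))) ?x)))) ?x = s (\<phi> (f (d x))) ?x"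
      using 1(1) fx(1) by (simp only: d.scale f.scale functionalD(2)[OF \<phi>]) simp
    show "\<forall>z\<in>X5. s (\<phi> (f (s (\<phi> (f z)) ?q + s (\<chi> (g z)) ?p))) ?q + s (\<chi> (g (s (\<phi> (f z)) ?q + s (\<chi> (g z)) ?p))) ?p
        = s (\<phi> (f z)) ?q + s (\<chi> (g z)) ?p"
      using 1 mem by (simp only: f.add g.add f.scale[of _ ?p] f.scale[of _ ?q] g.scale[of _ ?p] g.scale[of _ ?q]
          functionalD[OF \<phi>] functionalD[OF \<chi>]) simp
    show "\<forall>x\<in>X4. s (\<phi> (f (d x))) ?q + s (\<chi> (g (d x))) ?p = d (s (\<phi> (f (d x))) ?x)"
      unfolding d.scale[of _ ?x] dx using eq by (simp add: scale_right_distrib)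
    show "\<forall>r\<in>X7. s (\<phi> (s (\<phi> r) (f ?q))) (f ?q) = s (\<phi> r) (f ?q)"
      using 1(1) by (simp only: functionalD(2)[OF \<phi>]) simp
    show "\<forall>r\<in>X8. s (\<chi> (s (\<chi> r) (g ?p))) (g ?p) = s (\<chi> r) (g ?p)"
      using 1(2) by (simp only: functionalD(2)[OF \<chi>]) simp
    show "\<forall>z\<in>X5. s (\<phi> (f z)) (f ?q) = f (s (\<phi> (f z)) ?q + s (\<chi> (g z)) ?p)"
      using mem by (simp only: f.add f.scale[of _ ?p] f.scale[of _ ?q]) simp
    show "\<forall>z\<in>X5. s (\<chi> (g z)) (g ?p) = g (s (\<phi> (f z)) ?q + s (\<chi> (g z)) ?p)"
      using mem by (simp only: g.add g.scale[of _ ?p] g.scale[of _ ?q]) simp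
    show "\<forall>z\<in>X5. e (s (\<phi> (f z)) ?q + s (\<chi> (g z)) ?p) = 0"
      using mem by (simp only: e.add e.scale[of _ ?p] e.scale[of _ ?q]) simp
    show "Vector_Spaces.linear s s (\<lambda>z. s (\<phi> (f z)) ?q + s (\<chi> (g z)) ?p)" by (rule l5)
    show "\<forall>z\<in>X5. s (\<phi> (f z)) ?q + s (\<chi> (g z)) ?p \<in> X5"
      using mem subspace_add[OF sub5] subspace_scale[OF sub5] by blast
    show "\<forall>a\<in>A. s (\<phi> (f (d a))) ?x = 0" using A by simp
    show "d ?x \<in> X5" using d_in mem by blast
    show "Vector_Spaces.linear s s (\<lambda>x. s (\<phi> (f (d x))) ?x)" by (rule linear_rank_one_fd[OF \<phi>])
    show "Vector_Spaces.linear s s (\<lambda>r. s (\<phi> r) (f ?q))" by (rule linear_rank_one[OF \<phi>])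
    show "Vector_Spaces.linear s s (\<lambda>r. s (\<chi> r) (g ?p))" by (rule linear_rank_one[OF \<chi>])
    show "\<forall>x\<in>X4. s (\<phi> (f (d x))) ?x \<in> X4" using subspace_scale[OF sub4] mem by blast
    show "\<forall>r\<in>X7. s (\<phi> r) (f ?q) \<in> X7" using subspace_scale[OF sub7] f_in mem by blast
    show "\<forall>r\<in>X8. s (\<chi> r) (g ?p) \<in> X8" using subspace_scale[OF sub8] g_in mem by blast
  qed
  have "?q + ?p = 0" using h0 by (simp only: fx 1 scale_one)
  then have "f ?q + f ?p = 0" by (metis f.add f.zero)
  then have "f ?q = 0" unfolding mem(5) by (simp only: add_0_right)
  then show False using 1(1) functionalD(3)[OF \<phi>] by (simp only: zero_neq_one)
qed

lemma no_string_5_8: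
  "Vector_Spaces.linear s (*) \<phi> \<Longrightarrow> (\<And>x. x \<in> X4 \<Longrightarrow> \<phi> (g (d x)) = 0) \<Longrightarrow> r \<in> X8 \<Longrightarrow> \<phi> r = 0"
  by (rule split_data.no_string_5_7[OF swap])

text \<open>\<open>P\<close> and \<open>Q\<close> consist of the possible images in \<open>X\<close>
  of the two basis vectors of the brick at vertex 5. A pair from \<open>P\<close> and
  \<open>Q\<close> comes from a homomorphism exactly when its sum lies in \<open>D\<close>.\<close>

definition P :: "'v set" where "P = {z\<in>X5. e z = 0 \<and> f z = 0}"
definition Q :: "'v set" where "Q = {z\<in>X5. e z = 0 \<and> g z = 0}"
definition D :: "'v set" where "D = d ` X4"

interpretation ss: vector_space_pair s s ..

lemma fd_kernel_subset:
  assumes "fd_subspace s U" "Vector_Spaces.linear s s h" shows "fd_subspace s {x\<in>U. h x = 0}"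
  by (rule fd_subspace_dim_mono(1)[OF assms(1) ss.subspace_kernel_on[OF assms(2) fd_subspaceD[OF assms(1)]]]) auto

text \<open>The kernel of \<open>e\<close> has dimension at least 12 - 2, and \<open>f\<close> maps
  it into dimension 7.\<close>

lemma fd_P: "fd_subspace s P" and dim_P: "dim P \<ge> 3"
proof -
  let ?L = "{z\<in>X5. e z = 0}"
  have L: "fd_subspace s ?L" by (rule fd_kernel_subset[OF fd5 lin_e])
  have dL: "dim ?L \<ge> 10" using ss.rank_nullity(2)[OF lin_e fd5] dims by simp
  have PL: "P = {z\<in>?L. f z = 0}" by (auto simp: P_def)
  show "fd_subspace s P" unfolding PL by (rule fd_kernel_subset[OF L lin_f])
  have "f ` ?L \<subseteq> X7" using f_in by auto
  then have "dim (f ` ?L) \<le> 7"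
    using fd_subspace_dim_mono(2)[OF fd7 fd_subspaceD[OF ss.rank_nullity(1)[OF lin_f L]]] dims by simp
  then show "dim P \<ge> 3" using ss.rank_nullity(2)[OF lin_f L] dL unfolding PL by linarith
qed

lemma fd_Q: "fd_subspace s Q" and dim_Q: "dim Q \<ge> 3"
  using split_data.fd_P[OF swap] split_data.dim_P[OF swap] by (simp_all add: split_data.P_def[OF swap] Q_def)

lemma fd_D: "fd_subspace s D" and dim_D: "dim D = 8"
  using ss.rank_nullity(1)[OF lin_d fd4] ss.dim_image_inj[OF lin_d fd4 d_inj] dims by (simp_all add: D_def)

lemma Int_PQ: "P \<inter> Q = {0}"
  using no_socle sub_zero by (auto simp: P_def Q_def)

lemma Int_DQ: "D \<inter> Q = {0}"
  using no_string_4_5_7 sub_zero d_in by (force simp: D_def Q_def)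

lemma D_sub: "D \<subseteq> X5"
  using d_in by (auto simp: D_def)

text \<open>\<open>P \<inter> (D + Q)\<close> and \<open>Q \<inter> (D + P)\<close> are the projections of the space of pairs \<open>(p, q)\<close> with
  \<open>p + q \<in> D\<close>; both projections are injective.\<close>

definition P' :: "'v set" where "P' = P \<inter> {x + y |x y. x \<in> D \<and> y \<in> Q}"

text \<open>By \<open>decomp\<close>, \<open>P\<close> and \<open>D + Q\<close> together span
  \<open>X5\<close>, and \<open>D + Q\<close> is a direct sum, so the intersection has dimension dim
  P + (8 + dim Q) - 12. This is the dimension of Hom(B, X).\<close>

lemma fd_P': "fd_subspace s P'" and dim_P': "dim P' + 4 = dim P + dim Q"
proof -
  have DQ: "fd_subspace s {x + y |x y. x \<in> D \<and> y \<in> Q}" by (rule fd_subspace_sum[OF fd_D fd_Q])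
  have "subspace P'" unfolding P'_def
    using subspace_inter fd_subspaceD fd_P DQ by blast
  then show "fd_subspace s P'" by (rule fd_subspace_dim_mono(1)[OF fd_P]) (simp add: P'_def)
  have "{x + y |x y. x \<in> P \<and> y \<in> {x + y |x y. x \<in> D \<and> y \<in> Q}} = X5" (is "?L = X5")
  proof
    show "?L \<subseteq> X5" using D_sub subspace_add[OF sub5] by (auto simp: P_def Q_def)
    show "X5 \<subseteq> ?L"
    proof
      fix z assume "z \<in> X5"
      then obtain x p q where *: "x \<in> X4" "p \<in> X5" "q \<in> X5" "z = d x + p + q" "e p = 0" "f p = 0" "e q = 0" "g q = 0"
        using decomp by blast
      then have "z = p + (d x + q)" "p \<in> P" "d x \<in> D" "q \<in> Q" by (simp_all add: P_def Q_def D_def algebra_simps)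
      then show "z \<in> ?L" by blast
    qed
  qed
  then have "12 + dim P' = dim P + dim {x + y |x y. x \<in> D \<and> y \<in> Q}"
    using dim_sum_Int[OF fd_P DQ] dims by (simp add: P'_def)
  moreover have "dim {x + y |x y. x \<in> D \<and> y \<in> Q} = 8 + dim Q"
    using dim_sum_Int[OF fd_D fd_Q] Int_DQ dim_D dim_zero_subspace by simp
  ultimately show "dim P' + 4 = dim P + dim Q" by simp
qed

definition Q' :: "'v set" where "Q' = Q \<inter> {x + y |x y. x \<in> D \<and> y \<in> P}"

lemma fd_Q': "fd_subspace s Q'" and dim_Q': "dim Q' + 4 = dim P + dim Q"
  using split_data.fd_P'[OF swap] split_data.dim_P'[OF swap]
  by (simp_all add: split_data.P'_def[OF swap] split_data.P_def[OF swap] split_data.Q_def[OF swap]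
      split_data.D_def[OF swap] Q'_def P_def Q_def D_def add.commute)

text \<open>Sending \<open>x = p + q\<close> to \<open>p\<close> is injective because
  \<open>D\<close> meets \<open>Q\<close> only in 0. In terms of subspaces: adding \<open>Q\<close>
  to the left-hand space gives a direct sum inside the direct sum of \<open>P'\<close> and
  \<open>Q\<close>.\<close>

lemma dim_D_Int: "fd_subspace s {x\<in>D. \<exists>p\<in>P. \<exists>q\<in>Q. x = p + q}" "dim {x\<in>D. \<exists>p\<in>P. \<exists>q\<in>Q. x = p + q} \<le> dim P'"
proof -
  let ?R = "{x\<in>D. \<exists>p\<in>P. \<exists>q\<in>Q. x = p + q}"
  have "?R = D \<inter> {p + q |p q. p \<in> P \<and> q \<in> Q}" by auto
  then have "subspace ?R"
    using subspace_inter fd_subspaceD fd_D fd_subspace_sum[OF fd_P fd_Q] by auto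
  then show R: "fd_subspace s ?R" by (rule fd_subspace_dim_mono(1)[OF fd_D]) auto
  have "?R \<inter> Q \<subseteq> {0}" using Int_DQ by blast
  then have "?R \<inter> Q = {0}" using subspace_0 fd_subspaceD R fd_Q by blast
  then have 1: "dim {x + y |x y. x \<in> ?R \<and> y \<in> Q} = dim ?R + dim Q"
    using dim_sum_Int[OF R fd_Q] dim_zero_subspace by simp
  have "P' \<inter> Q = {0}" using Int_PQ subspace_0 fd_subspaceD fd_P' fd_Q unfolding P'_def by blast
  then have 2: "dim {x + y |x y. x \<in> P' \<and> y \<in> Q} = dim P' + dim Q"
    using dim_sum_Int[OF fd_P' fd_Q] dim_zero_subspace by simp
  have "{x + y |x y. x \<in> ?R \<and> y \<in> Q} \<subseteq> {x + y |x y. x \<in> P' \<and> y \<in> Q}"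
  proof
    fix z assume "z \<in> {x + y |x y. x \<in> ?R \<and> y \<in> Q}"
    then obtain x y p q where *: "x \<in> D" "p \<in> P" "q \<in> Q" "x = p + q" "y \<in> Q" "z = x + y" by blast
    have "p = x + - q" using * by simp
    then have "p \<in> P'" unfolding P'_def using * subspace_neg[OF fd_subspaceD[OF fd_Q]] by blast
    moreover have "q + y \<in> Q" using * subspace_add[OF fd_subspaceD[OF fd_Q]] by blast
    moreover have "z = p + (q + y)" using * by (simp add: add.assoc)
    ultimately show "z \<in> {x + y |x y. x \<in> P' \<and> y \<in> Q}" by blast
  qed
  then have "dim {x + y |x y. x \<in> ?R \<and> y \<in> Q} \<le> dim {x + y |x y. x \<in> P' \<and> y \<in> Q}"
    using fd_subspace_dim_mono(2)[OF fd_subspace_sum[OF fd_P' fd_Q] fd_subspaceD[OF fd_subspace_sum[OF R fd_Q]]] by blast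
  then show "dim ?R \<le> dim P'" using 1 2 by simp
qed

section \<open>Homomorphisms to the brick and the final count\<close>

abbreviation (input) "ps \<equiv> prod_scale s s"

text \<open>A pair of functionals (\<phi>, \<chi>) on \<open>X7 \<times> X8\<close> kills
  \<open>N\<close> exactly when \<phi> after \<open>f \<circ> d\<close> equals \<chi> after
  \<open>g \<circ> d\<close> on \<open>X4\<close> and vanishes on \<open>A\<close>. These are the
  data of a homomorphism to the brick, so the codimension of \<open>N\<close> is dim Hom(X,
  B).\<close>

definition N :: "('v \<times> 'v) set" where
  "N = (\<lambda>u. (f (d (fst u)) + f (d (snd u)), - g (d (fst u)))) ` (X4 \<times> A)"

lemma N_memI: "x \<in> X4 \<Longrightarrow> a \<in> A \<Longrightarrow> (f (d x) + f (d a), - g (d x)) \<in> N"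
  by (force simp: N_def)

text \<open>Here \<open>x\<close> is the image of the brick vector at 4 under a homomorphism to
  \<open>X\<close>. By \<open>no_square\<close> every homomorphism back to the brick kills it, that
  is, every functional vanishing on \<open>N\<close> vanishes at both pairs; separation puts them in
  \<open>N\<close>.\<close>

lemma P'_Q'_in_N:
  assumes "x \<in> X4" "d x = p + q" "p \<in> P" "q \<in> Q"
    and N: "module.subspace ps N"
  shows "(f (d x), 0) \<in> N" "(0, g (d x)) \<in> N"
proof -
  interpret p: vector_space ps by (rule vector_space_prod_scale[OF vector_space_axioms vector_space_axioms])
  have "\<mu> (f (d x), 0) = 0 \<and> \<mu> (0, g (d x)) = 0"
    if l: "Vector_Spaces.linear ps (*) \<mu>" "\<And>u. u \<in> N \<Longrightarrow> \<mu> u = 0" for \<mu> :: "'v \<times> 'v \<Rightarrow> 'k"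
  proof -
    interpret l: Vector_Spaces.linear ps "(*)" \<mu> by (rule l(1))
    let ?\<phi> = "\<lambda>r. \<mu> (r, 0)" and ?\<chi> = "\<lambda>r. \<mu> (0, r)"
    have sc: "\<mu> (s c a, 0) = c * \<mu> (a, 0)" "\<mu> (0, s c a) = c * \<mu> (0, a)" for c a
      using l.scale[of c "(a, 0)"] l.scale[of c "(0, a)"] by simp_all
    have ad: "\<mu> (a + b, 0) = \<mu> (a, 0) + \<mu> (b, 0)" "\<mu> (0, a + b) = \<mu> (0, a) + \<mu> (0, b)" for a b
      using l.add[of "(a, 0)" "(b, 0)"] l.add[of "(0, a)" "(0, b)"] by simp_all
    have \<phi>: "Vector_Spaces.linear s (*) ?\<phi>" and \<chi>: "Vector_Spaces.linear s (*) ?\<chi>"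
      by (rule linearI'[OF vector_space_axioms linear_field_vs]; simp add: sc ad)+
    have eq: "?\<phi> (f (d y)) = ?\<chi> (g (d y))" if "y \<in> X4" for y
    proof -
      have "(f (d y), - g (d y)) \<in> N" using N_memI[OF that sub_zero(5)] by simp
      moreover have "(f (d y), - g (d y)) = (f (d y), 0) - (0, g (d y))" by simp
      ultimately have "\<mu> ((f (d y), 0) - (0, g (d y))) = 0" using l(2) by metis
      then show ?thesis unfolding l.diff by (simp only: right_minus_eq)
    qed
    have "?\<phi> (f (d a)) = 0" if "a \<in> A" for a
      using l(2)[OF N_memI[OF sub_zero(1) that]] by simp
    then have "?\<phi> (f (d x)) = 0"
      using no_square[OF \<phi> \<chi> eq _ assms(1,2)] assms(3,4) by (auto simp: P_def Q_def)
    moreover have "?\<phi> (f (d x)) = ?\<chi> (g (d x))" by (rule eq[OF assms(1)])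
    ultimately show ?thesis by simp
  qed
  note kill = this
  show "(f (d x), 0) \<in> N"
  proof (rule ccontr)
    assume "(f (d x), 0) \<notin> N"
    then obtain \<mu> :: "'v \<times> 'v \<Rightarrow> 'k" where "Vector_Spaces.linear ps (*) \<mu>" "\<And>u. u \<in> N \<Longrightarrow> \<mu> u = 0" "\<mu> (f (d x), 0) = 1"
      by (rule p.functional_separation[OF N]) (rule that; assumption)
    then show False using kill[of \<mu>] by simp
  qed
  show "(0, g (d x)) \<in> N"
  proof (rule ccontr)
    assume "(0, g (d x)) \<notin> N"
    then obtain \<mu> :: "'v \<times> 'v \<Rightarrow> 'k" where "Vector_Spaces.linear ps (*) \<mu>" "\<And>u. u \<in> N \<Longrightarrow> \<mu> u = 0" "\<mu> (0, g (d x)) = 1"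
      by (rule p.functional_separation[OF N]) (rule that; assumption)
    then show False using kill[of \<mu>] by simp
  qed
qed

text \<open>With \<open>c\<close> the codimension of \<open>N\<close> in \<open>X7 \<times> X8\<close> and \<open>w = dim P'\<close>, the space
  \<open>K5 = {z. (f z, 0) \<in> N \<and> (0, g z) \<in> N}\<close> has dimension \<open>12 - 2 c\<close> and contains \<open>d K4 + P' + Q'\<close>,
  of dimension at least \<open>8 - c + w\<close>. Hence \<open>w + c \<le> 4\<close>, contradicting \<open>w \<ge> 2\<close> and \<open>c \<ge> 3\<close>.\<close>

lemma impossible: False
proof -
  note v = vector_space_axioms
  interpret p: vector_space ps by (rule vector_space_prod_scale[OF v v])
  let ?pp = "prod_scale ps ps"
  interpret pp: vector_space ?pp by (rule vector_space_prod_scale[OF p.vector_space_axioms p.vector_space_axioms])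
  interpret sp: vector_space_pair s ps ..
  interpret spp: vector_space_pair s ?pp ..
  interpret p2: vector_space_pair ps ps ..
  let ?V = "X7 \<times> X8"
  note V = fd_subspace_Times[OF v v fd7 fd8]
  note XA = fd_subspace_Times[OF v v fd4 fdA]
  have linN: "Vector_Spaces.linear ps ps (\<lambda>u. (f (d (fst u)) + f (d (snd u)), - g (d (fst u))))"
    by (rule linearI'[OF p.vector_space_axioms p.vector_space_axioms])
      (auto simp: f.add g.add d.add f.scale g.scale d.scale scale_right_distrib)
  have fdN: "fd_subspace ps N" unfolding N_def by (rule p2.rank_nullity(1)[OF linN XA(1)])
  note sN = p.fd_subspaceD[OF fdN]
  \<comment> \<open>\<open>N\<close> is an image of \<open>X4 \<times> A\<close>, of dimension at
    most 8 + 3, inside a space of dimension 14; this gives c \<ge> 3.\<close>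
  have dN: "p.dim N \<le> 11" using p2.rank_nullity(2)[OF linN XA(1)] XA(2) dims unfolding N_def by linarith
  have NV: "N \<subseteq> ?V"
  proof
    fix u assume "u \<in> N"
    then obtain x a where *: "x \<in> X4" "a \<in> A" "u = (f (d x) + f (d a), - g (d x))" by (auto simp: N_def)
    then have "f (d x) \<in> X7" "f (d a) \<in> X7" "g (d x) \<in> X8" using d_in f_in g_in A4 by blast+
    then show "u \<in> ?V" using * subspace_add[OF sub7] subspace_neg[OF sub8] by simp
  qed
  obtain \<rho> where \<rho>: "Vector_Spaces.linear ps ps \<rho>" "\<And>u. \<rho> u \<in> N" "\<And>u. u \<in> N \<Longrightarrow> \<rho> u = u"
    by (rule p.linear_retraction[OF sN]) (rule that; assumption)
  interpret rho: Vector_Spaces.linear ps ps \<rho> by (rule \<rho>(1))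
  \<comment> \<open>\<pi> has kernel \<open>N\<close>, so the image \<open>C\<close> of
    \<open>X7 \<times> X8\<close> stands for the quotient by \<open>N\<close>. Functionals on
    \<open>C\<close> are homomorphisms from \<open>X\<close> to the brick.\<close>
  define \<pi> where "\<pi> u = u - \<rho> u" for u
  have lin_pi: "Vector_Spaces.linear ps ps \<pi>"
  proof (rule linearI'[OF p.vector_space_axioms p.vector_space_axioms])
    show "\<pi> (x + y) = \<pi> x + \<pi> y" for x y by (simp only: \<pi>_def rho.add) simp
    show "\<pi> (ps c x) = ps c (\<pi> x)" for c x by (simp only: \<pi>_def rho.scale p.scale_right_diff_distrib)
  qed
  interpret pi: Vector_Spaces.linear ps ps \<pi> by (rule lin_pi)
  have pi0: "\<pi> u = 0 \<longleftrightarrow> u \<in> N" for u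
  proof
    assume "\<pi> u = 0"
    then have "u = \<rho> u" by (simp add: \<pi>_def)
    then show "u \<in> N" using \<rho>(2)[of u] by simp
  qed (simp add: \<pi>_def \<rho>(3))
  define C where "C = \<pi> ` ?V"
  have fdC: "fd_subspace ps C" unfolding C_def by (rule p2.rank_nullity(1)[OF lin_pi V(1)])
  have dimC: "p.dim C \<ge> 3"
  proof -
    have k: "{u\<in>?V. \<pi> u = 0} = N" using pi0 NV by blast
    show ?thesis using p2.rank_nullity(2)[OF lin_pi V(1)] V(2) dN dims unfolding C_def k by linarith
  qed
  \<comment> \<open>The universal map to copies of the brick, read at vertex 5: one component for
    each of the two basis vectors there, with \<open>C\<close> as multiplicity space.\<close>
  define T where "T z = (\<pi> (f z, 0), \<pi> (0, g z))" for z
  have pi_add: "\<pi> (a + b, 0) = \<pi> (a, 0) + \<pi> (b, 0)" "\<pi> (0, a + b) = \<pi> (0, a) + \<pi> (0, b)"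
    "\<pi> (s c a, 0) = ps c (\<pi> (a, 0))" "\<pi> (0, s c a) = ps c (\<pi> (0, a))" for a b c
    using pi.add[of "(a, 0)" "(b, 0)"] pi.add[of "(0, a)" "(0, b)"] pi.scale[of c "(a, 0)"] pi.scale[of c "(0, a)"]
    by simp_all
  have lin_T: "Vector_Spaces.linear s ?pp T"
    by (rule linearI'[OF v pp.vector_space_axioms]) (simp_all add: T_def f.add g.add f.scale g.scale pi_add)
  have T_in: "T z \<in> C \<times> C" if "z \<in> X5" for z
    using f_in[OF that] g_in[OF that] sub_zero by (auto simp: T_def C_def)
  have T_onto: "C \<times> C \<subseteq> T ` X5"
  proof (rule ccontr)
    assume "\<not> C \<times> C \<subseteq> T ` X5"
    then obtain w where w: "w \<in> C \<times> C" "w \<notin> T ` X5" by blast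
    have sT: "pp.subspace (T ` X5)" using spp.rank_nullity(1)[OF lin_T fd5] pp.fd_subspaceD by blast
    obtain \<mu> :: "('v \<times> 'v) \<times> ('v \<times> 'v) \<Rightarrow> 'k" where \<mu>: "Vector_Spaces.linear ?pp (*) \<mu>"
        "\<And>u. u \<in> T ` X5 \<Longrightarrow> \<mu> u = 0" "\<mu> w = 1"
      using w(2) by (rule pp.functional_separation[OF sT]) (rule that; assumption)
    interpret mu: Vector_Spaces.linear ?pp "(*)" \<mu> by (rule \<mu>(1))
    have mu_add: "\<mu> (a, b) = \<mu> (a, 0) + \<mu> (0, b)" for a b using mu.add[of "(a, 0)" "(0, b)"] by simp
    have mu_add': "\<mu> (a + b, 0) = \<mu> (a, 0) + \<mu> (b, 0)" "\<mu> (0, a + b) = \<mu> (0, a) + \<mu> (0, b)"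
        "\<mu> (ps c a, 0) = c * \<mu> (a, 0)" "\<mu> (0, ps c a) = c * \<mu> (0, a)" for a b c
      using mu.add[of "(a, 0)" "(b, 0)"] mu.add[of "(0, a)" "(0, b)"] mu.scale[of c "(a, 0)"] mu.scale[of c "(0, a)"]
      by (simp_all add: zero_prod_def)
    \<comment> \<open>A functional killing the image of \<open>T\<close> splits into four
      functionals on \<open>X7\<close> and \<open>X8\<close>, which vanish in turn: \<phi> by
      \<open>no_string_7_5_8\<close>, since on \<open>X5\<close> it is tied to \<chi>'; then
      \<chi>', because \<open>g\<close> is onto; then \<chi> and \<phi>', which agree along
      \<open>d\<close> with the first two and so fall to the strings 5 -> 8 and 5 -> 7.\<close>
    define \<phi> where "\<phi> r = \<mu> (\<pi> (r, 0), 0)" for r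
    define \<chi> where "\<chi> r = \<mu> (\<pi> (0, r), 0)" for r
    define \<phi>' where "\<phi>' r = \<mu> (0, \<pi> (r, 0))" for r
    define \<chi>' where "\<chi>' r = \<mu> (0, \<pi> (0, r))" for r
    have lin: "Vector_Spaces.linear s (*) \<phi>" "Vector_Spaces.linear s (*) \<chi>"
        "Vector_Spaces.linear s (*) \<phi>'" "Vector_Spaces.linear s (*) \<chi>'"
      unfolding \<phi>_def \<chi>_def \<phi>'_def \<chi>'_def
      by (rule linearI'[OF v linear_field_vs]; simp only: pi_add mu_add')+
    have lneg: "Vector_Spaces.linear s (*) (\<lambda>r. - h r)" if "Vector_Spaces.linear s (*) h" for h :: "'v \<Rightarrow> 'k"
      using that by (auto simp: Vector_Spaces.linear_iff)
    have rel: "\<phi> (f z) = - \<chi>' (g z)" if "z \<in> X5" for z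
      using \<mu>(2)[of "T z"] that mu_add[of "\<pi> (f z, 0)" "\<pi> (0, g z)"]
      by (simp add: \<phi>_def \<chi>'_def T_def eq_neg_iff_add_eq_0)
    have pi_pair: "\<pi> (a, b) = \<pi> (a, 0) + \<pi> (0, b)" for a b using pi.add[of "(a, 0)" "(0, b)"] by simp
    have pi_eq: "\<pi> (f (d x), 0) = \<pi> (0, g (d x))" if "x \<in> X4" for x
    proof -
      have "(f (d x), - g (d x)) \<in> N" using N_memI[OF that sub_zero(5)] by simp
      moreover have "(f (d x), - g (d x)) = (f (d x), 0) - (0, g (d x))" by simp
      ultimately have "\<pi> ((f (d x), 0) - (0, g (d x))) = 0" using pi0 by metis
      then show ?thesis unfolding pi.diff by (simp only: right_minus_eq)
    qed
    have pi_A: "\<pi> (f (d a), 0) = 0" if "a \<in> A" for a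
      using N_memI[OF sub_zero(1) that] pi0 by simp
    have \<phi>0: "\<phi> r = 0" if "r \<in> X7" for r
    proof (rule no_string_7_5_8[OF lin(1) lneg[OF lin(4)] rel _ that])
      show "\<phi> (f (d a)) = 0" if "a \<in> A" for a
        using pi_A[OF that] mu.zero by (simp add: \<phi>_def zero_prod_def)
    qed
    have \<chi>'0: "\<chi>' r = 0" if r: "r \<in> X8" for r
    proof -
      obtain z where "z \<in> X5" "g z = r" using onto_g[OF r] by blast
      then show ?thesis using rel[of z] \<phi>0[OF f_in] by simp
    qed
    have \<chi>0: "\<chi> r = 0" if "r \<in> X8" for r
    proof (rule no_string_5_8[OF lin(2) _ that])
      fix x assume "x \<in> X4"
      then show "\<chi> (g (d x)) = 0" using \<phi>0[OF f_in[OF d_in]] pi_eq by (simp add: \<phi>_def \<chi>_def)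
    qed
    have \<phi>'0: "\<phi>' r = 0" if "r \<in> X7" for r
    proof (rule no_string_5_7[OF lin(3) _ that])
      fix x assume "x \<in> X4"
      then show "\<phi>' (f (d x)) = 0" using \<chi>'0[OF g_in[OF d_in]] pi_eq by (simp add: \<phi>'_def \<chi>'_def)
    qed
    obtain r t r' t' where wr: "w = (\<pi> (r, t), \<pi> (r', t'))" "r \<in> X7" "t \<in> X8" "r' \<in> X7" "t' \<in> X8"
      using w(1) by (auto simp: C_def)
    have "\<mu> w = \<mu> (\<pi> (r, t), 0) + \<mu> (0, \<pi> (r', t'))" unfolding wr(1) by (rule mu_add)
    then have "\<mu> w = \<phi> r + \<chi> t + (\<phi>' r' + \<chi>' t')"
      unfolding pi_pair[of r t] pi_pair[of r' t'] mu_add' \<phi>_def \<chi>_def \<phi>'_def \<chi>'_def .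
    then show False using wr \<phi>0 \<chi>0 \<phi>'0 \<chi>'0 \<mu>(3) by simp
  qed
  define K5 where "K5 = {z\<in>X5. T z = 0}"
  have K5_iff: "z \<in> K5 \<longleftrightarrow> z \<in> X5 \<and> (f z, 0) \<in> N \<and> (0, g z) \<in> N" for z
    by (auto simp: K5_def T_def prod_eq_iff pi0[symmetric])
  have "T ` X5 = C \<times> C" using T_in T_onto by blast
  then have dK5: "12 = 2 * p.dim C + dim K5"
    using spp.rank_nullity(2)[OF lin_T fd5] fd_subspace_Times(2)[OF p.vector_space_axioms p.vector_space_axioms fdC fdC] dims
    unfolding K5_def by simp
  have sK5: "subspace K5" unfolding K5_def by (rule spp.subspace_kernel_on[OF lin_T sub5])
  have fdK5: "fd_subspace s K5" by (rule fd_subspace_dim_mono(1)[OF fd5 sK5]) (auto simp: K5_def)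
  have lin4: "Vector_Spaces.linear s ps (\<lambda>x. \<pi> (f (d x), 0))"
    by (rule linearI'[OF v p.vector_space_axioms]) (simp_all add: f.add d.add f.scale d.scale pi_add)
  \<comment> \<open>On the image of \<open>d\<close> the two conditions defining \<open>K5\<close>
    coincide, because \<open>(f (d x), - g (d x))\<close> lies in \<open>N\<close>. Hence
    \<open>K4\<close> has codimension at most c in \<open>X4\<close>, not 2c.\<close>
  define K4 where "K4 = {x\<in>X4. \<pi> (f (d x), 0) = 0}"
  have fdK4: "fd_subspace s K4" unfolding K4_def
    by (rule fd_subspace_dim_mono(1)[OF fd4 sp.subspace_kernel_on[OF lin4 sub4]]) auto
  have "(\<lambda>x. \<pi> (f (d x), 0)) ` X4 \<subseteq> C" using f_in d_in sub_zero by (auto simp: C_def)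
  then have "p.dim ((\<lambda>x. \<pi> (f (d x), 0)) ` X4) \<le> p.dim C"
    using p.fd_subspace_dim_mono(2)[OF fdC p.fd_subspaceD[OF sp.rank_nullity(1)[OF lin4 fd4]]] by blast
  then have dK4: "8 \<le> p.dim C + dim K4"
    using sp.rank_nullity(2)[OF lin4 fd4] dims unfolding K4_def by linarith
  have fddK4: "fd_subspace s (d ` K4)" by (rule ss.rank_nullity(1)[OF lin_d fdK4])
  have ddK4: "dim (d ` K4) = dim K4" by (rule ss.dim_image_inj[OF lin_d fdK4]) (auto simp: K4_def d_inj)
  have K45: "d ` K4 \<subseteq> K5"
  proof
    fix z assume "z \<in> d ` K4"
    then obtain x where x: "x \<in> X4" "(f (d x), 0) \<in> N" "z = d x" by (auto simp: K4_def pi0)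
    have "(f (d x), - g (d x)) \<in> N" using N_memI[OF x(1) sub_zero(5)] by simp
    then have "(f (d x), 0) - (f (d x), - g (d x)) \<in> N" using p.subspace_diff[OF sN x(2)] by blast
    then show "z \<in> K5" using x d_in by (simp add: K5_iff)
  qed
  have Z: "(0, 0) \<in> N" using p.subspace_0[OF sN] by (simp add: zero_prod_def)
  \<comment> \<open>On \<open>P\<close> the condition on \<open>f\<close> is void, and
    \<open>g p0\<close> equals \<open>g (d x)\<close> because \<open>g\<close> kills
    \<open>Q\<close>.\<close>
  have P'K5: "P' \<subseteq> K5"
  proof
    fix p0 assume "p0 \<in> P'"
    then obtain x q where *: "x \<in> X4" "q \<in> Q" "p0 = d x + q" "p0 \<in> P" by (auto simp: P'_def D_def)
    have "- q \<in> Q" by (rule subspace_neg[OF fd_subspaceD[OF fd_Q] *(2)])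
    moreover have "d x = p0 + - q" using *(3) by simp
    ultimately have "(0, g (d x)) \<in> N" using P'_Q'_in_N[OF *(1) _ *(4) _ sN] by blast
    moreover have "g (d x) = g p0" using * by (simp add: Q_def g.add)
    ultimately show "p0 \<in> K5" using *(4) Z by (simp add: K5_iff P_def)
  qed
  have Q'K5: "Q' \<subseteq> K5"
  proof
    fix q0 assume "q0 \<in> Q'"
    then obtain x q where *: "x \<in> X4" "q \<in> P" "q0 = d x + q" "q0 \<in> Q" by (auto simp: Q'_def D_def)
    have "- q \<in> P" by (rule subspace_neg[OF fd_subspaceD[OF fd_P] *(2)])
    moreover have "d x = - q + q0" using *(3) by simp
    ultimately have "(f (d x), 0) \<in> N" using P'_Q'_in_N[OF *(1) _ _ *(4) sN] by blast
    moreover have "f (d x) = f q0" using * by (simp add: P_def f.add)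
    ultimately show "q0 \<in> K5" using *(4) Z by (simp add: K5_iff Q_def)
  qed
  let ?M = "{p + q |p q. p \<in> P' \<and> q \<in> Q'}"
  have M: "fd_subspace s ?M" by (rule fd_subspace_sum[OF fd_P' fd_Q'])
  have "P' \<inter> Q' = {0}"
    using Int_PQ subspace_0[OF fd_subspaceD[OF fd_P']] subspace_0[OF fd_subspaceD[OF fd_Q']]
    unfolding P'_def Q'_def by blast
  then have dM: "dim ?M = dim P' + dim Q'" using dim_sum_Int[OF fd_P' fd_Q'] dim_zero_subspace by simp
  let ?S = "{x + y |x y. x \<in> d ` K4 \<and> y \<in> ?M}"
  have "?S \<subseteq> K5"
  proof
    fix z assume "z \<in> ?S"
    then obtain x p q where "x \<in> K5" "p \<in> K5" "q \<in> K5" "z = x + (p + q)" using K45 P'K5 Q'K5 by blast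
    then show "z \<in> K5" using subspace_add[OF sK5] by blast
  qed
  then have "dim ?S \<le> dim K5"
    using fd_subspace_dim_mono(2)[OF fdK5 fd_subspaceD[OF fd_subspace_sum[OF fddK4 M]]] by blast
  moreover have "dim ?S + dim (d ` K4 \<inter> ?M) = dim (d ` K4) + dim ?M" by (rule dim_sum_Int[OF fddK4 M])
  \<comment> \<open>What is lost by overlap is at most the image of the copies of the brick at
    vertex 4, of dimension w, against a gain of 2w at vertex 5.\<close>
  moreover have "dim (d ` K4 \<inter> ?M) \<le> dim P'"
  proof -
    have "d ` K4 \<inter> ?M \<subseteq> {x\<in>D. \<exists>p\<in>P. \<exists>q\<in>Q. x = p + q}"
      unfolding K4_def D_def P'_def Q'_def by blast
    then have "dim (d ` K4 \<inter> ?M) \<le> dim {x\<in>D. \<exists>p\<in>P. \<exists>q\<in>Q. x = p + q}"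
      using fd_subspace_dim_mono(2)[OF dim_D_Int(1)] subspace_inter[OF fd_subspaceD[OF fddK4] fd_subspaceD[OF M]] by blast
    then show ?thesis using dim_D_Int(2) by linarith
  qed
  ultimately show False
    using dK5 dK4 ddK4 dM dimC dim_P' dim_Q' dim_P dim_Q by linarith
qed

end

section \<open>The representations of the quiver\<close>

context vector_space
begin

lemma dim_1_coordinates:
  assumes U: "fd_subspace scale U" "dim U = 1"
  obtains v and c :: "'b \<Rightarrow> 'a" where "v \<in> U" "Vector_Spaces.linear scale (*) c" "c v = 1"
    "\<And>y. y \<in> U \<Longrightarrow> y = scale (c y) v"
proof -
  obtain B where B: "B \<subseteq> U" "independent B" "finite B" "span B = U" "card B = dim U"
    using fd_subspace_basis[OF U(1)] by metis
  then obtain v where v: "B = {v}" using U(2) by (metis card_1_singletonE)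
  have "v \<noteq> 0" using B(2) v by simp
  then have "v \<notin> {0}" by simp
  then obtain c :: "'b \<Rightarrow> 'a" where c: "Vector_Spaces.linear scale (*) c" "c v = 1"
    using functional_separation[OF subspace_single_0] by metis
  have "y = scale (c y) v" if y: "y \<in> U" for y
  proof -
    obtain k where k: "y = scale k v" using y B(4) v by (auto simp: span_singleton)
    then show ?thesis using c by (simp add: Vector_Spaces.linear_iff)
  qed
  then show thesis using that[OF _ c] B(1) v by blast
qed

lemma dim_2_coordinates:
  assumes U: "fd_subspace scale U" "dim U = 2" and u: "u \<in> U" "u \<noteq> 0" and w: "w \<in> U" "w \<notin> span {u}"
  obtains cu cw :: "'b \<Rightarrow> 'a" where "Vector_Spaces.linear scale (*) cu" "Vector_Spaces.linear scale (*) cw"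
    "cu u = 1" "cu w = 0" "cw u = 0" "cw w = 1" "\<And>y. y \<in> U \<Longrightarrow> y = scale (cu y) u + scale (cw y) w"
proof -
  interpret k: vector_space "(*) :: 'a \<Rightarrow> 'a \<Rightarrow> 'a" by (rule linear_field_vs)
  interpret vk: vector_space_pair scale "(*) :: 'a \<Rightarrow> 'a \<Rightarrow> 'a" ..
  have ind: "independent {w, u}" using independent_insertI[OF w(2)] u(2) by simp
  have ne: "w \<noteq> u" using w(2) span_base by blast
  have "dim (span {w, u}) = 2" using dim_span_eq_card_independent[OF ind] ne by simp
  then have span: "span {w, u} = U"
    using fd_subspace_dim_mono(3)[OF U(1) subspace_span] span_minimal[OF _ fd_subspaceD[OF U(1)], of "{w, u}"] u w U(2)
    by auto
  obtain cu where cu: "Vector_Spaces.linear scale (*) cu" "\<forall>x\<in>{w, u}. cu x = (if x = u then 1 else 0)"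
    using vk.linear_independent_extend[OF ind, of "\<lambda>x. if x = u then 1 else 0"] by blast
  obtain cw where cw: "Vector_Spaces.linear scale (*) cw" "\<forall>x\<in>{w, u}. cw x = (if x = w then 1 else 0)"
    using vk.linear_independent_extend[OF ind, of "\<lambda>x. if x = w then 1 else 0"] by blast
  have "y = scale (cu y) u + scale (cw y) w" if y: "y \<in> U" for y
  proof -
    obtain k where "y - scale k w \<in> span {u}" using y span span_breakdown_eq[of y w "{u}"] by auto
    then obtain j where "y - scale k w = scale j u" by (auto simp: span_singleton)
    then have e: "y = scale j u + scale k w" by (simp add: algebra_simps)
    have "cu y = j" "cw y = k" unfolding e using cu cw ne by (simp_all add: Vector_Spaces.linear_iff)
    then show ?thesis using e by simp
  qed
  then show thesis using that[OF cu(1) cw(1)] cu(2) cw(2) ne by simp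
qed

end

section \<open>Total maps and dimension vectors\<close>

lemma total_extension:
  assumes X: "is_rep G X" and Y: "is_rep G Y" and i: "i \<in> verts G"
    and f: "linear_map_on (smul X) (space X i) (smul Y) W f"
  obtains F where "Vector_Spaces.linear (smul X) (smul Y) F" "\<And>v. v \<in> space X i \<Longrightarrow> F v = f v"
proof -
  interpret vector_space_pair "smul X" "smul Y" by (rule is_rep_pair[OF X Y])
  show thesis using linear_extension[OF f is_repD(3)[OF X i]] that by blast
qed

lemma total_amap:
  assumes X: "is_rep G X" and wf: "wf_digraph G"
  obtains F where "\<And>x. x \<in> arcs G \<Longrightarrow> Vector_Spaces.linear (smul X) (smul X) (F x)"
    "\<And>x v. x \<in> arcs G \<Longrightarrow> v \<in> space X (tail G x) \<Longrightarrow> F x v = amap X x v"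
proof -
  have "\<exists>F. Vector_Spaces.linear (smul X) (smul X) F \<and> (\<forall>v\<in>space X (tail G x). F v = amap X x v)"
    if "x \<in> arcs G" for x
    by (rule total_extension[OF X X wf_digraph.tail_in_verts[OF wf that] is_repD(4)[OF X that]]) (intro exI conjI ballI; assumption | simp)
  then obtain F where "\<forall>x\<in>arcs G. Vector_Spaces.linear (smul X) (smul X) (F x) \<and>
      (\<forall>v\<in>space X (tail G x). F x v = amap X x v)"
    by metis
  then show thesis by (intro that[of F]) auto
qed

text \<open>Rank-nullity at each vertex: the difference of the dimensions is the dimension of the
  kernel. The second part serves to exclude \<beta> = \<alpha>, where an epimorphism to the brick
  would also be a monomorphism.\<close>

lemma (in wf_digraph) epi_dim_vec:
  assumes X: "is_rep G X" and Y: "is_rep G Y" and f: "is_epi G X Y f"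
  shows "dim_vec G Y i \<le> dim_vec G X i" and "dim_vec G Y = dim_vec G X \<Longrightarrow> is_mono G X Y f"
proof -
  interpret vector_space_pair "smul X" "smul Y" by (rule is_rep_pair[OF X Y])
  have h: "is_hom G X Y f" using f by (simp add: is_epi_def)
  have *: "vs1.dim (space X i) = vs2.dim (space Y i) + vs1.dim {v\<in>space X i. f i v = 0}"
    "fd_subspace (smul X) {v\<in>space X i. f i v = 0}" if i: "i \<in> verts G" for i
  proof -
    obtain F where F: "Vector_Spaces.linear (smul X) (smul Y) F" "\<And>v. v \<in> space X i \<Longrightarrow> F v = f i v"
      by (rule total_extension[OF X Y i is_homD(1)[OF h i]]) (rule that; assumption)
    have im: "F ` space X i = space Y i" using f F(2) i by (auto simp: is_epi_def)
    have k: "{v\<in>space X i. F v = 0} = {v\<in>space X i. f i v = 0}" using F(2) by auto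
    show "vs1.dim (space X i) = vs2.dim (space Y i) + vs1.dim {v\<in>space X i. f i v = 0}"
      using rank_nullity(2)[OF F(1) is_repD(2)[OF X i]] unfolding im k .
    show "fd_subspace (smul X) {v\<in>space X i. f i v = 0}"
      using vs1.fd_subspace_dim_mono(1)[OF is_repD(2)[OF X i] subspace_kernel_on[OF F(1) is_repD(3)[OF X i]]]
      unfolding k by blast
  qed
  show "dim_vec G Y i \<le> dim_vec G X i" using *(1)[of i] by (simp add: dim_vec_def)
  assume eq: "dim_vec G Y = dim_vec G X"
  have "inj_on (f i) (space X i)" if i: "i \<in> verts G" for i
  proof (rule inj_onI)
    fix u v assume uv: "u \<in> space X i" "v \<in> space X i" "f i u = f i v"
    have "vs1.dim {v\<in>space X i. f i v = 0} = 0" using *(1)[OF i] fun_cong[OF eq, of i] i by (simp add: dim_vec_def)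
    then have "{v\<in>space X i. f i v = 0} = {0}" using vs1.fd_dim_0[OF *(2)[OF i]] by blast
    moreover have "f i (u - v) = 0"
      using linear_map_on_zero_diff(2)[OF is_homD(1)[OF h i] vs1.vector_space_axioms vs2.vector_space_axioms
          is_repD(3)[OF X i] uv(1,2)] uv(3) by simp
    moreover have "u - v \<in> space X i" by (rule vs1.subspace_diff[OF is_repD(3)[OF X i] uv(1,2)])
    ultimately have "u - v = 0" by blast
    then show "u = v" by simp
  qed
  then show "is_mono G X Y f" using h by (simp add: is_mono_def)
qed

lemma (in wf_digraph) mono_dim_vec:
  assumes X: "is_rep G X" and Y: "is_rep G Y" and f: "is_mono G X Y f"
  shows "dim_vec G X i \<le> dim_vec G Y i" and "dim_vec G X = dim_vec G Y \<Longrightarrow> is_epi G X Y f"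
proof -
  interpret vector_space_pair "smul X" "smul Y" by (rule is_rep_pair[OF X Y])
  have h: "is_hom G X Y f" using f by (simp add: is_mono_def)
  have *: "vs2.dim (f i ` space X i) = vs1.dim (space X i)" "vs2.subspace (f i ` space X i)"
    "f i ` space X i \<subseteq> space Y i" if i: "i \<in> verts G" for i
  proof -
    obtain F where F: "Vector_Spaces.linear (smul X) (smul Y) F" "\<And>v. v \<in> space X i \<Longrightarrow> F v = f i v"
      by (rule total_extension[OF X Y i is_homD(1)[OF h i]]) (rule that; assumption)
    have im: "F ` space X i = f i ` space X i" using F(2) by auto
    have inj: "inj_on (f i) (space X i)" using f i by (simp add: is_mono_def)
    have z: "0 \<in> space X i" by (rule vs1.subspace_0[OF is_repD(3)[OF X i]])
    have "v = 0" if "v \<in> space X i" "F v = 0" for v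
      using inj_onD[OF inj, of v 0] that z F(2) linear_0[OF F(1)] by auto
    then show "vs2.dim (f i ` space X i) = vs1.dim (space X i)"
      using dim_image_inj[OF F(1) is_repD(2)[OF X i]] im by simp
    show "vs2.subspace (f i ` space X i)"
      using vs2.fd_subspaceD[OF rank_nullity(1)[OF F(1) is_repD(2)[OF X i]]] im by simp
    show "f i ` space X i \<subseteq> space Y i" using linear_map_onD(1)[OF is_homD(1)[OF h i]] by blast
  qed
  show "dim_vec G X i \<le> dim_vec G Y i"
    using vs2.fd_subspace_dim_mono(2)[OF is_repD(2)[OF Y] *(2,3)] *(1) by (simp add: dim_vec_def)
  assume eq: "dim_vec G X = dim_vec G Y"
  have "f i ` space X i = space Y i" if i: "i \<in> verts G" for i
    using vs2.fd_subspace_dim_mono(3)[OF is_repD(2)[OF Y i] *(2,3)[OF i]] *(1)[OF i] fun_cong[OF eq, of i] i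
    by (simp add: dim_vec_def)
  then show "is_epi G X Y f" using h by (simp add: is_epi_def)
qed

section \<open>The shape of the brick\<close>

lemma wf_digraph_Q8: "wf_digraph Q8"
  using fin_digraph_Q8 by (simp add: fin_digraph_def)

text \<open>All endomorphisms to be tested are zero at 1, 2, 3 and 6: on the brick because the
  spaces there are zero, on \<open>X\<close> because the summands to be split off avoid these
  vertices.\<close>

definition endo :: "('v \<Rightarrow> 'v) \<Rightarrow> ('v \<Rightarrow> 'v) \<Rightarrow> ('v \<Rightarrow> 'v) \<Rightarrow> ('v \<Rightarrow> 'v) \<Rightarrow> nat \<Rightarrow> 'v::zero \<Rightarrow> 'v" where
  "endo h4 h5 h7 h8 i = (if i = 4 then h4 else if i = 5 then h5 else if i = 7 then h7
     else if i = 8 then h8 else (\<lambda>v. 0))"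

lemma endo_simps:
  "endo h4 h5 h7 h8 1 = (\<lambda>v. 0)" "endo h4 h5 h7 h8 2 = (\<lambda>v. 0)" "endo h4 h5 h7 h8 3 = (\<lambda>v. 0)"
  "endo h4 h5 h7 h8 4 = h4" "endo h4 h5 h7 h8 5 = h5" "endo h4 h5 h7 h8 6 = (\<lambda>v. 0)"
  "endo h4 h5 h7 h8 7 = h7" "endo h4 h5 h7 h8 8 = h8"
  by (simp_all add: endo_def)

lemma is_hom_endo:
  fixes X :: "('k::field, 'v::ab_group_add, nat, nat \<times> nat) qrep"
  assumes X: "is_rep Q8 X"
    and l: "Vector_Spaces.linear (smul X) (smul X) h4" "Vector_Spaces.linear (smul X) (smul X) h5"
      "Vector_Spaces.linear (smul X) (smul X) h7" "Vector_Spaces.linear (smul X) (smul X) h8"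
    and m: "\<forall>x\<in>space X 4. h4 x \<in> space X 4" "\<forall>x\<in>space X 5. h5 x \<in> space X 5"
      "\<forall>x\<in>space X 7. h7 x \<in> space X 7" "\<forall>x\<in>space X 8. h8 x \<in> space X 8"
    and c: "\<forall>v\<in>space X 1. h4 (amap X (1, 4) v) = 0" "\<forall>v\<in>space X 2. h4 (amap X (2, 4) v) = 0"
      "\<forall>v\<in>space X 3. h4 (amap X (3, 4) v) = 0" "\<forall>v\<in>space X 4. h5 (amap X (4, 5) v) = amap X (4, 5) (h4 v)"
      "\<forall>v\<in>space X 5. amap X (5, 6) (h5 v) = 0" "\<forall>v\<in>space X 5. h7 (amap X (5, 7) v) = amap X (5, 7) (h5 v)"
      "\<forall>v\<in>space X 5. h8 (amap X (5, 8) v) = amap X (5, 8) (h5 v)"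
  shows "is_hom Q8 X X (endo h4 h5 h7 h8)"
proof -
  interpret vector_space "smul X" using X is_repD by blast
  have z: "0 \<in> space X i" if "i \<in> verts Q8" for i by (rule subspace_0[OF is_repD(3)[OF X that]])
  have a0: "amap X x 0 = 0" if "x \<in> arcs Q8" for x
    by (rule linear_map_on_zero_diff(1)[OF is_repD(4)[OF X that] vector_space_axioms vector_space_axioms
        is_repD(3)[OF X wf_digraph.tail_in_verts[OF wf_digraph_Q8 that]]])
  have lin: "linear_map_on (smul X) (space X i) (smul X) (space X i) h"
    if "Vector_Spaces.linear (smul X) (smul X) h" "\<forall>x\<in>space X i. h x \<in> space X i" for h i
    using that by (auto simp: linear_map_on_def Vector_Spaces.linear_iff)
  have lin0: "Vector_Spaces.linear (smul X) (smul X) (\<lambda>v. 0)"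
    by (rule linearI'[OF vector_space_axioms vector_space_axioms]) auto
  show ?thesis
    unfolding is_hom_def
  proof (intro conjI ballI)
    show "linear_map_on (smul X) (space X i) (smul X) (space X i) (endo h4 h5 h7 h8 i)" if "i \<in> verts Q8" for i
      unfolding endo_def using l m z[OF that] lin0 by (auto intro!: lin)
    show "endo h4 h5 h7 h8 (head Q8 x) (amap X x v) = amap X x (endo h4 h5 h7 h8 (tail Q8 x) v)"
      if "x \<in> arcs Q8" "v \<in> space X (tail Q8 x)" for x v
      using that c a0[OF that(1)] by (auto simp: Q8_simps endo_simps simp del: One_nat_def)
  qed
qed

text \<open>Any degenerate position of the maps admits a nonscalar endomorphism. So the two maps out
  of vertex 5 are nonzero, their kernels are distinct lines, and the image of the arrow 4 -> 5 is a
  line different from both.\<close>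

lemma brick_structure:
  fixes B :: "('k::field, 'w::ab_group_add, nat, nat \<times> nat) qrep"
  assumes B: "is_rep Q8 B" and E: "End_is_field Q8 B" and dv: "dim_vec Q8 B = vec8 [0, 0, 0, 1, 2, 0, 1, 1]"
  obtains v u w :: 'w and c4 cu cw :: "'w \<Rightarrow> 'k" where
    "v \<in> space B 4" "u \<in> space B 5" "w \<in> space B 5" "amap B (4, 5) v = u + w"
    "amap B (5, 7) u = 0" "amap B (5, 8) w = 0" "amap B (5, 7) w \<noteq> 0" "amap B (5, 8) u \<noteq> 0"
    "\<And>y. y \<in> space B 4 \<Longrightarrow> y = smul B (c4 y) v"
    "\<And>z. z \<in> space B 5 \<Longrightarrow> z = smul B (cu z) u + smul B (cw z) w"
    "Vector_Spaces.linear (smul B) (*) c4" "Vector_Spaces.linear (smul B) (*) cu" "Vector_Spaces.linear (smul B) (*) cw"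
    "c4 v = 1" "cu u = 1" "cu w = 0" "cw u = 0" "cw w = 1"
    "space B 1 = {0}" "space B 2 = {0}" "space B 3 = {0}" "space B 6 = {0}"
proof -
  interpret vector_space "smul B" using B is_repD by blast
  interpret vv: vector_space_pair "smul B" "smul B" ..
  interpret k: vector_space "(*) :: 'k \<Rightarrow> 'k \<Rightarrow> 'k" by (rule linear_field_vs)
  interpret vk: vector_space_pair "smul B" "(*) :: 'k \<Rightarrow> 'k \<Rightarrow> 'k" ..
  have dims: "dim (space B 1) = 0" "dim (space B 2) = 0" "dim (space B 3) = 0" "dim (space B 4) = 1" "dim (space B 5) = 2"
    "dim (space B 6) = 0" "dim (space B 7) = 1" "dim (space B 8) = 1"
    using fun_cong[OF dv, of 1] fun_cong[OF dv, of 2] fun_cong[OF dv, of 3] fun_cong[OF dv, of 4]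
      fun_cong[OF dv, of 5] fun_cong[OF dv, of 6] fun_cong[OF dv, of 7] fun_cong[OF dv, of 8]
    by (simp_all add: dim_vec_def vec8_def verts_Q8 del: One_nat_def)
  have V: "1 \<in> verts Q8" "2 \<in> verts Q8" "3 \<in> verts Q8" "4 \<in> verts Q8" "5 \<in> verts Q8" "6 \<in> verts Q8"
    "7 \<in> verts Q8" "8 \<in> verts Q8" by (simp_all add: verts_Q8)
  note fd = is_repD(2)[OF B] and sub = is_repD(3)[OF B]
  have triv: "space B 1 = {0}" "space B 2 = {0}" "space B 3 = {0}" "space B 6 = {0}"
    using fd_dim_0[OF fd] dims V by auto
  obtain M where M: "\<And>x. x \<in> arcs Q8 \<Longrightarrow> Vector_Spaces.linear (smul B) (smul B) (M x)"
    "\<And>x v. x \<in> arcs Q8 \<Longrightarrow> v \<in> space B (tail Q8 x) \<Longrightarrow> M x v = amap B x v"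
    by (rule total_amap[OF B wf_digraph_Q8]) (rule that; assumption)
  define D where "D = M (4, 5)"
  define F where "F = M (5, 7)"
  define H where "H = M (5, 8)"
  have lin: "Vector_Spaces.linear (smul B) (smul B) D" "Vector_Spaces.linear (smul B) (smul B) F"
    "Vector_Spaces.linear (smul B) (smul B) H"
    using M(1) by (simp_all add: D_def F_def H_def arcs_Q8)
  interpret D: Vector_Spaces.linear "smul B" "smul B" D by (rule lin)
  interpret F: Vector_Spaces.linear "smul B" "smul B" F by (rule lin)
  interpret H: Vector_Spaces.linear "smul B" "smul B" H by (rule lin)
  have MD: "amap B (4, 5) y = D y" if "y \<in> space B 4" for y using M(2)[of "(4,5)" y] that by (simp add: D_def Q8_simps)
  have MF: "amap B (5, 7) y = F y" if "y \<in> space B 5" for y using M(2)[of "(5,7)" y] that by (simp add: F_def Q8_simps)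
  have MH: "amap B (5, 8) y = H y" if "y \<in> space B 5" for y using M(2)[of "(5,8)" y] that by (simp add: H_def Q8_simps)
  have in5: "D y \<in> space B 5" if "y \<in> space B 4" for y
    using linear_map_onD(1)[OF is_repD(4)[OF B, of "(4, 5)"], of y] that unfolding MD[OF that, symmetric] by (simp add: Q8_simps)
  have in7: "F y \<in> space B 7" if "y \<in> space B 5" for y
    using linear_map_onD(1)[OF is_repD(4)[OF B, of "(5, 7)"], of y] that unfolding MF[OF that, symmetric] by (simp add: Q8_simps)
  have in8: "H y \<in> space B 8" if "y \<in> space B 5" for y
    using linear_map_onD(1)[OF is_repD(4)[OF B, of "(5, 8)"], of y] that unfolding MH[OF that, symmetric] by (simp add: Q8_simps)
  have a0: "amap B x 0 = 0" if "x \<in> arcs Q8" for x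
    by (rule linear_map_on_zero_diff(1)[OF is_repD(4)[OF B that] vector_space_axioms vector_space_axioms
        is_repD(3)[OF B wf_digraph.tail_in_verts[OF wf_digraph_Q8 that]]])
  have e0: "amap B (5, 6) y = 0" if "y \<in> space B 5" for y
    using linear_map_onD(1)[OF is_repD(4)[OF B, of "(5, 6)"]] that triv by (simp add: Q8_simps)
  have scalar: "\<exists>c. (\<forall>y\<in>space B 4. h4 y = smul B c y) \<and> (\<forall>y\<in>space B 5. h5 y = smul B c y) \<and>
      (\<forall>y\<in>space B 7. h7 y = smul B c y) \<and> (\<forall>y\<in>space B 8. h8 y = smul B c y)"
    if l: "Vector_Spaces.linear (smul B) (smul B) h4" "Vector_Spaces.linear (smul B) (smul B) h5"
      "Vector_Spaces.linear (smul B) (smul B) h7" "Vector_Spaces.linear (smul B) (smul B) h8"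
    and m: "\<forall>x\<in>space B 4. h4 x \<in> space B 4" "\<forall>x\<in>space B 5. h5 x \<in> space B 5"
      "\<forall>x\<in>space B 7. h7 x \<in> space B 7" "\<forall>x\<in>space B 8. h8 x \<in> space B 8"
    and c: "\<forall>y\<in>space B 4. h5 (D y) = D (h4 y)" "\<forall>y\<in>space B 5. h7 (F y) = F (h5 y)"
      "\<forall>y\<in>space B 5. h8 (H y) = H (h5 y)" for h4 h5 h7 h8
  proof -
    have h40: "h4 0 = 0" using vv.linear_0[OF l(1)] .
    have "is_hom Q8 B B (endo h4 h5 h7 h8)"
      by (rule is_hom_endo[OF B l m]) (use c m triv h40 e0 in \<open>auto simp: MD MF MH a0 Q8_simps simp del: One_nat_def\<close>)
    then obtain c where "\<forall>i\<in>verts Q8. \<forall>y\<in>space B i. endo h4 h5 h7 h8 i y = smul B c y"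
      using E unfolding End_is_field_def by blast
    then have "\<forall>y\<in>space B i. endo h4 h5 h7 h8 i y = smul B c y" if "i \<in> verts Q8" for i using that by blast
    from this[OF V(4)] this[OF V(5)] this[OF V(7)] this[OF V(8)] show ?thesis
      unfolding endo_simps by blast
  qed
  have lz: "Vector_Spaces.linear (smul B) (smul B) (\<lambda>y. 0)"
    by (rule linearI'[OF vector_space_axioms vector_space_axioms]) auto
  note lid = linear_ident
  have lr: "Vector_Spaces.linear (smul B) (smul B) (\<lambda>y. smul B (\<phi> y) x)"
    if "Vector_Spaces.linear (smul B) (*) \<phi>" for \<phi> x
    by (rule linearI'[OF vector_space_axioms vector_space_axioms])
      (use that in \<open>auto simp: Vector_Spaces.linear_iff scale_left_distrib\<close>)
  have z: "0 \<in> space B i" if "i \<in> verts Q8" for i by (rule subspace_0[OF sub[OF that]])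
  have ex: "\<exists>y\<in>space B i. y \<noteq> 0" if "i \<in> verts Q8" "dim (space B i) \<noteq> 0" for i
  proof (rule ccontr)
    assume "\<not> (\<exists>y\<in>space B i. y \<noteq> 0)"
    then have "space B i = {0}" using z[OF that(1)] by auto
    then show False using that(2) dim_zero_subspace by simp
  qed
  obtain v c4 where v: "v \<in> space B 4" "Vector_Spaces.linear (smul B) (*) c4" "c4 v = 1"
      "\<And>y. y \<in> space B 4 \<Longrightarrow> y = smul B (c4 y) v"
    by (rule dim_1_coordinates[OF fd[OF V(4)] dims(4)]) (rule that; assumption)
  have v0: "v \<noteq> 0" using v(2,3) vk.linear_0[OF v(2)] by auto
  have kernel: "\<exists>u\<in>space B 5. u \<noteq> 0 \<and> K u = 0"
    if K: "Vector_Spaces.linear (smul B) (smul B) K" "\<forall>y\<in>space B 5. K y \<in> space B j" "j \<in> verts Q8" "dim (space B j) = 1" for K j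
  proof (rule ccontr)
    assume "\<not> ?thesis"
    then have "dim (K ` space B 5) = dim (space B 5)" by (intro vv.dim_image_inj[OF K(1) fd[OF V(5)]]) blast
    moreover have "K ` space B 5 \<subseteq> space B j" using K(2) by blast
    ultimately show False
      using fd_subspace_dim_mono(2)[OF fd[OF K(3)] fd_subspaceD[OF vv.rank_nullity(1)[OF K(1) fd[OF V(5)]]]] K(4) dims by simp
  qed
  obtain u where u: "u \<in> space B 5" "u \<noteq> 0" "F u = 0" using kernel[OF lin(2), of 7] in7 V dims by blast
  obtain w where w: "w \<in> space B 5" "w \<noteq> 0" "H w = 0" using kernel[OF lin(3), of 8] in8 V dims by blast
  obtain r7 where r7: "r7 \<in> space B 7" "r7 \<noteq> 0" using ex[OF V(7)] dims by auto
  obtain r8 where r8: "r8 \<in> space B 8" "r8 \<noteq> 0" using ex[OF V(8)] dims by auto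
  \<comment> \<open>Otherwise the identity at 7, extended by zero, is a nonscalar
    endomorphism.\<close>
  have Fnz: "\<exists>y\<in>space B 5. F y \<noteq> 0"
  proof (rule ccontr)
    assume "\<not> ?thesis"
    then obtain c where "\<forall>y\<in>space B 5. 0 = smul B c y" "\<forall>y\<in>space B 7. y = smul B c y"
      using scalar[OF lz lz lid lz] z V by auto
    then show False using u r7 by (metis scale_eq_0_iff scale_zero_left)
  qed
  have Hnz: "\<exists>y\<in>space B 5. H y \<noteq> 0"
  proof (rule ccontr)
    assume "\<not> ?thesis"
    then obtain c where "\<forall>y\<in>space B 5. 0 = smul B c y" "\<forall>y\<in>space B 8. y = smul B c y"
      using scalar[OF lz lz lz lid] z V by auto
    then show False using u r8 by (metis scale_eq_0_iff scale_zero_left)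
  qed
  have "w \<notin> span {u}"
  proof
    assume "w \<in> span {u}"
    then obtain t where t: "w = smul B t u" by (auto simp: span_singleton)
    then have Hu: "H u = 0" using w H.scale[of t u] by auto
    \<comment> \<open>The space at 5 has dimension 2, so some vector lies off the line of
      \<open>D v\<close>. A functional \<psi> that vanishes on this line but not at \<open>b\<close>
      makes \<open>y \<mapsto> \<psi> y u\<close> a nonscalar endomorphism, its values being killed
      by both \<open>F\<close> and \<open>H\<close>.\<close>
    have "\<exists>b\<in>space B 5. b \<notin> span {D v}"
    proof (rule ccontr)
      assume "\<not> ?thesis"
      then have "dim (space B 5) \<le> card {D v}" by (intro dim_le_card) auto
      then show False using dims by simp
    qed
    then obtain b where b: "b \<in> space B 5" "b \<notin> span {D v}" by blast
    obtain \<psi> :: "'w \<Rightarrow> 'k" where \<psi>: "Vector_Spaces.linear (smul B) (*) \<psi>" "\<And>x. x \<in> span {D v} \<Longrightarrow> \<psi> x = 0" "\<psi> b = 1"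
      by (rule functional_separation[OF subspace_span b(2)]) (rule that; assumption)
    have "\<psi> (D y) = 0" if "y \<in> space B 4" for y
    proof -
      have "D y = smul B (c4 y) (D v)" using v(4)[OF that] D.scale by metis
      then show ?thesis using \<psi>(2) span_scale span_base by simp
    qed
    then obtain c where c: "\<forall>y\<in>space B 5. smul B (\<psi> y) u = smul B c y" "\<forall>y\<in>space B 7. 0 = smul B c y"
      using scalar[OF lz lr[OF \<psi>(1), of u] lz lz] z V subspace_scale[OF sub[OF V(5)] u(1)]
      by (auto simp: F.scale H.scale u Hu)
    then have "c = 0" using r7 by auto
    then show False using bspec[OF c(1) b(1)] \<psi>(3) u(2) by simp
  qed
  then obtain cu cw where cc: "Vector_Spaces.linear (smul B) (*) cu" "Vector_Spaces.linear (smul B) (*) cw"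
      "cu u = 1" "cu w = 0" "cw u = 0" "cw w = 1" "\<And>y. y \<in> space B 5 \<Longrightarrow> y = smul B (cu y) u + smul B (cw y) w"
    by (rule dim_2_coordinates[OF fd[OF V(5)] dims(5) u(1,2) w(1)]) (rule that; assumption)
  have Fw: "F w \<noteq> 0"
    using Fnz cc(7) u(3) by (metis F.add F.scale add_0 scale_zero_right)
  have Hu: "H u \<noteq> 0"
    using Hnz cc(7) w(3) by (metis H.add H.scale add_0_right scale_zero_right)
  have cD: "cu (D y) = c4 y * cu (D v)" "cw (D y) = c4 y * cw (D v)" if "y \<in> space B 4" for y
  proof -
    have "D y = smul B (c4 y) (D v)" using v(4)[OF that] D.scale by metis
    then show "cu (D y) = c4 y * cu (D v)" "cw (D y) = c4 y * cw (D v)"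
      using cc(1,2) by (simp_all add: Vector_Spaces.linear_iff)
  qed
  \<comment> \<open>If \<open>D v\<close> lay on the line of \<open>w\<close>, the projection to the
    line of \<open>u\<close> at 5 with the identity at 8 and zero at 4 and 7 would be a nonscalar
    endomorphism.\<close>
  have \<alpha>: "cu (D v) \<noteq> 0"
  proof
    assume 0: "cu (D v) = 0"
    have com: "\<forall>y\<in>space B 5. H y = H (smul B (cu y) u)"
    proof
      fix y assume "y \<in> space B 5"
      from arg_cong[OF cc(7)[OF this], of H] show "H y = H (smul B (cu y) u)"
        using w(3) by (simp add: H.add H.scale)
    qed
    have "\<forall>y\<in>space B 5. 0 = F (smul B (cu y) u)" using u(3) by (simp add: F.scale)
    moreover have "\<forall>y\<in>space B 4. smul B (cu (D y)) u = D 0" using cD 0 by simp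
    moreover have "\<forall>y\<in>space B 5. smul B (cu y) u \<in> space B 5" using subspace_scale[OF sub[OF V(5)] u(1)] by blast
    ultimately obtain c where c: "\<forall>y\<in>space B 4. 0 = smul B c y" "\<forall>y\<in>space B 8. y = smul B c y"
      using scalar[OF lz lr[OF cc(1), of u] lz lid] com z V by blast
    then have "c = 0" using v(1) v0 by auto
    then show False using c(2) r8 by auto
  qed
  have \<beta>: "cw (D v) \<noteq> 0"
  proof
    assume 0: "cw (D v) = 0"
    have com: "\<forall>y\<in>space B 5. F y = F (smul B (cw y) w)"
    proof
      fix y assume "y \<in> space B 5"
      from arg_cong[OF cc(7)[OF this], of F] show "F y = F (smul B (cw y) w)"
        using u(3) by (simp add: F.add F.scale)
    qed
    have "\<forall>y\<in>space B 5. 0 = H (smul B (cw y) w)" using w(3) by (simp add: H.scale)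
    moreover have "\<forall>y\<in>space B 4. smul B (cw (D y)) w = D 0" using cD 0 by simp
    moreover have "\<forall>y\<in>space B 5. smul B (cw y) w \<in> space B 5" using subspace_scale[OF sub[OF V(5)] w(1)] by blast
    ultimately obtain c where c: "\<forall>y\<in>space B 4. 0 = smul B c y" "\<forall>y\<in>space B 7. y = smul B c y"
      using scalar[OF lz lr[OF cc(2), of w] lid lz] com z V by blast
    then have "c = 0" using v(1) v0 by auto
    then show False using c(2) r7 by auto
  qed
  \<comment> \<open>Rescaling the two kernel vectors by the coordinates of \<open>D v\<close>
    normalises the image of \<open>v\<close> to their sum; the coordinate functionals are divided
    accordingly.\<close>
  let ?a = "cu (D v)" and ?b = "cw (D v)"
  have lsc: "Vector_Spaces.linear (smul B) (*) (\<lambda>y. h y / a)" if "Vector_Spaces.linear (smul B) (*) h" for h a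
    using that by (auto simp: Vector_Spaces.linear_iff add_divide_distrib)
  have hs: "h (smul B c y) = c * h y" if "Vector_Spaces.linear (smul B) (*) h" for h c y
    using that by (auto simp: Vector_Spaces.linear_iff)
  show thesis
  proof (rule that[of v "smul B ?a u" "smul B ?b w" c4 "\<lambda>y. cu y / ?a" "\<lambda>y. cw y / ?b"])
    show m: "smul B ?a u \<in> space B 5" "smul B ?b w \<in> space B 5"
      using subspace_scale[OF sub[OF V(5)]] u w by auto
    show "amap B (4, 5) v = smul B ?a u + smul B ?b w" using MD[OF v(1)] cc(7)[OF in5[OF v(1)]] by simp
    show "amap B (5, 7) (smul B ?a u) = 0" "amap B (5, 8) (smul B ?b w) = 0"
      "amap B (5, 7) (smul B ?b w) \<noteq> 0" "amap B (5, 8) (smul B ?a u) \<noteq> 0"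
      using MF[OF m(1)] MH[OF m(2)] MF[OF m(2)] MH[OF m(1)] Fw Hu \<alpha> \<beta> u w by (simp_all add: F.scale H.scale)
    show "y = smul B (cu y / ?a) (smul B ?a u) + smul B (cw y / ?b) (smul B ?b w)" if "y \<in> space B 5" for y
      using cc(7)[OF that] \<alpha> \<beta> by simp
  qed (use v cc lsc triv \<alpha> \<beta> in \<open>simp_all add: hs\<close>)
qed

section \<open>Vanishing of extensions as linear algebra on X\<close>

lemma linear_map_on_functional_scale:
  assumes "vector_space s1" "vector_space s2" "Vector_Spaces.linear s1 (*) \<phi>" "module.subspace s2 W" "q \<in> W"
  shows "linear_map_on s1 U s2 W (\<lambda>z. s2 (\<phi> z) q)"
proof -
  interpret vector_space s2 by fact
  show ?thesis using assms(3,4,5) subspace_scale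
    by (auto simp: linear_map_on_def Vector_Spaces.linear_iff scale_left_distrib)
qed

lemma linear_map_on_const_zero:
  assumes "vector_space s2" "module.subspace s2 W" shows "linear_map_on s1 U s2 W (\<lambda>z. 0)"
proof -
  interpret vector_space s2 by fact
  show ?thesis using subspace_0[OF assms(2)] by (simp add: linear_map_on_def)
qed

text \<open>The task is to establish \<open>split_data\<close>. Its conditions coming from
  extensions are coboundary equations for well-chosen test families along the arrows, evaluated at
  the normalised basis of the brick.\<close>

lemma no_brick_below_alpha8:
  fixes X :: "('k::field, 'v::ab_group_add, nat, nat \<times> nat) qrep"
    and B :: "('k, 'w::ab_group_add, nat, nat \<times> nat) qrep"
  assumes X: "is_indec_of Q8 alpha8 X"
    and B: "is_rep Q8 B" "End_is_field Q8 B" "dim_vec Q8 B = vec8 [0, 0, 0, 1, 2, 0, 1, 1]"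
    and EBX: "Ext1_vanishes Q8 B X" and EXB: "Ext1_vanishes Q8 X B"
  shows False
proof -
  have ind: "indecomposable Q8 X" and dv: "dim_vec Q8 X = alpha8" using X by (auto simp: is_indec_of_def)
  have rX: "is_rep Q8 X" using ind by (simp add: indecomposable_def)
  interpret wf_digraph Q8 by (rule wf_digraph_Q8)
  interpret vector_space "smul X" using rX is_repD by blast
  interpret b: vector_space "smul B" using B is_repD by blast
  interpret vv: vector_space_pair "smul X" "smul X" ..
  have V: "1 \<in> verts Q8" "2 \<in> verts Q8" "3 \<in> verts Q8" "4 \<in> verts Q8" "5 \<in> verts Q8" "6 \<in> verts Q8"
    "7 \<in> verts Q8" "8 \<in> verts Q8" by (simp_all add: verts_Q8)
  have ar: "(1, 4) \<in> arcs Q8" "(2, 4) \<in> arcs Q8" "(3, 4) \<in> arcs Q8" "(4, 5) \<in> arcs Q8" "(5, 6) \<in> arcs Q8"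
    "(5, 7) \<in> arcs Q8" "(5, 8) \<in> arcs Q8" by (simp_all add: arcs_Q8)
  have dims: "dim (space X 1) = 1" "dim (space X 2) = 1" "dim (space X 3) = 1" "dim (space X 4) = 8" "dim (space X 5) = 12"
    "dim (space X 6) = 2" "dim (space X 7) = 7" "dim (space X 8) = 7"
    using fun_cong[OF dv, of 1] fun_cong[OF dv, of 2] fun_cong[OF dv, of 3] fun_cong[OF dv, of 4]
      fun_cong[OF dv, of 5] fun_cong[OF dv, of 6] fun_cong[OF dv, of 7] fun_cong[OF dv, of 8]
    by (simp_all add: dim_vec_def alpha8_def verts_Q8 del: One_nat_def)
  note fd = is_repD(2)[OF rX] and sub = is_repD(3)[OF rX]
  obtain M where M: "\<And>x. x \<in> arcs Q8 \<Longrightarrow> Vector_Spaces.linear (smul X) (smul X) (M x)"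
    "\<And>x v. x \<in> arcs Q8 \<Longrightarrow> v \<in> space X (tail Q8 x) \<Longrightarrow> M x v = amap X x v"
    by (rule total_amap[OF rX wf_digraph_Q8]) (rule that; assumption)
  have Mam: "M (i, j) v = amap X (i, j) v" if "(i, j) \<in> arcs Q8" "v \<in> space X i" for i j v
    using M(2)[OF that(1)] that(2) by (simp add: tail_head_Q8)
  have Min: "M (i, j) v \<in> space X j" if "(i, j) \<in> arcs Q8" "v \<in> space X i" for i j v
    using linear_map_onD(1)[OF is_repD(4)[OF rX that(1)], of v] that(2) unfolding Mam[OF that] by (simp add: tail_head_Q8)
  have M0: "M x 0 = 0" if "x \<in> arcs Q8" for x using vv.linear_0[OF M(1)[OF that]] .
  \<comment> \<open>Vertices 1, 2, 3 are seen only through the sum of their images in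
    \<open>space X 4\<close>, of dimension at most 1 + 1 + 1.\<close>
  define A1 where "A1 = {x + y |x y. x \<in> M (1, 4) ` space X 1 \<and> y \<in> M (2, 4) ` space X 2}"
  define A where "A = {x + y |x y. x \<in> A1 \<and> y \<in> M (3, 4) ` space X 3}"
  have fdi: "fd_subspace (smul X) (M (i, j) ` space X i)" "dim (M (i, j) ` space X i) \<le> dim (space X i)"
    if "(i, j) \<in> arcs Q8" "i \<in> verts Q8" for i j
    using vv.rank_nullity[OF M(1)[OF that(1)] fd[OF that(2)]] by auto
  have fdA1: "fd_subspace (smul X) A1" unfolding A1_def by (intro fd_subspace_sum fdi V ar)
  have fdA: "fd_subspace (smul X) A" unfolding A_def by (intro fd_subspace_sum fdi fdA1 V ar)
  have dA1: "dim A1 \<le> 2"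
    using dim_sum_Int[OF fdi(1)[OF ar(1) V(1)] fdi(1)[OF ar(2) V(2)]] fdi(2)[OF ar(1) V(1)] fdi(2)[OF ar(2) V(2)] dims
    unfolding A1_def by linarith
  have dA: "dim A \<le> 3"
    using dim_sum_Int[OF fdA1 fdi(1)[OF ar(3) V(3)]] dA1 fdi(2)[OF ar(3) V(3)] dims
    unfolding A_def by linarith
  have A4: "A \<subseteq> space X 4"
    using subspace_add[OF sub[OF V(4)]] Min ar by (auto simp: A_def A1_def)
  have A_kill: "h y = 0" if h: "linear_map_on (smul X) (space X 4) s W h"
      and k: "\<And>i t. (i, 4) \<in> arcs Q8 \<Longrightarrow> t \<in> space X i \<Longrightarrow> h (M (i, 4) t) = 0" and y: "y \<in> A"
    for h :: "'v \<Rightarrow> 'u::ab_group_add" and s W y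
  proof -
    obtain t1 t2 t3 where t: "t1 \<in> space X 1" "t2 \<in> space X 2" "t3 \<in> space X 3"
        "y = (M (1, 4) t1 + M (2, 4) t2) + M (3, 4) t3"
      using y by (auto simp: A_def A1_def)
    note m = Min[OF ar(1) t(1)] Min[OF ar(2) t(2)] Min[OF ar(3) t(3)]
    show ?thesis
      unfolding t(4) using m subspace_add[OF sub[OF V(4)] m(1,2)] k[OF ar(1) t(1)] k[OF ar(2) t(2)] k[OF ar(3) t(3)]
      by (simp add: linear_map_onD(2)[OF h])
  qed
  have A_gen: "M (i, 4) t \<in> A" if "(i, 4) \<in> arcs Q8" "t \<in> space X i" for i t
  proof -
    note z = subspace_0[OF sub[OF V(1)]] subspace_0[OF sub[OF V(2)]] subspace_0[OF sub[OF V(3)]]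
    have "M (i, 4) t = (M (1, 4) t + M (2, 4) 0) + M (3, 4) 0 \<and> i = 1 \<or>
      M (i, 4) t = (M (1, 4) 0 + M (2, 4) t) + M (3, 4) 0 \<and> i = 2 \<or>
      M (i, 4) t = (M (1, 4) 0 + M (2, 4) 0) + M (3, 4) t \<and> i = 3"
      using that(1) M0[OF ar(1)] M0[OF ar(2)] M0[OF ar(3)] by (auto simp: arcs_Q8 simp del: One_nat_def)
    then show ?thesis unfolding A_def A1_def using that(2) z by blast
  qed
  obtain v u w :: 'w and c4 cu cw :: "'w \<Rightarrow> 'k" where
    mem: "v \<in> space B 4" "u \<in> space B 5" "w \<in> space B 5" and Bd: "amap B (4, 5) v = u + w"
    and Bf: "amap B (5, 7) u = 0" "amap B (5, 8) w = 0" "amap B (5, 7) w \<noteq> 0" "amap B (5, 8) u \<noteq> 0"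
    and c4: "\<And>y. y \<in> space B 4 \<Longrightarrow> y = smul B (c4 y) v"
    and c5: "\<And>z. z \<in> space B 5 \<Longrightarrow> z = smul B (cu z) u + smul B (cw z) w"
    and cl: "Vector_Spaces.linear (smul B) (*) c4" "Vector_Spaces.linear (smul B) (*) cu" "Vector_Spaces.linear (smul B) (*) cw"
    and cv: "c4 v = 1" "cu u = 1" "cu w = 0" "cw u = 0" "cw w = 1"
    and triv: "space B 1 = {0}" "space B 2 = {0}" "space B 3 = {0}" "space B 6 = {0}"
    by (rule brick_structure[OF B]) (rule that; assumption)
  note vX = vector_space_axioms and vB = b.vector_space_axioms
  have B0: "amap B x 0 = 0" if "x \<in> arcs Q8" for x
    by (rule linear_map_on_zero_diff(1)[OF is_repD(4)[OF B(1) that] vB vB is_repD(3)[OF B(1) tail_in_verts[OF that]]])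
  have B56: "amap B (5, 6) z = 0" if "z \<in> space B 5" for z
    using linear_map_onD(1)[OF is_repD(4)[OF B(1) ar(5)], of z] that triv by (simp add: tail_head_Q8)
  have from_Ext_BX: "\<exists>y\<in>space X 4. \<exists>m\<in>space X 5. \<exists>n\<in>space X 5. M (5, 6) m = 0 \<and> M (5, 6) n = 0 \<and>
      M (5, 7) m = r \<and> M (5, 8) n = r' \<and> q = m + n - M (4, 5) y"
    if q: "q \<in> space X 5" "r \<in> space X 7" "r' \<in> space X 8" for q r r'
  proof -
    \<comment> \<open>The test family has the value \<open>q\<close> at \<open>v\<close> and the
      values \<open>- r\<close> at \<open>u\<close> and \<open>- r'\<close> at \<open>w\<close>. The
      signs compensate the minus sign in the coboundary, whose other term is zero there since
      \<open>u\<close> and \<open>w\<close> are killed by the respective arrows.\<close>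
    define \<zeta> where "\<zeta> x z = (if x = (4, 5) then smul X (c4 z) q else if x = (5, 7) then smul X (cu z) (- r)
      else if x = (5, 8) then smul X (cw z) (- r') else 0)" for x :: "nat \<times> nat" and z
    have "linear_map_on (smul B) (space B (tail Q8 x)) (smul X) (space X (head Q8 x)) (\<zeta> x)" if x: "x \<in> arcs Q8" for x
    proof -
      consider "x = (4, 5)" | "x = (5, 7)" | "x = (5, 8)" | "x \<notin> {(4, 5), (5, 7), (5, 8)}" by blast
      then show ?thesis
      proof cases
        case 1
        then show ?thesis
          using linear_map_on_functional_scale[OF vB vX cl(1) sub[OF V(5)] q(1)] by (simp add: \<zeta>_def[abs_def] tail_head_Q8)
      next
        case 2
        then show ?thesis
          using linear_map_on_functional_scale[OF vB vX cl(2) sub[OF V(7)] subspace_neg[OF sub[OF V(7)] q(2)]]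
          by (simp add: \<zeta>_def[abs_def] tail_head_Q8)
      next
        case 3
        then show ?thesis
          using linear_map_on_functional_scale[OF vB vX cl(3) sub[OF V(8)] subspace_neg[OF sub[OF V(8)] q(3)]]
          by (simp add: \<zeta>_def[abs_def] tail_head_Q8)
      next
        case 4
        then have "\<zeta> x = (\<lambda>z. 0)" by (auto simp: \<zeta>_def)
        then show ?thesis using linear_map_on_const_zero[OF vX sub[OF head_in_verts[OF x]]] by simp
      qed
    qed
    then obtain \<eta> where \<eta>: "\<And>i. i \<in> verts Q8 \<Longrightarrow> linear_map_on (smul B) (space B i) (smul X) (space X i) (\<eta> i)"
        "\<And>x z. x \<in> arcs Q8 \<Longrightarrow> z \<in> space B (tail Q8 x) \<Longrightarrow>
          \<zeta> x z = \<eta> (head Q8 x) (amap B x z) - amap X x (\<eta> (tail Q8 x) z)"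
      by (rule Ext1_vanishes_coboundary[OF B(1) rX EBX]) (assumption, (rule that; assumption))
    have e: "\<zeta> (i, j) z = \<eta> j (amap B (i, j) z) - M (i, j) (\<eta> i z)" if "(i, j) \<in> arcs Q8" "z \<in> space B i" "i \<in> verts Q8" for i j z
      using \<eta>(2)[OF that(1), of z] that(2) Mam[OF that(1) linear_map_onD(1)[OF \<eta>(1)[OF that(3)] that(2)]]
      by (simp add: tail_head_Q8)
    have \<eta>0: "\<eta> i 0 = 0" if "i \<in> verts Q8" for i
      by (rule linear_map_on_zero_diff(1)[OF \<eta>(1)[OF that] vB vX is_repD(3)[OF B(1) that]])
    have "q = \<eta> 5 (u + w) - M (4, 5) (\<eta> 4 v)" using e[OF ar(4) mem(1) V(4)] cv Bd by (simp add: \<zeta>_def)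
    then have "q = \<eta> 5 u + \<eta> 5 w - M (4, 5) (\<eta> 4 v)"
      using linear_map_onD(2)[OF \<eta>(1)[OF V(5)] mem(2,3)] by simp
    moreover have "M (5, 6) (\<eta> 5 u) = 0" "M (5, 6) (\<eta> 5 w) = 0"
      using e[OF ar(5) mem(2) V(5)] e[OF ar(5) mem(3) V(5)] B56 mem \<eta>0[OF V(6)] by (simp_all add: \<zeta>_def)
    moreover have "M (5, 7) (\<eta> 5 u) = r" "M (5, 8) (\<eta> 5 w) = r'"
      using e[OF ar(6) mem(2) V(5)] e[OF ar(7) mem(3) V(5)] Bf cv \<eta>0[OF V(7)] \<eta>0[OF V(8)] by (simp_all add: \<zeta>_def)
    ultimately show ?thesis
      using linear_map_onD(1)[OF \<eta>(1)[OF V(4)] mem(1)] linear_map_onD(1)[OF \<eta>(1)[OF V(5)] mem(2)]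
        linear_map_onD(1)[OF \<eta>(1)[OF V(5)] mem(3)] by blast
  qed
  have from_Ext_XB: "\<kappa> y = \<mu> x"
    if xy: "x \<in> space X 4" "y \<in> space X 4" "x - y \<in> A" "M (5, 7) (M (4, 5) x) = 0" "M (5, 8) (M (4, 5) y) = 0"
      and l: "Vector_Spaces.linear (smul X) (*) \<kappa>" "Vector_Spaces.linear (smul X) (*) \<mu>" for x y \<kappa> \<mu>
  proof -
    \<comment> \<open>The test family is concentrated on the arrow 4 -> 5. As the brick vanishes at
      1, 2, 3, the map \<eta> at vertex 4 kills \<open>A\<close> and takes equal values at
      \<open>x\<close> and \<open>y\<close>. The conditions at 7 and 8 then express this common
      value as \<open>- \<mu> x\<close> and as \<open>- \<kappa> y\<close>.\<close>
    define \<zeta> where "\<zeta> a z = (if a = (4, 5) then smul B (\<kappa> z) u + smul B (\<mu> z) w else 0)" for a :: "nat \<times> nat" and z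
    have "linear_map_on (smul X) (space X (tail Q8 a)) (smul B) (space B (head Q8 a)) (\<zeta> a)" if a: "a \<in> arcs Q8" for a
    proof (cases "a = (4, 5)")
      case True
      have "smul B c u + smul B c' w \<in> space B 5" for c c'
        using b.subspace_add[OF is_repD(3)[OF B(1) V(5)]] b.subspace_scale[OF is_repD(3)[OF B(1) V(5)]] mem by blast
      then show ?thesis
        using l True by (auto simp: \<zeta>_def tail_head_Q8 linear_map_on_def Vector_Spaces.linear_iff
            b.scale_left_distrib b.scale_right_distrib)
    next
      case False
      then have "\<zeta> a = (\<lambda>z. 0)" by (auto simp: \<zeta>_def)
      then show ?thesis using linear_map_on_const_zero[OF vB is_repD(3)[OF B(1) head_in_verts[OF a]]] by simp
    qed
    then obtain \<eta> where \<eta>: "\<And>i. i \<in> verts Q8 \<Longrightarrow> linear_map_on (smul X) (space X i) (smul B) (space B i) (\<eta> i)"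
        "\<And>a z. a \<in> arcs Q8 \<Longrightarrow> z \<in> space X (tail Q8 a) \<Longrightarrow>
          \<zeta> a z = \<eta> (head Q8 a) (amap X a z) - amap B a (\<eta> (tail Q8 a) z)"
      by (rule Ext1_vanishes_coboundary[OF rX B(1) EXB]) (assumption, (rule that; assumption))
    have e: "\<zeta> (i, j) z = \<eta> j (M (i, j) z) - amap B (i, j) (\<eta> i z)" if "(i, j) \<in> arcs Q8" "z \<in> space X i" for i j z
      using \<eta>(2)[OF that(1), of z] that(2) Mam[OF that] by (simp add: tail_head_Q8)
    have \<eta>0: "\<eta> i 0 = 0" if "i \<in> verts Q8" for i
      by (rule linear_map_on_zero_diff(1)[OF \<eta>(1)[OF that] vX vB sub[OF that]])
    note lB = is_repD(4)[OF B(1)]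
    have in5: "\<eta> 5 z \<in> space B 5" if "z \<in> space X 5" for z by (rule linear_map_onD(1)[OF \<eta>(1)[OF V(5)] that])
    have in4: "\<eta> 4 z \<in> space B 4" if "z \<in> space X 4" for z by (rule linear_map_onD(1)[OF \<eta>(1)[OF V(4)] that])
    have s5: "smul B c u \<in> space B 5" "smul B c w \<in> space B 5" for c
      using b.subspace_scale[OF is_repD(3)[OF B(1) V(5)]] mem by auto
    have F: "amap B (5, 7) z = smul B (cw z) (amap B (5, 7) w)" "amap B (5, 8) z = smul B (cu z) (amap B (5, 8) u)"
      if z: "z \<in> space B 5" for z
    proof -
      have "amap B (5, 7) (smul B (cu z) u + smul B (cw z) w) = smul B (cw z) (amap B (5, 7) w)"
        using linear_map_onD[OF lB[OF ar(6)]] s5 mem Bf by (simp add: tail_head_Q8)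
      then show "amap B (5, 7) z = smul B (cw z) (amap B (5, 7) w)" using c5[OF z] by simp
      have "amap B (5, 8) (smul B (cu z) u + smul B (cw z) w) = smul B (cu z) (amap B (5, 8) u)"
        using linear_map_onD[OF lB[OF ar(7)]] s5 mem Bf by (simp add: tail_head_Q8)
      then show "amap B (5, 8) z = smul B (cu z) (amap B (5, 8) u)" using c5[OF z] by simp
    qed
    have D: "amap B (4, 5) z = smul B (c4 z) (u + w)" if z: "z \<in> space B 4" for z
    proof -
      have "amap B (4, 5) (smul B (c4 z) v) = smul B (c4 z) (u + w)"
        using linear_map_onD(3)[OF lB[OF ar(4)]] mem Bd by (simp add: tail_head_Q8)
      then show ?thesis using c4[OF z] by simp
    qed
    have "\<eta> 4 (M (i, 4) t) = 0" if "(i, 4) \<in> arcs Q8" "t \<in> space X i" for i t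
    proof -
      have "i = 1 \<or> i = 2 \<or> i = 3" using that(1) by (auto simp: arcs_Q8 simp del: One_nat_def)
      then have "\<eta> i t = 0" using linear_map_onD(1)[OF \<eta>(1), of i t] that(2) triv V by blast
      then show ?thesis using e[OF that] B0[OF that(1)] by (simp add: \<zeta>_def)
    qed
    then have "\<eta> 4 (x - y) = 0" using A_kill[OF \<eta>(1)[OF V(4)] _ xy(3)] by blast
    then have eq4: "\<eta> 4 x = \<eta> 4 y" using linear_map_on_zero_diff(2)[OF \<eta>(1)[OF V(4)] vX vB sub[OF V(4)] xy(1,2)] by simp
    have comp: "cu (smul B a u + smul B c w) = a" "cw (smul B a u + smul B c w) = c" for a c
      using cl cv by (simp_all add: Vector_Spaces.linear_iff)
    have \<zeta>45: "\<eta> 5 (M (4, 5) z) = smul B (\<kappa> z + c4 (\<eta> 4 z)) u + smul B (\<mu> z + c4 (\<eta> 4 z)) w" if z: "z \<in> space X 4" for z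
      using e[OF ar(4) z] D[OF in4[OF z]]
      by (simp add: \<zeta>_def b.scale_left_distrib b.scale_right_distrib algebra_simps)
    have "cw (\<eta> 5 (M (4, 5) x)) = 0"
    proof -
      have "amap B (5, 7) (\<eta> 5 (M (4, 5) x)) = 0"
        using e[OF ar(6) Min[OF ar(4) xy(1)]] xy(4) \<eta>0[OF V(7)] by (simp add: \<zeta>_def)
      then show ?thesis using F(1)[OF in5[OF Min[OF ar(4) xy(1)]]] Bf(3) by simp
    qed
    moreover have "cu (\<eta> 5 (M (4, 5) y)) = 0"
    proof -
      have "amap B (5, 8) (\<eta> 5 (M (4, 5) y)) = 0"
        using e[OF ar(7) Min[OF ar(4) xy(2)]] xy(5) \<eta>0[OF V(8)] by (simp add: \<zeta>_def)
      then show ?thesis using F(2)[OF in5[OF Min[OF ar(4) xy(2)]]] Bf(4) by simp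
    qed
    ultimately have "\<mu> x + c4 (\<eta> 4 x) = 0" "\<kappa> y + c4 (\<eta> 4 y) = 0"
      unfolding \<zeta>45[OF xy(1)] \<zeta>45[OF xy(2)] comp by auto
    then show ?thesis using eq4 by (metis add_right_imp_eq)
  qed
  have lzero: "Vector_Spaces.linear (smul X) (*) (\<lambda>z. 0 :: 'k)"
    by (rule linearI'[OF vX linear_field_vs]) auto
  have sep: "x = 0" if "\<And>\<phi> :: 'v \<Rightarrow> 'k. Vector_Spaces.linear (smul X) (*) \<phi> \<Longrightarrow> \<phi> x = 0" for x
  proof (rule ccontr)
    assume "x \<noteq> 0"
    then have "x \<notin> {0}" by simp
    then show False using functional_separation[OF subspace_single_0, of x] that by (metis zero_neq_one)
  qed
  \<comment> \<open>The maps \<open>endo\<close> vanish at vertex 1, so a nonzero vector there rules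
    out the identity as outcome for an idempotent.\<close>
  obtain x1 where x1: "x1 \<in> space X 1" "x1 \<noteq> 0"
  proof -
    have "space X 1 \<noteq> {0}" using dims(1) dim_zero_subspace by auto
    then show thesis using that subspace_0[OF sub[OF V(1)]] by blast
  qed
  have "split_data (smul X) (space X 4) (space X 5) (space X 7) (space X 8) A (M (4, 5)) (M (5, 6)) (M (5, 7)) (M (5, 8))"
  proof (rule split_data.intro[OF vX split_data_axioms.intro])
    show "\<exists>z\<in>space X 5. M (5, 6) z = 0 \<and> M (5, 7) z = r" if "r \<in> space X 7" for r
      using from_Ext_BX[OF subspace_0[OF sub[OF V(5)]] that subspace_0[OF sub[OF V(8)]]] by blast
    show "\<exists>z\<in>space X 5. M (5, 6) z = 0 \<and> M (5, 8) z = r" if "r \<in> space X 8" for r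
      using from_Ext_BX[OF subspace_0[OF sub[OF V(5)]] subspace_0[OF sub[OF V(7)]] that] by blast
    show "\<exists>x\<in>space X 4. \<exists>p\<in>space X 5. \<exists>q\<in>space X 5. z = M (4, 5) x + p + q \<and>
        M (5, 6) p = 0 \<and> M (5, 7) p = 0 \<and> M (5, 6) q = 0 \<and> M (5, 8) q = 0" if z: "z \<in> space X 5" for z
    proof -
      obtain y m n where *: "y \<in> space X 4" "m \<in> space X 5" "n \<in> space X 5" "M (5, 6) m = 0" "M (5, 6) n = 0"
          "M (5, 7) m = 0" "M (5, 8) n = 0" "z = m + n - M (4, 5) y"
        using from_Ext_BX[OF z subspace_0[OF sub[OF V(7)]] subspace_0[OF sub[OF V(8)]]] by blast
      have "z = M (4, 5) (- y) + m + n" using *(8) vv.linear_neg[OF M(1)[OF ar(4)]] by simp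
      then show ?thesis using * subspace_neg[OF sub[OF V(4)] *(1)] by blast
    qed
    show "x = 0 \<and> y = 0" if xy: "x \<in> space X 4" "y \<in> space X 4" "x - y \<in> A" "M (5, 7) (M (4, 5) x) = 0"
        "M (5, 8) (M (4, 5) y) = 0" for x y
    proof
      \<comment> \<open>With one of the two functionals zero, \<open>\<kappa> y = \<mu> x\<close>
        makes the other vanish at its argument, and functionals separate points.\<close>
      show "x = 0"
      proof (rule sep)
        fix \<phi> :: "'v \<Rightarrow> 'k" assume "Vector_Spaces.linear (smul X) (*) \<phi>"
        from from_Ext_XB[OF xy lzero this] show "\<phi> x = 0" by simp
      qed
      show "y = 0"
      proof (rule sep)
        fix \<phi> :: "'v \<Rightarrow> 'k" assume "Vector_Spaces.linear (smul X) (*) \<phi>"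
        from from_Ext_XB[OF xy this lzero] show "\<phi> y = 0" by simp
      qed
    qed
    show "h5 z = 0" if l: "Vector_Spaces.linear (smul X) (smul X) h4" "Vector_Spaces.linear (smul X) (smul X) h5"
        "Vector_Spaces.linear (smul X) (smul X) h7" "Vector_Spaces.linear (smul X) (smul X) h8"
        and m: "\<forall>x\<in>space X 4. h4 x \<in> space X 4" "\<forall>z\<in>space X 5. h5 z \<in> space X 5" "\<forall>r\<in>space X 7. h7 r \<in> space X 7"
          "\<forall>r\<in>space X 8. h8 r \<in> space X 8"
        and i: "\<forall>x\<in>space X 4. h4 (h4 x) = h4 x" "\<forall>z\<in>space X 5. h5 (h5 z) = h5 z"
          "\<forall>r\<in>space X 7. h7 (h7 r) = h7 r" "\<forall>r\<in>space X 8. h8 (h8 r) = h8 r"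
        and c: "\<forall>a\<in>A. h4 a = 0" "\<forall>x\<in>space X 4. h5 (M (4, 5) x) = M (4, 5) (h4 x)" "\<forall>z\<in>space X 5. M (5, 6) (h5 z) = 0"
          "\<forall>z\<in>space X 5. h7 (M (5, 7) z) = M (5, 7) (h5 z)" "\<forall>z\<in>space X 5. h8 (M (5, 8) z) = M (5, 8) (h5 z)"
        and z: "z \<in> space X 5" for h4 h5 h7 h8 z
    proof -
      have hom: "is_hom Q8 X X (endo h4 h5 h7 h8)"
      proof (rule is_hom_endo[OF rX l m])
        show "\<forall>v\<in>space X 1. h4 (amap X (1, 4) v) = 0" "\<forall>v\<in>space X 2. h4 (amap X (2, 4) v) = 0"
          "\<forall>v\<in>space X 3. h4 (amap X (3, 4) v) = 0"
          using A_gen[OF ar(1)] A_gen[OF ar(2)] A_gen[OF ar(3)] Mam ar c(1) by metis+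
        show "\<forall>v\<in>space X 4. h5 (amap X (4, 5) v) = amap X (4, 5) (h4 v)" using c(2) Mam[OF ar(4)] m by metis
        show "\<forall>v\<in>space X 5. amap X (5, 6) (h5 v) = 0" using c(3) Mam[OF ar(5)] m by metis
        show "\<forall>v\<in>space X 5. h7 (amap X (5, 7) v) = amap X (5, 7) (h5 v)" using c(4) Mam[OF ar(6)] m by metis
        show "\<forall>v\<in>space X 5. h8 (amap X (5, 8) v) = amap X (5, 8) (h5 v)" using c(5) Mam[OF ar(7)] m by metis
      qed
      have "endo h4 h5 h7 h8 i (endo h4 h5 h7 h8 i y) = endo h4 h5 h7 h8 i y" if "y \<in> space X i" for i y
        using that i by (auto simp: endo_def)
      then have "(\<forall>i\<in>verts Q8. \<forall>v\<in>space X i. endo h4 h5 h7 h8 i v = 0) \<or>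
          (\<forall>i\<in>verts Q8. \<forall>v\<in>space X i. endo h4 h5 h7 h8 i v = v)"
        using idempotent_endomorphism[OF ind hom] by blast
      then show "h5 z = 0"
      proof
        assume "\<forall>i\<in>verts Q8. \<forall>v\<in>space X i. endo h4 h5 h7 h8 i v = 0"
        from bspec[OF bspec[OF this V(5)] z] show ?thesis unfolding endo_simps .
      next
        assume "\<forall>i\<in>verts Q8. \<forall>v\<in>space X i. endo h4 h5 h7 h8 i v = v"
        from bspec[OF bspec[OF this V(1)] x1(1)] show ?thesis unfolding endo_simps using x1(2) by simp
      qed
    qed
    have "M (5, 6) ` space X 5 \<subseteq> space X 6" using Min[OF ar(5)] by blast
    then show "dim (M (5, 6) ` space X 5) \<le> 2"
      using fd_subspace_dim_mono(2)[OF fd[OF V(6)] fd_subspaceD[OF fdi(1)[OF ar(5) V(5)]]] dims(6) by simp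
  qed (use fd V fdA A4 M(1) ar Min dims dA in blast)+
  then show False by (rule split_data.impossible)
qed

theorem theorem2p1:
  shows "positive_real_root Q8 alpha8 \<and>
    (\<forall>X :: ('k::field, 'v::ab_group_add, nat, nat \<times> nat) qrep.
       is_indec_of Q8 alpha8 X \<longrightarrow>
       \<not> (\<exists>\<beta> (B :: ('k, 'w::ab_group_add, nat, nat \<times> nat) qrep).
            real_schur_root Q8 \<beta> B \<and>
            X \<in> M_both Q8 B \<and>
            (Hom_nonzero Q8 X B \<or> Hom_nonzero Q8 B X)))"
proof (intro conjI allI impI notI)
  show "positive_real_root Q8 alpha8" by (rule positive_real_root_alpha8)
  fix X :: "('k, 'v, nat, nat \<times> nat) qrep"
  assume X: "is_indec_of Q8 alpha8 X"
  assume "\<exists>\<beta> (B :: ('k, 'w, nat, nat \<times> nat) qrep). real_schur_root Q8 \<beta> B \<and> X \<in> M_both Q8 B \<and>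
      (Hom_nonzero Q8 X B \<or> Hom_nonzero Q8 B X)"
  then obtain \<beta> and B :: "('k, 'w, nat, nat \<times> nat) qrep" where B: "real_schur_root Q8 \<beta> B"
    and MB: "X \<in> M_both Q8 B" and Hom: "Hom_nonzero Q8 X B \<or> Hom_nonzero Q8 B X" by blast
  interpret fin_digraph Q8 by (rule fin_digraph_Q8)
  have root: "positive_real_root Q8 \<beta>" and EB: "End_is_field Q8 B" and dB: "dim_vec Q8 B = \<beta>" and iB: "indecomposable Q8 B"
    using B by (auto simp: real_schur_root_def is_indec_of_def)
  have iX: "indecomposable Q8 X" and dX: "dim_vec Q8 X = alpha8" using X by (auto simp: is_indec_of_def)
  have rX: "is_rep Q8 X" "\<not> is_zero_rep Q8 X" and rB: "is_rep Q8 B"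
    using iX iB by (auto simp: indecomposable_def)
  have up: "X \<in> M_upper Q8 B" and low: "X \<in> M_lower Q8 B" using MB by (auto simp: M_both_def)
  have EBX: "Ext1_vanishes Q8 B X" and EXB: "Ext1_vanishes Q8 X B"
    using up low by (auto simp: M_upper_def M_lower_def)
  note no_mono = M_upper_no_mono[OF up rX(2) rB] and no_epi = M_lower_no_epi[OF low rX(2)]
  \<comment> \<open>Equal dimension vectors would turn the remaining epimorphism or monomorphism
    into an isomorphism, which the two subcategories exclude as well.\<close>
  have "(\<forall>i. \<beta> i \<le> alpha8 i) \<and> \<beta> \<noteq> alpha8"
    using Hom
  proof
    assume "Hom_nonzero Q8 X B"
    then obtain f i v where f: "is_hom Q8 X B f" "i \<in> verts Q8" "v \<in> space X i" "f i v \<noteq> 0"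
      by (auto simp: Hom_nonzero_def)
    have "is_epi Q8 X B f"
      using mono_or_epi_to_brick[OF iX rB EB EBX f] no_mono by blast
    then show ?thesis using epi_dim_vec[OF rX(1) rB] no_mono unfolding dX dB by blast
  next
    assume "Hom_nonzero Q8 B X"
    then obtain f i v where f: "is_hom Q8 B X f" "i \<in> verts Q8" "v \<in> space B i" "f i v \<noteq> 0"
      by (auto simp: Hom_nonzero_def)
    have "is_mono Q8 B X f"
      using mono_or_epi_from_brick[OF iX rB EB EXB f] no_epi by blast
    then show ?thesis using mono_dim_vec[OF rB rX(1)] no_epi unfolding dX dB by blast
  qed
  moreover have "\<beta> = alpha8 \<or> \<beta> = vec8 [0, 0, 0, 1, 2, 0, 1, 1]"
  proof (rule Euler_form_candidates)
    show "0 \<le> \<beta> i \<and> \<beta> i \<le> alpha8 i" for i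
      using calculation root by (auto simp: positive_real_root_def)
    show "\<beta> i = 0" if "i \<notin> verts Q8" for i using that by (simp add: dim_vec_def flip: dB)
    show "ringel_form Q8 \<beta> \<beta> = 1" by (rule ringel_form_root[OF _ root]) (auto simp: Q8_simps)
    show "ringel_form Q8 alpha8 \<beta> \<ge> 0" "ringel_form Q8 \<beta> alpha8 \<ge> 0"
      using ringel_form_Ext1_vanishes(1)[OF rX(1) rB EXB] ringel_form_Ext1_vanishes(1)[OF rB rX(1) EBX]
      by (simp_all add: dX dB)
    show "ringel_form Q8 alpha8 \<beta> > 0 \<or> ringel_form Q8 \<beta> alpha8 > 0"
      using Hom ringel_form_Ext1_vanishes(2)[OF rX(1) rB EXB] ringel_form_Ext1_vanishes(2)[OF rB rX(1) EBX]
      by (auto simp: dX dB)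
  qed
  ultimately have "dim_vec Q8 B = vec8 [0, 0, 0, 1, 2, 0, 1, 1]" using dB by blast
  then show False by (rule no_brick_below_alpha8[OF X rB EB _ EBX EXB])
qed

end
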